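(* Assume the Standing Assumption below holds. Let $t\in[0,T)$, $x\in\mathbb{R}^d$, $g\in C^1(\mathbb{R}^d)$ and $f\in C^1([0,T]\times\mathbb{R}^d)$, both with bounded first-order derivatives. Then $$\sup_{s\in[t,T)}\mathbb{E}\left|\frac{g(X_T^{s,x})-g(x)}{T-s}\int_s^T\big[\sigma(r,X_r^{s,x})^{-1}D_r^{s,x}\big]^{\mathrm T}\,\mathrm{d}W_r\right|^2<+\infty,$$ and $$\int_t^T\mathbb{E}\left|\frac{f(s,X_s^{t,x})-f(t,x)}{s-t}\int_t^s\big[\sigma(r,X_r^{t,x})^{-1}D_r^{t,x}\big]^{\mathrm T}\,\mathrm{d}W_r\right|^2\mathrm{d}s<+\infty.$$
   Context: Let $T>0$, $d\in\mathbb{N}^+$, and let $(\Omega,\mathbb{F},\{\mathcal{F}_t\}_{0\le t\le T},\mathbb{P})$ be a filtered probability space carrying a $d$-dimensional standard Brownian motion $W=(W^1,\dots,W^d)^{\mathrm T}$ with $W_0=0$. Let $\mu:[0,T]\times\mathbb{R}^d\to\mathbb{R}^d$ and $\sigma=(\sigma_1,\dots,\sigma_d):[0,T]\times\mathbb{R}^d\to\mathbb{R}^{d\times d}$, where $\sigma_j$ denotes the $j$-th column of $\sigma$. Standing Assumption: $\mu$ and $\sigma$ are continuously differentiable in $t$ and $x$; $\nabla_x\mu$ and $\nabla_x\sigma_j$ ($j=1,\dots,d$) are bounded continuous functions $[0,T]\times\mathbb{R}^d\to\mathbb{R}^{d\times d}$; $\mu(t,0)$ and $\sigma(t,0)$ are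 bounded for $t\in[0,T]$; and there are constants $0<m\le M<\infty$ with $m|y|^2\le y^{\mathrm T}\sigma\sigma^{\mathrm T}(t,x)y\le M|y|^2$ for all $x,y\in\mathbb{R}^d$, $t\in[0,T]$ ($|\cdot|$ is the Euclidean norm). For $(t,x)\in[0,T]\times\mathbb{R}^d$, $X^{t,x}$ is the solution of $X_s^{t,x}=x+\int_t^s\mu(r,X_r^{t,x})\,\mathrm{d}r+\int_t^s\sigma(r,X_r^{t,x})\,\mathrm{d}W_r$, $s\in[t,T]$, and $D^{t,x}$ is the $\mathbb{R}^{d\times d}$-valued variational (Jacobian) process $D_s^{t,x}=\mathrm{I}_d+\int_t^s\nabla_x\mu(r,X_r^{t,x})D_r^{t,x}\,\mathrm{d}r+\sum_{j=1}^d\int_t^s\nabla_x\sigma_j(r,X_r^{t,x})D_r^{t,x}\,\mathrm{d}W_r^j$. *)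

theory Defs
  imports "HOL-Probability.Probability"
begin

definition filtered_prob_space :: "'w measure \<Rightarrow> (real \<Rightarrow> 'w measure) \<Rightarrow> bool" where
  "filtered_prob_space M F \<longleftrightarrow> prob_space M \<and> filtration (space M) F \<and> (\<forall>t. sets (F t) \<subseteq> sets M)"

definition brownian_motion ::
  "'w measure \<Rightarrow> (real \<Rightarrow> 'w measure) \<Rightarrow> real \<Rightarrow> (real \<Rightarrow> 'w \<Rightarrow> real^'d::finite) \<Rightarrow> bool" where
  "brownian_motion M F T W \<longleftrightarrow>
     (\<forall>\<omega>\<in>space M. W 0 \<omega> = 0) \<and>
     (\<forall>\<omega>\<in>space M. continuous_on {0..T} (\<lambda>t. W t \<omega>)) \<and>
     (\<forall>t\<in>{0..T}. W t \<in> borel_measurable (F t)) \<and>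
     (\<forall>s t. 0 \<le> s \<longrightarrow> s < t \<longrightarrow> t \<le> T \<longrightarrow>
        distributed M lborel (\<lambda>\<omega>. W t \<omega> - W s \<omega>)
          (\<lambda>z. ennreal (\<Prod>i\<in>UNIV. normal_density 0 (sqrt (t - s)) (z $ i))) \<and>
        (\<forall>A\<in>sets (F s). \<forall>B\<in>sets (borel :: (real^'d) measure).
           measure M (A \<inter> {\<omega>\<in>space M. W t \<omega> - W s \<omega> \<in> B})
             = measure M A * measure M {\<omega>\<in>space M. W t \<omega> - W s \<omega> \<in> B}))"

definition simple_ito ::
  "'w measure \<Rightarrow> (real \<Rightarrow> 'w measure) \<Rightarrow> (real \<Rightarrow> 'w \<Rightarrow> real) \<Rightarrow> real \<Rightarrow> real \<Rightarrow>
   (real \<Rightarrow> 'w \<Rightarrow> real) \<Rightarrow> ('w \<Rightarrow> real) \<Rightarrow> bool" where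
  "simple_ito M F B a b H I \<longleftrightarrow>
     (\<exists>(n::nat) (\<tau>::nat \<Rightarrow> real) (\<xi>::nat \<Rightarrow> 'w \<Rightarrow> real).
        \<tau> 0 = a \<and> \<tau> n = b \<and> (\<forall>k<n. \<tau> k < \<tau> (Suc k)) \<and>
        (\<forall>k<n. \<xi> k \<in> borel_measurable (F (\<tau> k)) \<and> (\<exists>C. \<forall>\<omega>\<in>space M. \<bar>\<xi> k \<omega>\<bar> \<le> C)) \<and>
        (\<forall>r\<in>{a<..b}. \<forall>\<omega>\<in>space M.
            H r \<omega> = (\<Sum>k<n. \<xi> k \<omega> * indicator {\<tau> k<..\<tau> (Suc k)} r)) \<and>
        (\<forall>\<omega>\<in>space M. I \<omega> = (\<Sum>k<n. \<xi> k \<omega> * (B (\<tau> (Suc k)) \<omega> - B (\<tau> k) \<omega>))))"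

definition is_ito_integral ::
  "'w measure \<Rightarrow> (real \<Rightarrow> 'w measure) \<Rightarrow> (real \<Rightarrow> 'w \<Rightarrow> real) \<Rightarrow> real \<Rightarrow> real \<Rightarrow>
   (real \<Rightarrow> 'w \<Rightarrow> real) \<Rightarrow> ('w \<Rightarrow> real) \<Rightarrow> bool" where
  "is_ito_integral M F B a b H Y \<longleftrightarrow>
     Y \<in> borel_measurable M \<and>
     (\<exists>Hs Is. (\<forall>n. simple_ito M F B a b (Hs n) (Is n)) \<and>
        ((\<lambda>n. \<integral>\<^sup>+\<omega>. (\<integral>\<^sup>+r\<in>{a..b}. ennreal ((Hs n r \<omega> - H r \<omega>)\<^sup>2) \<partial>lborel) \<partial>M)
           \<longlonglongrightarrow> 0) \<and>
        ((\<lambda>n. \<integral>\<^sup>+\<omega>. ennreal ((Is n \<omega> - Y \<omega>)\<^sup>2) \<partial>M) \<longlonglongrightarrow> 0))"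

definition ito_integral ::
  "'w measure \<Rightarrow> (real \<Rightarrow> 'w measure) \<Rightarrow> (real \<Rightarrow> 'w \<Rightarrow> real) \<Rightarrow> real \<Rightarrow> real \<Rightarrow>
   (real \<Rightarrow> 'w \<Rightarrow> real) \<Rightarrow> 'w \<Rightarrow> real" where
  "ito_integral M F B a b H = (SOME Y. is_ito_integral M F B a b H Y)"

definition ito_vec ::
  "'w measure \<Rightarrow> (real \<Rightarrow> 'w measure) \<Rightarrow> (real \<Rightarrow> 'w \<Rightarrow> real^'d::finite) \<Rightarrow> real \<Rightarrow> real \<Rightarrow>
   (real \<Rightarrow> 'w \<Rightarrow> real^'d^'d) \<Rightarrow> 'w \<Rightarrow> real^'d" where
  "ito_vec M F W a b S = (\<lambda>\<omega>. \<chi> i. \<Sum>j\<in>UNIV.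
      ito_integral M F (\<lambda>r \<omega>'. W r \<omega>' $ j) a b (\<lambda>r \<omega>'. S r \<omega>' $ i $ j) \<omega>)"

definition ito_mat ::
  "'w measure \<Rightarrow> (real \<Rightarrow> 'w measure) \<Rightarrow> (real \<Rightarrow> 'w \<Rightarrow> real^'d::finite) \<Rightarrow> real \<Rightarrow> real \<Rightarrow>
   ('d \<Rightarrow> real \<Rightarrow> 'w \<Rightarrow> real^'d^'d) \<Rightarrow> 'w \<Rightarrow> real^'d^'d" where
  "ito_mat M F W a b G = (\<lambda>\<omega>. \<chi> k l. \<Sum>j\<in>UNIV.
      ito_integral M F (\<lambda>r \<omega>'. W r \<omega>' $ j) a b (\<lambda>r \<omega>'. G j r \<omega>' $ k $ l) \<omega>)"

definition col :: "'d::finite \<Rightarrow> real^'d^'d \<Rightarrow> real^'d" where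
  "col j A = (\<chi> i. A $ i $ j)"

definition standing_assumption ::
  "real \<Rightarrow> (real \<Rightarrow> real^'d \<Rightarrow> real^'d) \<Rightarrow> (real \<Rightarrow> real^'d \<Rightarrow> real^'d^'d) \<Rightarrow>
   (real \<Rightarrow> real^'d \<Rightarrow> real^'d^'d) \<Rightarrow> ('d \<Rightarrow> real \<Rightarrow> real^'d \<Rightarrow> real^'d^'d) \<Rightarrow> bool" where
  "standing_assumption T \<mu> \<sigma> Dmu Dsig \<longleftrightarrow>
     (\<exists>Tmu. (\<forall>t\<in>{0..T}. \<forall>x.
        ((\<lambda>p. \<mu> (fst p) (snd p)) has_derivative (\<lambda>(h,k). h *\<^sub>R Tmu t x + Dmu t x *v k))
          (at (t,x) within {0..T} \<times> UNIV)) \<and>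
        continuous_on ({0..T} \<times> UNIV) (\<lambda>p. Tmu (fst p) (snd p)) \<and>
        continuous_on ({0..T} \<times> UNIV) (\<lambda>p. Dmu (fst p) (snd p))) \<and>
     (\<forall>j. \<exists>Tsig. (\<forall>t\<in>{0..T}. \<forall>x.
        ((\<lambda>p. col j (\<sigma> (fst p) (snd p))) has_derivative (\<lambda>(h,k). h *\<^sub>R Tsig t x + Dsig j t x *v k))
          (at (t,x) within {0..T} \<times> UNIV)) \<and>
        continuous_on ({0..T} \<times> UNIV) (\<lambda>p. Tsig (fst p) (snd p)) \<and>
        continuous_on ({0..T} \<times> UNIV) (\<lambda>p. Dsig j (fst p) (snd p))) \<and>
     (\<exists>C. \<forall>t\<in>{0..T}. \<forall>x. norm (Dmu t x) \<le> C \<and> (\<forall>j. norm (Dsig j t x) \<le> C)) \<and>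
     (\<exists>C. \<forall>t\<in>{0..T}. norm (\<mu> t 0) \<le> C \<and> norm (\<sigma> t 0) \<le> C) \<and>
     (\<exists>m M. 0 < m \<and> m \<le> M \<and> (\<forall>t\<in>{0..T}. \<forall>x y.
        m * (norm y)\<^sup>2 \<le> y \<bullet> ((\<sigma> t x ** transpose (\<sigma> t x)) *v y) \<and>
        y \<bullet> ((\<sigma> t x ** transpose (\<sigma> t x)) *v y) \<le> M * (norm y)\<^sup>2))"

definition sde_solution ::
  "'w measure \<Rightarrow> (real \<Rightarrow> 'w measure) \<Rightarrow> (real \<Rightarrow> 'w \<Rightarrow> real^'d::finite) \<Rightarrow> real \<Rightarrow>
   (real \<Rightarrow> real^'d \<Rightarrow> real^'d) \<Rightarrow> (real \<Rightarrow> real^'d \<Rightarrow> real^'d^'d) \<Rightarrow>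
   real \<Rightarrow> real^'d \<Rightarrow> (real \<Rightarrow> 'w \<Rightarrow> real^'d) \<Rightarrow> bool" where
  "sde_solution M F W T \<mu> \<sigma> t x X \<longleftrightarrow>
     (\<forall>s\<in>{t..T}. X s \<in> borel_measurable (F s)) \<and>
     (\<forall>\<omega>\<in>space M. continuous_on {t..T} (\<lambda>s. X s \<omega>)) \<and>
     (\<forall>s\<in>{t..T}. AE \<omega> in M.
        X s \<omega> = x + (LINT r:{t..s}|lborel. \<mu> r (X r \<omega>))
                  + ito_vec M F W t s (\<lambda>r \<omega>'. \<sigma> r (X r \<omega>')) \<omega>)"

definition variational_solution ::
  "'w measure \<Rightarrow> (real \<Rightarrow> 'w measure) \<Rightarrow> (real \<Rightarrow> 'w \<Rightarrow> real^'d::finite) \<Rightarrow> real \<Rightarrow>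
   (real \<Rightarrow> real^'d \<Rightarrow> real^'d^'d) \<Rightarrow> ('d \<Rightarrow> real \<Rightarrow> real^'d \<Rightarrow> real^'d^'d) \<Rightarrow>
   real \<Rightarrow> (real \<Rightarrow> 'w \<Rightarrow> real^'d) \<Rightarrow> (real \<Rightarrow> 'w \<Rightarrow> real^'d^'d) \<Rightarrow> bool" where
  "variational_solution M F W T Dmu Dsig t X D \<longleftrightarrow>
     (\<forall>s\<in>{t..T}. D s \<in> borel_measurable (F s)) \<and>
     (\<forall>\<omega>\<in>space M. continuous_on {t..T} (\<lambda>s. D s \<omega>)) \<and>
     (\<forall>s\<in>{t..T}. AE \<omega> in M.
        D s \<omega> = mat 1 + (LINT r:{t..s}|lborel. Dmu r (X r \<omega>) ** D r \<omega>)
                  + ito_mat M F W t s (\<lambda>j r \<omega>'. Dsig j r (X r \<omega>') ** D r \<omega>') \<omega>)"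

end

theory Submission
  imports Defs
begin

text \<open>After Cauchy--Schwarz both claims reduce to fourth moments of order \<open>(s - t)\<^sup>2\<close> for the increment of
  \<open>X\<close> and for the weight \<open>\<integral> (\<sigma>\<^sup>-\<^sup>1 D)\<^sup>T dW\<close>.  The fourth moment of a stochastic integral is at most
  \<open>36 (b - a) E \<integral> H\<^sup>4\<close>: for step integrands this is Young's inequality applied along the partition, and it
  passes to the limit by Fatou.  Linear growth and Gronwall then bound \<open>E |X|\<^sup>4\<close> and \<open>E |D|\<^sup>4\<close> uniformly in
  the starting time; the a-priori finiteness that Gronwall needs comes from cutting off where
  \<open>\<integral>\<^sub>t\<^sup>s |U|\<^sup>4 dr\<close> exceeds a level.  That the integrands are square integrable at all, so that the integrals in
  the equations denote stochastic integrals, is itself derived from the equations by a continuation argument in time.\<close>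

section \<open>Square distance, path integrals and Gronwall's inequality\<close>

text \<open>Two obstacles shape the argument. \<open>ito_integral\<close> is a choice among square
  integrable limits, so nothing can be read off from it before the integrand is known to be square
  integrable, while \<open>X\<close> and \<open>D\<close> are merely continuous, adapted and satisfy
  their equations almost surely at each fixed time. Moreover, a cutoff such as "running integral at
  most L" concerns the whole path up to time s and cannot be moved inside a stochastic integral. The
  remedy for the second obstacle is a canonical approximating sequence: every integral of a
  continuous adapted process is the limit of the same explicit sums, which depend on the integrand
  path by path. Hence two integrals agree almost surely on the event where their integrands agree,
  and this stands in for optional stopping. All constants are built from T, the growth constant, the
  dimensions and the initial value, never from the starting time, whence the uniformity in the first
  claim. On an interval of length d the fourth moments are of order d^2 and cancel the 1/d^2 of the
  squared difference quotient, so both expectations stay bounded up to the singular time.\<close>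

definition sqdist :: "'a measure \<Rightarrow> ('a \<Rightarrow> real) \<Rightarrow> ('a \<Rightarrow> real) \<Rightarrow> ennreal" where
  "sqdist N f g = (\<integral>\<^sup>+x. ennreal ((f x - g x)\<^sup>2) \<partial>N)"

lemma sqdist_commute: "sqdist N f g = sqdist N g f"
  by (simp add: sqdist_def power2_commute)

lemma sqdist_cong:
  assumes "\<And>x. x \<in> space N \<Longrightarrow> f x = f' x" "\<And>x. x \<in> space N \<Longrightarrow> g x = g' x"
  shows "sqdist N f g = sqdist N f' g'"
  unfolding sqdist_def by (rule nn_integral_cong) (simp add: assms)

lemma power2_diff_triangle: "((x::real) - z)\<^sup>2 \<le> 2 * (x - y)\<^sup>2 + 2 * (y - z)\<^sup>2"
proof -
  have "0 \<le> ((x - y) - (y - z))\<^sup>2" by simp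
  then show ?thesis by (simp add: power2_eq_square algebra_simps)
qed

text \<open>\<open>sqdist\<close> is a squared L2 distance with values in \<open>ennreal\<close>, so
  infinite distances need no side conditions. The price is the factor 2 from (a + b)^2 <= 2 a^2 + 2
  b^2, harmless for convergence to 0 and for finiteness.\<close>

lemma sqdist_triangle:
  assumes [measurable]: "f \<in> borel_measurable N" "g \<in> borel_measurable N" "h \<in> borel_measurable N"
  shows "sqdist N f h \<le> 2 * sqdist N f g + 2 * sqdist N g h"
proof -
  have "sqdist N f h \<le> (\<integral>\<^sup>+x. 2 * ennreal ((f x - g x)\<^sup>2) + 2 * ennreal ((g x - h x)\<^sup>2) \<partial>N)"
    unfolding sqdist_def
  proof (rule nn_integral_mono)
    fix x
    have "ennreal ((f x - h x)\<^sup>2) \<le> ennreal (2 * (f x - g x)\<^sup>2 + 2 * (g x - h x)\<^sup>2)"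
      by (rule ennreal_leI) (rule power2_diff_triangle)
    then show "ennreal ((f x - h x)\<^sup>2) \<le> 2 * ennreal ((f x - g x)\<^sup>2) + 2 * ennreal ((g x - h x)\<^sup>2)"
      by (simp add: ennreal_mult)
  qed
  also have "\<dots> = 2 * sqdist N f g + 2 * sqdist N g h"
    unfolding sqdist_def by (subst nn_integral_add) (simp_all add: nn_integral_cmult)
  finally show ?thesis .
qed

lemma sqdist_eq_0:
  assumes [measurable]: "f \<in> borel_measurable N" "g \<in> borel_measurable N" and "sqdist N f g = 0"
  shows "AE x in N. f x = g x"
proof -
  have "AE x in N. ennreal ((f x - g x)\<^sup>2) = 0"
    using assms(3) unfolding sqdist_def by (subst (asm) nn_integral_0_iff_AE) simp_all
  then show ?thesis by eventually_elim (simp add: ennreal_eq_0_iff)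
qed

text \<open>The squared differences tend to 0 in L1, and L1 convergence yields almost sure
  convergence along a subsequence. Finitely many of the distances may be infinite, so the L1
  argument runs on the tail from \<open>n0\<close> on.\<close>

lemma sqdist_AE_subseq:
  assumes [measurable]: "\<And>n. f n \<in> borel_measurable N" "g \<in> borel_measurable N"
    and lim: "(\<lambda>n. sqdist N (f n) g) \<longlonglongrightarrow> 0"
  obtains r :: "nat \<Rightarrow> nat" where "strict_mono r" "AE x in N. (\<lambda>n. f (r n) x) \<longlonglongrightarrow> g x"
proof -
  have "eventually (\<lambda>n. sqdist N (f n) g < \<top>) sequentially"
    using lim by (rule order_tendstoD) simp
  then obtain n0 where n0: "\<And>n. n \<ge> n0 \<Longrightarrow> sqdist N (f n) g < \<top>"
    by (auto simp: eventually_sequentially)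
  define u where "u = (\<lambda>n x. (f (n + n0) x - g x)\<^sup>2)"
  have int: "integrable N (u n)" for n
    unfolding u_def by (rule integrableI_bounded) (use n0[of "n + n0"] in \<open>auto simp: sqdist_def\<close>)
  have eq: "ennreal (\<integral>x. norm (u n x) \<partial>N) = sqdist N (f (n + n0)) g" for n
    using int[of n] by (simp add: u_def sqdist_def nn_integral_eq_integral)
  have "(\<lambda>n. ennreal (\<integral>x. norm (u n x) \<partial>N)) \<longlonglongrightarrow> ennreal 0"
    unfolding eq using LIMSEQ_ignore_initial_segment[OF lim, of n0] by simp
  then have "(\<lambda>n. \<integral>x. norm (u n x) \<partial>N) \<longlonglongrightarrow> 0"
    by (subst (asm) tendsto_ennreal_iff) auto
  from tendsto_L1_AE_subseq[OF int this]
  obtain r where r: "strict_mono r" "AE x in N. (\<lambda>n. u (r n) x) \<longlonglongrightarrow> 0" by auto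
  show ?thesis
  proof (rule that[of "\<lambda>n. r n + n0"])
    show "strict_mono (\<lambda>n. r n + n0)" using r(1) by (auto simp: strict_mono_def)
    show "AE x in N. (\<lambda>n. f (r n + n0) x) \<longlonglongrightarrow> g x"
      using r(2)
    proof eventually_elim
      case (elim x)
      have "(\<lambda>n. sqrt (u (r n) x)) \<longlonglongrightarrow> sqrt 0" by (intro tendsto_real_sqrt elim)
      then have "(\<lambda>n. \<bar>f (r n + n0) x - g x\<bar>) \<longlonglongrightarrow> 0" by (simp add: u_def)
      then have "(\<lambda>n. f (r n + n0) x - g x) \<longlonglongrightarrow> 0" by (rule tendsto_rabs_zero_cancel)
      then show ?case by (simp add: LIM_zero_iff)
    qed
  qed
qed

text \<open>Almost sure convergence along a subsequence, followed by Fatou. This is the gate through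
  which moment bounds for elementary sums reach their L2 limits: it is applied with the second and
  the fourth power as \<phi>.\<close>

lemma nn_integral_Fatou_sqdist:
  assumes [measurable]: "\<And>n. f n \<in> borel_measurable N" "g \<in> borel_measurable N"
    and lim: "(\<lambda>n. sqdist N (f n) g) \<longlonglongrightarrow> 0"
    and \<phi>: "continuous_on UNIV (\<phi> :: real \<Rightarrow> real)"
    and le: "\<And>n. (\<integral>\<^sup>+x. ennreal (\<phi> (f n x)) \<partial>N) \<le> c"
  shows "(\<integral>\<^sup>+x. ennreal (\<phi> (g x)) \<partial>N) \<le> c"
proof -
  have [measurable]: "\<phi> \<in> borel_measurable borel" using \<phi> by (rule borel_measurable_continuous_onI)
  obtain r where r: "strict_mono r" "AE x in N. (\<lambda>n. f (r n) x) \<longlonglongrightarrow> g x"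
    using sqdist_AE_subseq[OF assms(1,2,3)] by auto
  have "(\<integral>\<^sup>+x. ennreal (\<phi> (g x)) \<partial>N) = (\<integral>\<^sup>+x. liminf (\<lambda>n. ennreal (\<phi> (f (r n) x))) \<partial>N)"
  proof (rule nn_integral_cong_AE)
    show "AE x in N. ennreal (\<phi> (g x)) = liminf (\<lambda>n. ennreal (\<phi> (f (r n) x)))"
      using r(2)
    proof eventually_elim
      case (elim x)
      have "isCont \<phi> (g x)" using \<phi> by (simp add: continuous_on_eq_continuous_at)
      then have "(\<lambda>n. \<phi> (f (r n) x)) \<longlonglongrightarrow> \<phi> (g x)" using elim by (rule isCont_tendsto_compose)
      then have "(\<lambda>n. ennreal (\<phi> (f (r n) x))) \<longlonglongrightarrow> ennreal (\<phi> (g x))" by (rule tendsto_ennrealI)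
      from lim_imp_Liminf[OF sequentially_bot this] show ?case by simp
    qed
  qed
  also have "\<dots> \<le> liminf (\<lambda>n. \<integral>\<^sup>+x. ennreal (\<phi> (f (r n) x)) \<partial>N)"
    by (rule nn_integral_liminf) simp
  also have "\<dots> \<le> limsup (\<lambda>n. \<integral>\<^sup>+x. ennreal (\<phi> (f (r n) x)) \<partial>N)"
    by (rule Liminf_le_Limsup) simp
  also have "\<dots> \<le> c"
    by (rule Limsup_bounded) (simp add: le)
  finally show ?thesis .
qed

text \<open>Riesz-Fischer for functions that need not be square integrable themselves; only their
  mutual distances are controlled. Along indices with successive squared distances at most (1/4)^i,
  the series of 2^i times the squared increments has a finite integral, and Young's inequality y <=
  2^i y^2 + 2^-i turns this pointwise into summability of the increments.\<close>

lemma sqdist_complete: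
  assumes [measurable]: "\<And>n. f n \<in> borel_measurable N"
    and cauchy: "\<And>e::real. e > 0 \<Longrightarrow> \<exists>n0. \<forall>m\<ge>n0. \<forall>n\<ge>n0. sqdist N (f m) (f n) \<le> ennreal e"
  obtains g where "g \<in> borel_measurable N" "(\<lambda>n. sqdist N (f n) g) \<longlonglongrightarrow> 0"
proof -
  have "\<forall>i. \<exists>n0. \<forall>m\<ge>n0. \<forall>n\<ge>n0. sqdist N (f m) (f n) \<le> ennreal ((1/4)^i)"
    by (auto intro: cauchy)
  then obtain k where k: "\<And>i m n. m \<ge> k i \<Longrightarrow> n \<ge> k i \<Longrightarrow> sqdist N (f m) (f n) \<le> ennreal ((1/4)^i)"
    by metis
  define K where "K = (\<lambda>i. Max (k ` {..i}))"
  have K_ge: "k i \<le> K j" if "i \<le> j" for i j unfolding K_def using that by (intro Max_ge) auto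
  define h where "h = (\<lambda>i x. f (K i) x)"
  have [measurable]: "h i \<in> borel_measurable N" for i by (simp add: h_def)
  have small: "sqdist N (h (Suc i)) (h i) \<le> ennreal ((1/4)^i)" for i
    unfolding h_def by (rule k) (auto intro: K_ge)
  have "(\<integral>\<^sup>+x. (\<Sum>i. ennreal (2^i * (h (Suc i) x - h i x)\<^sup>2)) \<partial>N)
      = (\<Sum>i. \<integral>\<^sup>+x. ennreal (2^i * (h (Suc i) x - h i x)\<^sup>2) \<partial>N)"
    by (rule nn_integral_suminf) simp
  also have "\<dots> \<le> (\<Sum>i. ennreal ((1/2)^i))"
  proof (rule suminf_le)
    fix i
    have "(\<integral>\<^sup>+x. ennreal (2^i * (h (Suc i) x - h i x)\<^sup>2) \<partial>N) = ennreal (2^i) * sqdist N (h (Suc i)) (h i)"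
      unfolding sqdist_def by (simp add: ennreal_mult nn_integral_cmult)
    also have "\<dots> \<le> ennreal (2^i) * ennreal ((1/4)^i)" by (rule mult_left_mono[OF small]) simp
    also have "\<dots> = ennreal ((1/2)^i)" by (simp flip: ennreal_mult power_mult_distrib)
    finally show "(\<integral>\<^sup>+x. ennreal (2^i * (h (Suc i) x - h i x)\<^sup>2) \<partial>N) \<le> ennreal ((1/2)^i)" .
  qed simp_all
  also have "\<dots> = ennreal 2"
    using suminf_geometric[of "1/2::real"] by (subst suminf_ennreal2) (auto simp: summable_geometric)
  also have "\<dots> < \<infinity>" by simp
  finally have "AE x in N. (\<Sum>i. ennreal (2^i * (h (Suc i) x - h i x)\<^sup>2)) \<noteq> \<infinity>"
    by (intro nn_integral_noteq_infinite) auto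
  then have conv: "AE x in N. convergent (\<lambda>i. h i x)"
  proof eventually_elim
    case (elim x)
    then have s1: "summable (\<lambda>i. 2^i * (h (Suc i) x - h i x)\<^sup>2)"
      by (intro summable_suminf_not_top) auto
    have s2: "summable (\<lambda>i. (1/2)^i :: real)" by (simp add: summable_geometric)
    have "summable (\<lambda>i. h (Suc i) x - h i x)"
    proof (rule summable_comparison_test'[OF summable_add[OF s1 s2]])
      fix i :: nat
      define y where "y = \<bar>h (Suc i) x - h i x\<bar>"
      define z where "z = (2::real)^i"
      have z: "z > 0" by (simp add: z_def)
      have "0 \<le> (z * y - 1)\<^sup>2 + z * y * 1 + z * z * y * y"
        using z by (simp add: y_def)
      moreover have "0 \<le> (z * y - 1)\<^sup>2" by simp
      ultimately have "z * y \<le> z * z * y\<^sup>2 + 1"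
        by (simp add: power2_eq_square algebra_simps)
      then have "y \<le> z * y\<^sup>2 + 1 / z" using z by (simp add: field_simps)
      then show "norm (h (Suc i) x - h i x) \<le> 2^i * (h (Suc i) x - h i x)\<^sup>2 + (1/2)^i"
        by (simp add: y_def z_def power_divide)
    qed
    then have "convergent (\<lambda>n. \<Sum>i<n. h (Suc i) x - h i x)" by (simp add: summable_iff_convergent)
    then have "convergent (\<lambda>n. h n x - h 0 x)" using sum_lessThan_telescope[of "\<lambda>i. h i x"] by simp
    then have "convergent (\<lambda>n. h n x - h 0 x + h 0 x)" by (intro convergent_add convergent_const)
    then show ?case by simp
  qed
  define g where "g = (\<lambda>x. lim (\<lambda>i. h i x))"
  have g[measurable]: "g \<in> borel_measurable N" unfolding g_def by (rule borel_measurable_lim_metric) simp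
  have "(\<lambda>n. sqdist N (f n) g) \<longlonglongrightarrow> 0"
  proof (rule order_tendstoI)
    fix a :: ennreal assume "0 < a"
    then obtain e' where e': "0 < e'" "e' < a" using dense by blast
    then obtain e where "0 \<le> e" "e' = ennreal e" by (cases e') auto
    with e' have e: "0 < e" "ennreal e < a" by auto
    from cauchy[OF e(1)] obtain n0 where n0: "\<And>m n. m \<ge> n0 \<Longrightarrow> n \<ge> n0 \<Longrightarrow> sqdist N (f m) (f n) \<le> ennreal e" by blast
    have "sqdist N (f n) g \<le> ennreal e" if n: "n \<ge> n0" for n
    proof -
      have "sqdist N (f n) g = (\<integral>\<^sup>+x. liminf (\<lambda>i. ennreal ((f n x - h i x)\<^sup>2)) \<partial>N)"
        unfolding sqdist_def
      proof (rule nn_integral_cong_AE)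
        show "AE x in N. ennreal ((f n x - g x)\<^sup>2) = liminf (\<lambda>i. ennreal ((f n x - h i x)\<^sup>2))"
          using conv
        proof eventually_elim
          case (elim x)
          then have "(\<lambda>i. h i x) \<longlonglongrightarrow> g x" by (simp add: g_def convergent_LIMSEQ_iff)
          then have "(\<lambda>i. ennreal ((f n x - h i x)\<^sup>2)) \<longlonglongrightarrow> ennreal ((f n x - g x)\<^sup>2)"
            by (intro tendsto_ennrealI tendsto_intros)
          from lim_imp_Liminf[OF sequentially_bot this] show ?case by simp
        qed
      qed
      also have "\<dots> \<le> liminf (\<lambda>i. sqdist N (f n) (h i))"
        unfolding sqdist_def by (rule nn_integral_liminf) simp
      also have "\<dots> \<le> limsup (\<lambda>i. sqdist N (f n) (h i))"
        by (rule Liminf_le_Limsup) simp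
      also have "\<dots> \<le> ennreal e"
      proof (rule Limsup_bounded)
        obtain i0 where i0: "(1/4::real)^i0 < e" using e(1) real_arch_pow_inv[of e "1/4"] by auto
        show "\<forall>\<^sub>F i in sequentially. sqdist N (f n) (h i) \<le> ennreal e"
        proof (rule eventually_sequentiallyI)
          fix i assume "i \<ge> i0"
          show "sqdist N (f n) (h i) \<le> ennreal e"
          \<comment> \<open>\<open>K\<close> is nondecreasing but possibly bounded. If
            \<open>K i\<close> is below \<open>n0\<close>, then \<open>n\<close> and
            \<open>K i\<close> are both at least \<open>k i0\<close>, and the tolerance (1/4)^i0 < e
            is used instead.\<close>
          proof (cases "K i \<ge> n0")
            case True then show ?thesis unfolding h_def using n by (intro n0) auto
          next
            case False
            then have "sqdist N (f n) (h i) \<le> ennreal ((1/4)^i0)" unfolding h_def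
              using K_ge[OF \<open>i \<ge> i0\<close>] n by (intro k) auto
            also have "\<dots> \<le> ennreal e" using i0 by (intro ennreal_leI) simp
            finally show ?thesis .
          qed
        qed
      qed
      finally show ?thesis .
    qed
    then show "\<forall>\<^sub>F n in sequentially. sqdist N (f n) g < a"
      using e(2) by (intro eventually_sequentiallyI[of n0]) (auto intro: le_less_trans)
  qed simp
  with g that show ?thesis by blast
qed

section \<open>Joint measurability and path integrals of continuous processes\<close>

lemma borel_measurable_pair_clamp:
  fixes H :: "real \<Rightarrow> 'w \<Rightarrow> real"
  assumes meas: "\<And>r. r \<in> {u..v} \<Longrightarrow> H r \<in> borel_measurable N"
    and cont: "\<And>\<omega>. \<omega> \<in> space N \<Longrightarrow> continuous_on {u..v} (\<lambda>r. H r \<omega>)" and "u \<le> v"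
  shows "(\<lambda>p. H (max u (min v (snd p))) (fst p)) \<in> borel_measurable (N \<Otimes>\<^sub>M lborel)"
proof -
  \<comment> \<open>Time is clamped to [u, v], because nothing is known about \<open>H\<close>
    outside.\<close>
  define c where "c = (\<lambda>r. max u (min v r))"
  have c: "c r \<in> {u..v}" for r using \<open>u \<le> v\<close> by (auto simp: c_def)
  have cc: "continuous_on UNIV c" unfolding c_def by (intro continuous_intros)
  have Hc[measurable]: "H (c r) \<in> borel_measurable N" for r using meas c by blast
  show ?thesis
  \<comment> \<open>Sampling the time at floor(i r) / i leaves countably many sections, each of them
    measurable; continuity of the paths recovers the process in the limit.\<close>
  proof (rule borel_measurable_LIMSEQ_metric)
    fix i :: nat
    show "(\<lambda>p. H (c (real_of_int \<lfloor>real i * snd p\<rfloor> / real i)) (fst p)) \<in> borel_measurable (N \<Otimes>\<^sub>M lborel)"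
    proof (rule measurable_compose_countable[where f="\<lambda>k p. H (c (real_of_int k / real i)) (fst p)"])
      show "(\<lambda>p. \<lfloor>real i * snd p\<rfloor>) \<in> N \<Otimes>\<^sub>M lborel \<rightarrow>\<^sub>M count_space UNIV" by measurable
    qed measurable
  next
    fix p assume p: "p \<in> space (N \<Otimes>\<^sub>M (lborel :: real measure))"
    then have \<omega>: "fst p \<in> space N" by (auto simp: space_pair_measure)
    have "continuous_on UNIV (\<lambda>r. H (c r) (fst p))"
      by (rule continuous_on_compose2[OF cont[OF \<omega>] cc]) (use c in auto)
    then have ic: "isCont (\<lambda>r. H (c r) (fst p)) (snd p)" by (simp add: continuous_on_eq_continuous_at)
    have "(\<lambda>n. real_of_int \<lfloor>real n * snd p\<rfloor> / real n) \<longlonglongrightarrow> snd p"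
    proof (rule real_tendsto_sandwich)
      show "\<forall>\<^sub>F n in sequentially. snd p - 1 / real n \<le> real_of_int \<lfloor>real n * snd p\<rfloor> / real n"
      proof (rule eventually_sequentiallyI[of 1])
        fix n :: nat assume "1 \<le> n"
        have "real n * snd p - 1 \<le> real_of_int \<lfloor>real n * snd p\<rfloor>" by linarith
        then have "(real n * snd p - 1) / real n \<le> real_of_int \<lfloor>real n * snd p\<rfloor> / real n"
          by (rule divide_right_mono) simp
        then show "snd p - 1 / real n \<le> real_of_int \<lfloor>real n * snd p\<rfloor> / real n"
          using \<open>1 \<le> n\<close> by (simp add: diff_divide_distrib)
      qed
      show "\<forall>\<^sub>F n in sequentially. real_of_int \<lfloor>real n * snd p\<rfloor> / real n \<le> snd p"
        by (rule eventually_sequentiallyI[of 1]) (simp add: field_simps)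
      show "(\<lambda>n. snd p - 1 / real n) \<longlonglongrightarrow> snd p"
        using tendsto_diff[OF tendsto_const lim_1_over_n, of "snd p"] by simp
    qed simp
    from isCont_tendsto_compose[OF ic this]
    show "(\<lambda>n. H (c (real_of_int \<lfloor>real n * snd p\<rfloor> / real n)) (fst p)) \<longlonglongrightarrow> H (max u (min v (snd p))) (fst p)"
      by (simp add: c_def)
  qed
qed

lemma borel_measurable_pair_on:
  fixes H :: "real \<Rightarrow> 'w \<Rightarrow> real"
  assumes meas: "\<And>r. r \<in> {u..v} \<Longrightarrow> H r \<in> borel_measurable N"
    and cont: "\<And>\<omega>. \<omega> \<in> space N \<Longrightarrow> continuous_on {u..v} (\<lambda>r. H r \<omega>)"
    and A: "A \<in> sets borel" "A \<subseteq> {u..v}"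
  shows "(\<lambda>p. H (snd p) (fst p) * indicator A (snd p)) \<in> borel_measurable (N \<Otimes>\<^sub>M lborel)"
proof (cases "u \<le> v")
  case True
  have [measurable]: "A \<in> sets lborel" using A by simp
  have "(\<lambda>p. H (snd p) (fst p) * indicator A (snd p)) =
    (\<lambda>p. H (max u (min v (snd p))) (fst p) * indicator A (snd p))"
    using A(2) by (intro ext) (auto simp: indicator_def max_def min_def)
  then show ?thesis using borel_measurable_pair_clamp[OF assms(1,2) True] by simp
next
  case False then show ?thesis using A by (auto simp: indicator_def)
qed

lemma borel_measurable_path_integral:
  fixes H :: "real \<Rightarrow> 'w \<Rightarrow> real"
  assumes meas: "\<And>r. r \<in> {u..v} \<Longrightarrow> H r \<in> borel_measurable N"
    and cont: "\<And>\<omega>. \<omega> \<in> space N \<Longrightarrow> continuous_on {u..v} (\<lambda>r. H r \<omega>)"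
  shows "(\<lambda>\<omega>. LINT r:{u..v}|lborel. H r \<omega>) \<in> borel_measurable N"
proof -
  have "(\<lambda>p. H (snd p) (fst p) * indicator {u..v} (snd p)) \<in> borel_measurable (N \<Otimes>\<^sub>M lborel)"
    by (rule borel_measurable_pair_on[OF assms]) auto
  then have "case_prod (\<lambda>\<omega> r. indicator {u..v} r *\<^sub>R H r \<omega>) \<in> borel_measurable (N \<Otimes>\<^sub>M lborel)"
    by (simp add: case_prod_beta' mult.commute)
  then show ?thesis unfolding set_lebesgue_integral_def
    by (rule lborel.borel_measurable_lebesgue_integral)
qed

lemma set_lint_mono_cont:
  fixes f g :: "real \<Rightarrow> real"
  assumes "continuous_on {u..v} f" "continuous_on {u..v} g" "\<And>r. r \<in> {u..v} \<Longrightarrow> f r \<le> g r"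
  shows "(LINT r:{u..v}|lborel. f r) \<le> (LINT r:{u..v}|lborel. g r)"
  by (rule set_integral_mono) (use assms in \<open>auto intro: borel_integrable_atLeastAtMost'\<close>)

lemma nn_integral_eq_set_lint:
  fixes f :: "real \<Rightarrow> real"
  assumes "continuous_on {u..v} f" "\<And>r. r \<in> {u..v} \<Longrightarrow> 0 \<le> f r"
  shows "(\<integral>\<^sup>+r\<in>{u..v}. ennreal (f r) \<partial>lborel) = ennreal (LINT r:{u..v}|lborel. f r)"
proof -
  have "(\<integral>\<^sup>+r\<in>{u..v}. ennreal (f r) \<partial>lborel) = (\<integral>\<^sup>+r. ennreal (indicator {u..v} r *\<^sub>R f r) \<partial>lborel)"
    by (intro nn_integral_cong) (auto simp: indicator_def)
  also have "\<dots> = ennreal (LINT r:{u..v}|lborel. f r)" unfolding set_lebesgue_integral_def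
    by (rule nn_integral_eq_integral) (use borel_integrable_atLeastAtMost'[OF assms(1)] assms(2) in \<open>auto simp: indicator_def set_integrable_def\<close>)
  finally show ?thesis .
qed

lemma set_lint_power2_le:
  fixes f :: "real \<Rightarrow> real"
  assumes f: "continuous_on {u..v} f" and "u \<le> v"
  shows "(LINT r:{u..v}|lborel. f r)\<^sup>2 \<le> (v - u) * (LINT r:{u..v}|lborel. (f r)\<^sup>2)"
proof -
  define I J where "I = (LINT r:{u..v}|lborel. f r)" and "J = (LINT r:{u..v}|lborel. (f r)\<^sup>2)"
  have i: "set_integrable lborel {u..v} f" "set_integrable lborel {u..v} (\<lambda>r. (f r)\<^sup>2)"
    by (intro borel_integrable_atLeastAtMost' continuous_intros f)+
  have quad: "0 \<le> c\<^sup>2 * J - 2 * c * d * I + d\<^sup>2 * (v - u)" for c d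
  proof -
    have "0 \<le> (LINT r:{u..v}|lborel. (c * f r - d)\<^sup>2)"
      unfolding set_lebesgue_integral_def by (intro integral_nonneg_AE) auto
    also have "(LINT r:{u..v}|lborel. (c * f r - d)\<^sup>2) = (LINT r:{u..v}|lborel. c\<^sup>2 * (f r)\<^sup>2 - (2 * c * d) * f r + d\<^sup>2)"
      by (simp add: power2_eq_square algebra_simps)
    also have "\<dots> = c\<^sup>2 * J - (2 * c * d) * I + (LINT r:{u..v}|lborel. d\<^sup>2)"
    proof -
      have k: "set_integrable lborel {u..v} (\<lambda>r. c\<^sup>2 * (f r)\<^sup>2)" "set_integrable lborel {u..v} (\<lambda>r. 2 * c * d * f r)"
        "set_integrable lborel {u..v} (\<lambda>r. d\<^sup>2)"
        by (intro borel_integrable_atLeastAtMost' continuous_intros f)+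
      show ?thesis
        by (simp add: set_integral_add(2)[OF set_integral_diff(1)[OF k(1,2)] k(3)] set_integral_diff(2)[OF k(1,2)]
            I_def J_def)
    qed
    also have "(LINT r:{u..v}|lborel. d\<^sup>2) = d\<^sup>2 * (v - u)" using \<open>u \<le> v\<close>
      by (simp add: set_lebesgue_integral_def)
    finally show ?thesis by (simp add: algebra_simps)
  qed
  show ?thesis
  proof (cases "u = v")
    case True
    have "(\<lambda>r. indicator {u..v} r *\<^sub>R f r) = (\<lambda>r. indicator {u} r *\<^sub>R f u)"
      using True by (auto simp: indicator_def)
    then have "I = 0" by (simp add: I_def set_lebesgue_integral_def)
    then show ?thesis using True by (simp add: I_def)
  next
    case False
    \<comment> \<open>The quadratic form is evaluated at c = v - u and d = I, where it equals v - u
      times the defect in the Cauchy-Schwarz inequality.\<close>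
    have "0 \<le> (v - u)\<^sup>2 * J - 2 * (v - u) * I * I + I\<^sup>2 * (v - u)" by (rule quad)
    then have "0 \<le> (v - u) * ((v - u) * J - I\<^sup>2)" by (simp add: power2_eq_square algebra_simps)
    then show ?thesis using False \<open>u \<le> v\<close> unfolding I_def J_def by (simp add: zero_le_mult_iff)
  qed
qed

lemma set_lint_power4_le:
  fixes f :: "real \<Rightarrow> real"
  assumes f: "continuous_on {u..v} f" and "u \<le> v"
  shows "(LINT r:{u..v}|lborel. f r)^4 \<le> (v - u)^3 * (LINT r:{u..v}|lborel. (f r)^4)"
proof -
  have "(LINT r:{u..v}|lborel. f r)^4 = ((LINT r:{u..v}|lborel. f r)\<^sup>2)\<^sup>2" by simp
  also have "\<dots> \<le> ((v - u) * (LINT r:{u..v}|lborel. (f r)\<^sup>2))\<^sup>2"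
    by (rule power_mono[OF set_lint_power2_le[OF assms]]) simp
  also have "\<dots> = (v - u)\<^sup>2 * (LINT r:{u..v}|lborel. (f r)\<^sup>2)\<^sup>2" by (simp add: power_mult_distrib)
  also have "\<dots> \<le> (v - u)\<^sup>2 * ((v - u) * (LINT r:{u..v}|lborel. ((f r)\<^sup>2)\<^sup>2))"
    by (intro mult_left_mono set_lint_power2_le continuous_intros f assms) simp
  also have "\<dots> = (v - u)^3 * (LINT r:{u..v}|lborel. (f r)^4)" by (simp add: power3_eq_cube power2_eq_square power4_eq_xxxx mult.assoc)
  finally show ?thesis .
qed

section \<open>Gronwall's inequality for extended real functions\<close>

lemma nn_integral_exp_le:
  assumes "C > 0" "t \<le> s"
  shows "(\<integral>\<^sup>+r\<in>{t..s}. ennreal (exp (2 * C * (r - t))) \<partial>lborel) \<le> ennreal (exp (2 * C * (s - t)) / (2 * C))"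
proof -
  have "(\<integral>\<^sup>+r. ennreal (exp (2 * C * (r - t))) * indicator {t..s} r \<partial>lborel)
     = ennreal (exp (2 * C * (s - t)) / (2 * C) - exp (2 * C * (t - t)) / (2 * C))"
    using assms by (intro nn_integral_FTC_Icc) (auto intro!: derivative_eq_intros)
  also have "\<dots> \<le> ennreal (exp (2 * C * (s - t)) / (2 * C))" using assms by (intro ennreal_leI) simp
  finally show ?thesis .
qed

text \<open>With the weight exp(2C(s - t)), C times the integral of the weight is at most half the
  weight, so the supremum S of the weighted function satisfies S <= A + S/2; hence the constants 2A
  and 2C. Finiteness of S, without which this would say nothing, comes from inserting the finite
  total integral once into the inequality.\<close>

lemma gronwall_nn_integral:
  fixes v :: "real \<Rightarrow> ennreal"
  assumes ineq: "\<And>s. s \<in> {t<..b} \<Longrightarrow> v s \<le> ennreal A + ennreal C * (\<integral>\<^sup>+r\<in>{t..s}. v r \<partial>lborel)"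
    and fin: "(\<integral>\<^sup>+r\<in>{t..b}. v r \<partial>lborel) < \<infinity>" and "C > 0" "A \<ge> 0" and s: "s \<in> {t<..b}"
  shows "v s \<le> ennreal (2 * A * exp (2 * C * (s - t)))"
proof -
  obtain V where V: "V \<ge> 0" "(\<integral>\<^sup>+r\<in>{t..b}. v r \<partial>lborel) = ennreal V"
    using fin by (cases "\<integral>\<^sup>+r\<in>{t..b}. v r \<partial>lborel") auto
  have bnd: "v s \<le> ennreal (A + C * V)" if "s \<in> {t<..b}" for s
  proof -
    have "v s \<le> ennreal A + ennreal C * (\<integral>\<^sup>+r\<in>{t..s}. v r \<partial>lborel)" by (rule ineq[OF that])
    also have "\<dots> \<le> ennreal A + ennreal C * (\<integral>\<^sup>+r\<in>{t..b}. v r \<partial>lborel)"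
      using that by (intro add_left_mono mult_left_mono nn_integral_mono) (auto simp: indicator_def)
    also have "\<dots> = ennreal (A + C * V)" using V assms by (simp add: ennreal_mult ennreal_plus)
    finally show ?thesis .
  qed
  define w where "w = (\<lambda>s. enn2real (v s))"
  have w: "v s = ennreal (w s)" "0 \<le> w s" if "s \<in> {t<..b}" for s
    using bnd[OF that] by (auto simp: w_def ennreal_enn2real_if top_unique)
  define E where "E = (\<lambda>s. exp (2 * C * (s - t)))"
  have E: "E s > 0" for s by (simp add: E_def)
  define S where "S = (SUP s\<in>{t<..b}. w s / E s)"
  have ne: "{t<..b} \<noteq> {}" using s by auto
  have w_le: "w s \<le> A + C * V" if "s \<in> {t<..b}" for s
    using bnd[OF that] w[OF that] V assms by (simp add: ennreal_le_iff del: ennreal_plus)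
  have bdd: "bdd_above ((\<lambda>s. w s / E s) ` {t<..b})"
  proof (rule bdd_aboveI2)
    fix s assume s: "s \<in> {t<..b}"
    have "E s \<ge> 1" using s \<open>C > 0\<close> by (simp add: E_def)
    then have "w s / E s \<le> w s" using w(2)[OF s] by (simp add: divide_le_eq mult_left_le_one_le mult_le_cancel_left1)
    then show "w s / E s \<le> A + C * V" using w_le[OF s] by simp
  qed
  have wS: "w s \<le> S * E s" if "s \<in> {t<..b}" for s
    using cSUP_upper[OF that bdd] E[of s] by (simp add: S_def field_simps)
  have S0: "S \<ge> 0" using wS[OF s] w(2)[OF s] E[of s] by (smt (verit) mult_neg_pos)
  have "w r / E r \<le> A + S / 2" if r: "r \<in> {t<..b}" for r
  proof -
    have "(\<integral>\<^sup>+q\<in>{t..r}. v q \<partial>lborel) \<le> (\<integral>\<^sup>+q. ennreal S * (ennreal (exp (2 * C * (q - t))) * indicator {t..r} q) \<partial>lborel)"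
    proof (rule nn_integral_mono_AE)
      have "AE q in lborel. q \<noteq> t" by (rule AE_lborel_singleton)
      then show "AE q in lborel. v q * indicator {t..r} q \<le> ennreal S * (ennreal (exp (2 * C * (q - t))) * indicator {t..r} q)"
      proof eventually_elim
        case (elim q)
        show ?case
        proof (cases "q \<in> {t..r}")
          case True
          then have q: "q \<in> {t<..b}" using elim r by auto
          have "v q \<le> ennreal (S * E q)" using w[OF q] wS[OF q] by (simp add: ennreal_leI)
          then show ?thesis using True S0 by (simp add: E_def ennreal_mult)
        qed simp
      qed
    qed
    also have "\<dots> \<le> ennreal S * ennreal (exp (2 * C * (r - t)) / (2 * C))"
      using nn_integral_exp_le[OF \<open>C > 0\<close>, of t r] r by (simp add: nn_integral_cmult mult_left_mono)
    also have "\<dots> = ennreal (S * E r / (2 * C))" by (simp add: E_def flip: ennreal_mult'[OF S0])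
    finally have "v r \<le> ennreal A + ennreal C * ennreal (S * E r / (2 * C))"
      using ineq[OF r] by (meson add_left_mono mult_left_mono order.trans zero_le)
    also have "\<dots> = ennreal (A + S * E r / 2)" using S0 E[of r] assms
      by (simp add: divide_simps flip: ennreal_mult ennreal_plus)
    finally have "w r \<le> A + S * E r / 2" using w[OF r] S0 E[of r] assms by (simp add: ennreal_le_iff flip: ennreal_plus del: ennreal_plus)
    then have "w r / E r \<le> A / E r + S / 2" using E[of r] by (simp add: field_simps)
    moreover have "A / E r \<le> A" using r \<open>C > 0\<close> \<open>A \<ge> 0\<close> by (simp add: E_def divide_le_eq mult_left_le_one_le mult_le_cancel_left1)
    ultimately show ?thesis by simp
  qed
  then have "S \<le> A + S / 2" unfolding S_def by (intro cSUP_least ne)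
  then have "S \<le> 2 * A" by simp
  then have "w s \<le> 2 * A * E s" using wS[OF s] E[of s] by (meson mult_right_mono less_imp_le order.trans)
  then show ?thesis using w[OF s] by (simp add: E_def ennreal_leI)
qed

section \<open>The isometry and the fourth moment for elementary integrands\<close>

definition normal_moment :: "nat \<Rightarrow> real \<Rightarrow> real" where
  "normal_moment p h = (LINT x|lborel. normal_density 0 (sqrt h) x * x ^ p)"

lemma normal_moment_values:
  assumes "h > 0"
  shows "normal_moment 1 h = 0" "normal_moment 2 h = h" "normal_moment 3 h = 0" "normal_moment 4 h = 3 * h\<^sup>2"
proof -
  have *: "0 < sqrt h" using assms by simp
  show "normal_moment 1 h = 0" using integral_normal_moment_odd[OF *, of 0 0] by (simp add: normal_moment_def)
  show "normal_moment 3 h = 0" using integral_normal_moment_odd[OF *, of 0 1] by (simp add: normal_moment_def eval_nat_numeral)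
  show "normal_moment 2 h = h" using integral_normal_moment_even[OF *, of 0 1] assms by (simp add: normal_moment_def)
  have "normal_moment 4 h = fact 4 / ((2 / h)\<^sup>2 * fact 2)"
    using integral_normal_moment_even[OF *, of 0 2] assms by (simp add: normal_moment_def)
  also have "\<dots> = 3 * h\<^sup>2" using assms by (simp add: fact_numeral power_divide field_simps)
  finally show "normal_moment 4 h = 3 * h\<^sup>2" .
qed

text \<open>One scalar coordinate of the Brownian motion. Independence of the increments and their
  Gaussian law enter only in the combined form E[\<xi> (B_u - B_s)^p] = E[\<xi>] E[(B_u - B_s)^p]
  for \<xi> known at time s, which is what expansions of second and fourth powers call for.\<close>

locale ito_driver = prob_space M for M :: "'w measure" +
  fixes F :: "real \<Rightarrow> 'w measure" and T :: real and B :: "real \<Rightarrow> 'w \<Rightarrow> real"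
  assumes filtration: "filtration (space M) F"
    and subalgebra: "\<And>t. sets (F t) \<subseteq> sets M"
    and B_measurable: "\<And>r. r \<in> {0..T} \<Longrightarrow> B r \<in> borel_measurable (F r)"
    and increment_moment: "\<And>s u \<xi> p. 0 \<le> s \<Longrightarrow> s < u \<Longrightarrow> u \<le> T \<Longrightarrow> \<xi> \<in> borel_measurable (F s) \<Longrightarrow>
      integrable M \<xi> \<Longrightarrow>
      has_bochner_integral M (\<lambda>\<omega>. \<xi> \<omega> * (B u \<omega> - B s \<omega>) ^ p) (expectation \<xi> * normal_moment p (u - s))"

lemma distributed_component:
  fixes Z :: "'w \<Rightarrow> real^'d::finite"
  assumes dist: "distributed M lborel Z (\<lambda>z. ennreal (\<Prod>i\<in>UNIV. normal_density 0 \<sigma> (z $ i)))" and "\<sigma> > 0"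
  shows "distributed M lborel (\<lambda>\<omega>. Z \<omega> $ j) (normal_density 0 \<sigma>)"
proof -
  have Z[measurable]: "Z \<in> borel_measurable M" using dist by (simp add: distributed_def)
  have Zj[measurable]: "(\<lambda>\<omega>. Z \<omega> $ j) \<in> borel_measurable M"
    by (rule measurable_compose[OF Z borel_measurable_nth])
  have "distr M lborel (\<lambda>\<omega>. Z \<omega> $ j) = density lborel (normal_density 0 \<sigma>)"
  proof (rule measure_eqI)
    fix A assume "A \<in> sets (distr M lborel (\<lambda>\<omega>. Z \<omega> $ j))"
    then have [measurable]: "A \<in> sets borel" by simp
    \<comment> \<open>Only coordinate j carries the indicator of A. The remaining factors integrate
      to 1, so the product formula for Lebesgue measure leaves the one-dimensional density.\<close>
    define f :: "real^'d \<Rightarrow> real \<Rightarrow> ennreal" where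
      "f = (\<lambda>b y. ennreal (normal_density 0 \<sigma> y) * (if b = axis j 1 then indicator A y else 1))"
    have f[measurable]: "f b \<in> borel_measurable borel" for b unfolding f_def by (cases "b = axis j 1") auto
    have B: "(Basis :: (real^'d) set) = range (\<lambda>i. axis i 1)" by (auto simp: Basis_vec_def)
    have inj: "inj (\<lambda>i. axis i 1 :: real^'d)" by (auto simp: inj_on_def axis_eq_axis)
    have [measurable]: "(\<lambda>z::real^'d. z $ j) \<in> borel_measurable borel" by (rule borel_measurable_nth)
    have "emeasure (distr M lborel (\<lambda>\<omega>. Z \<omega> $ j)) A = (\<integral>\<^sup>+\<omega>. indicator A (Z \<omega> $ j) \<partial>M)"
    proof -
      have "emeasure (distr M lborel (\<lambda>\<omega>. Z \<omega> $ j)) A = emeasure M ((\<lambda>\<omega>. Z \<omega> $ j) -` A \<inter> space M)"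
        by (rule emeasure_distr) auto
      also have "\<dots> = (\<integral>\<^sup>+\<omega>. indicator ((\<lambda>\<omega>. Z \<omega> $ j) -` A \<inter> space M) \<omega> \<partial>M)"
        by (rule nn_integral_indicator[symmetric]) measurable
      also have "\<dots> = (\<integral>\<^sup>+\<omega>. indicator A (Z \<omega> $ j) \<partial>M)"
        by (intro nn_integral_cong) (simp add: indicator_def)
      finally show ?thesis .
    qed
    also have "\<dots> = (\<integral>\<^sup>+z. ennreal (\<Prod>i\<in>UNIV. normal_density 0 \<sigma> (z $ i)) * indicator A (z $ j) \<partial>lborel)"
      by (rule distributed_nn_integral[OF dist, symmetric]) measurable
    also have "\<dots> = (\<integral>\<^sup>+z. (\<Prod>b\<in>Basis. f b (z \<bullet> b)) \<partial>lborel)"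
    proof (rule nn_integral_cong)
      fix z :: "real^'d"
      have "(\<Prod>b\<in>Basis. f b (z \<bullet> b)) = (\<Prod>i\<in>UNIV. f (axis i 1) (z $ i))"
        unfolding B by (subst prod.reindex[OF inj]) (simp add: inner_axis)
      also have "\<dots> = (\<Prod>i\<in>UNIV. ennreal (normal_density 0 \<sigma> (z $ i))) * (\<Prod>i\<in>UNIV. if i = j then indicator A (z $ j) else 1)"
        unfolding f_def prod.distrib[symmetric] by (intro prod.cong) (auto simp: axis_eq_axis)
      also have "(\<Prod>i\<in>UNIV. if i = j then indicator A (z $ j) else 1) = (indicator A (z $ j) :: ennreal)"
        by (subst prod.delta) auto
      finally show "ennreal (\<Prod>i\<in>UNIV. normal_density 0 \<sigma> (z $ i)) * indicator A (z $ j) = (\<Prod>b\<in>Basis. f b (z \<bullet> b))"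
        by (simp add: prod_ennreal)
    qed
    also have "\<dots> = (\<Prod>b\<in>Basis. \<integral>\<^sup>+y. f b y \<partial>lborel)"
      by (rule nn_integral_lborel_prod) auto
    also have "\<dots> = (\<Prod>b\<in>(Basis :: (real^'d) set). if b = axis j 1 then \<integral>\<^sup>+y. ennreal (normal_density 0 \<sigma> y) * indicator A y \<partial>lborel else 1)"
    proof (rule prod.cong)
      fix b :: "real^'d"
      have "(\<integral>\<^sup>+y. ennreal (normal_density 0 \<sigma> y) \<partial>lborel) = 1"
        using \<open>\<sigma> > 0\<close> by (subst nn_integral_eq_integral) (auto simp: integrable_normal_density)
      then show "(\<integral>\<^sup>+y. f b y \<partial>lborel) = (if b = axis j 1 then \<integral>\<^sup>+y. ennreal (normal_density 0 \<sigma> y) * indicator A y \<partial>lborel else 1)"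
        by (simp add: f_def)
    qed simp
    also have "\<dots> = (\<integral>\<^sup>+y. ennreal (normal_density 0 \<sigma> y) * indicator A y \<partial>lborel)"
      by (subst prod.delta) (auto simp: B)
    also have "\<dots> = emeasure (density lborel (normal_density 0 \<sigma>)) A"
      by (subst emeasure_density) auto
    finally show "emeasure (distr M lborel (\<lambda>\<omega>. Z \<omega> $ j)) A = emeasure (density lborel (normal_density 0 \<sigma>)) A" .
  qed simp
  then show ?thesis by (auto simp: distributed_def)
qed

lemma borel_measurable_subalgebra:
  assumes "f \<in> borel_measurable N" "sets N \<subseteq> sets N'" "space N = space N'"
  shows "f \<in> borel_measurable N'"
  using assms by (auto simp: measurable_def)

text \<open>Independence of the increment from \<open>F s\<close> is given as a product formula for
  events. Restricted to the sigma-algebras generated by \<xi> and by the p-th power of one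
  coordinate of the increment, it becomes independence of two random variables, so that expectations
  factor.\<close>

lemma brownian_motion_ito_driver:
  fixes W :: "real \<Rightarrow> 'w \<Rightarrow> real^'d::finite"
  assumes fps: "filtered_prob_space M F" and bm: "brownian_motion M F T W"
  shows "ito_driver M F T (\<lambda>r \<omega>. W r \<omega> $ j)"
proof -
  interpret prob_space M using fps by (simp add: filtered_prob_space_def)
  have sub: "sets (F t) \<subseteq> sets M" for t using fps by (simp add: filtered_prob_space_def)
  have fil: "filtration (space M) F" using fps by (simp add: filtered_prob_space_def)
  have sp: "space (F t) = space M" for t using filtration.space_F[OF fil] .
  show ?thesis
  proof (intro ito_driver.intro ito_driver_axioms.intro)
    show "prob_space M" by unfold_locales
    show "filtration (space M) F" by (rule fil)
    show "\<And>t. sets (F t) \<subseteq> sets M" by (rule sub)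
    show "(\<lambda>\<omega>. W r \<omega> $ j) \<in> borel_measurable (F r)" if "r \<in> {0..T}" for r
    proof -
      have "W r \<in> borel_measurable (F r)" using bm that by (simp add: brownian_motion_def)
      then show ?thesis by (rule measurable_compose[OF _ borel_measurable_nth])
    qed
    fix s u :: real and \<xi> :: "'w \<Rightarrow> real" and p :: nat
    assume su: "0 \<le> s" "s < u" "u \<le> T" and \<xi>: "\<xi> \<in> borel_measurable (F s)" and int: "integrable M \<xi>"
    define Z where "Z = (\<lambda>\<omega>. W u \<omega> - W s \<omega>)"
    have dist: "distributed M lborel Z (\<lambda>z. ennreal (\<Prod>i\<in>UNIV. normal_density 0 (sqrt (u - s)) (z $ i)))"
      and ind: "\<And>A B. A \<in> sets (F s) \<Longrightarrow> B \<in> sets (borel :: (real^'d) measure) \<Longrightarrow>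
           measure M (A \<inter> {\<omega>\<in>space M. Z \<omega> \<in> B}) = measure M A * measure M {\<omega>\<in>space M. Z \<omega> \<in> B}"
      using bm su unfolding brownian_motion_def Z_def by blast+
    have pos: "sqrt (u - s) > 0" using su by simp
    have Z[measurable]: "Z \<in> borel_measurable M" using dist by (simp add: distributed_def)
    have dj: "distributed M lborel (\<lambda>\<omega>. Z \<omega> $ j) (normal_density 0 (sqrt (u - s)))"
      by (rule distributed_component[OF dist pos])
    have Zj[measurable]: "(\<lambda>\<omega>. Z \<omega> $ j) \<in> borel_measurable M"
      by (rule measurable_compose[OF Z borel_measurable_nth])
    have \<xi>M[measurable]: "\<xi> \<in> borel_measurable M" by (rule borel_measurable_subalgebra[OF \<xi> sub sp])
    have intp: "integrable M (\<lambda>\<omega>. (Z \<omega> $ j) ^ p)"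
    proof -
      have "integrable lborel (\<lambda>x. normal_density 0 (sqrt (u - s)) x * x ^ p)"
        using integrable_normal_moment[OF pos, of 0 p] by simp
      then show ?thesis by (subst (asm) distributed_integrable[OF dj]) auto
    qed
    have Ep: "expectation (\<lambda>\<omega>. (Z \<omega> $ j) ^ p) = normal_moment p (u - s)"
      unfolding normal_moment_def by (rule distributed_integral[OF dj, symmetric]) auto
    have indep: "indep_var borel \<xi> borel (\<lambda>\<omega>. (Z \<omega> $ j) ^ p)"
      unfolding indep_var_eq
    proof (intro conjI)
      define G where "G = {(\<lambda>\<omega>. (Z \<omega> $ j) ^ p) -` A \<inter> space M |A. A \<in> sets (borel :: real measure)}"
      have 1: "sigma_sets (space M) {\<xi> -` A \<inter> space M |A. A \<in> sets borel} \<subseteq> sets (F s)"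
        unfolding sp[of s, symmetric]
        by (rule sets.sigma_sets_subset) (use \<xi> in \<open>auto simp: measurable_sets\<close>)
      have 2: "sigma_sets (space M) G \<subseteq> {Z -` A \<inter> space M |A. A \<in> sets borel}"
      proof -
        have "G \<subseteq> sets (vimage_algebra (space M) Z borel)"
        proof
          fix S assume "S \<in> G"
          then obtain A where A: "A \<in> sets (borel :: real measure)" "S = (\<lambda>\<omega>. (Z \<omega> $ j) ^ p) -` A \<inter> space M"
            by (auto simp: G_def)
          have "(\<lambda>z::real^'d. (z $ j) ^ p) \<in> borel_measurable borel"
            by (intro borel_measurable_power borel_measurable_nth)
          from measurable_sets[OF this A(1)] have "(\<lambda>z::real^'d. (z $ j) ^ p) -` A \<in> sets borel" by simp
          then show "S \<in> sets (vimage_algebra (space M) Z borel)"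
            unfolding A(2) by (subst sets_vimage_algebra2) (auto intro!: exI[of _ "(\<lambda>z::real^'d. (z $ j) ^ p) -` A"])
        qed
        then have "sigma_sets (space M) G \<subseteq> sets (vimage_algebra (space M) Z borel)"
          using sets.sigma_sets_subset[of G "vimage_algebra (space M) Z borel"] by simp
        then show ?thesis by (subst (asm) sets_vimage_algebra2) auto
      qed
      show "indep_set (sigma_sets (space M) {\<xi> -` A \<inter> space M |A. A \<in> sets borel})
        (sigma_sets (space M) {(\<lambda>\<omega>. (Z \<omega> $ j) ^ p) -` A \<inter> space M |A. A \<in> sets borel})"
        unfolding G_def[symmetric]
      proof (rule indep_setI)
        show "sigma_sets (space M) {\<xi> -` A \<inter> space M |A. A \<in> sets borel} \<subseteq> events" using 1 sub by blast
        show "sigma_sets (space M) G \<subseteq> events" using 2 measurable_sets[OF Z] by fastforce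
        fix a b assume a: "a \<in> sigma_sets (space M) {\<xi> -` A \<inter> space M |A. A \<in> sets borel}"
          and b: "b \<in> sigma_sets (space M) G"
        from b 2 obtain A where A: "A \<in> sets borel" "b = Z -` A \<inter> space M" by blast
        have "b = {\<omega>\<in>space M. Z \<omega> \<in> A}" using A(2) by auto
        then show "prob (a \<inter> b) = prob a * prob b" using ind[of a A] a 1 A by auto
      qed
    qed (use \<xi>M in measurable)
    show "has_bochner_integral M (\<lambda>\<omega>. \<xi> \<omega> * (W u \<omega> $ j - W s \<omega> $ j) ^ p) (expectation \<xi> * normal_moment p (u - s))"
      using indep_var_integrable[OF indep int intp] indep_var_lebesgue_integral[OF indep int intp] Ep
      by (simp add: has_bochner_integral_iff Z_def)
  qed
qed

section \<open>Second and fourth moments of elementary integrals\<close>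

context ito_driver
begin

lemma space_F: "space (F t) = space M"
  using filtration.space_F[OF filtration] .

lemma measurable_F_mono: "f \<in> borel_measurable (F s) \<Longrightarrow> s \<le> t \<Longrightarrow> f \<in> borel_measurable (F t)"
  by (rule borel_measurable_subalgebra[of f "F s" "F t"]) (use filtration.sets_F_mono[OF filtration] space_F in auto)

lemma measurable_F_M: "f \<in> borel_measurable (F s) \<Longrightarrow> f \<in> borel_measurable M"
  by (rule borel_measurable_subalgebra[of f "F s" M]) (use subalgebra space_F in auto)

lemma B_measurable_M: "r \<in> {0..T} \<Longrightarrow> B r \<in> borel_measurable M"
  by (rule measurable_F_M[OF B_measurable])

lemma integrable_bounded:
  assumes "f \<in> borel_measurable M" "\<And>\<omega>. \<omega> \<in> space M \<Longrightarrow> \<bar>f \<omega>\<bar> \<le> C"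
  shows "integrable M (f :: 'w \<Rightarrow> real)"
  by (rule integrable_const_bound[of _ C]) (use assms in auto)

lemma integrable_mult_bounded:
  fixes f g :: "'w \<Rightarrow> real"
  assumes "integrable M f" "g \<in> borel_measurable M" "\<And>\<omega>. \<omega> \<in> space M \<Longrightarrow> \<bar>g \<omega>\<bar> \<le> C"
  shows "integrable M (\<lambda>\<omega>. g \<omega> * f \<omega>)"
proof (rule Bochner_Integration.integrable_bound[of _ "\<lambda>\<omega>. C * f \<omega>"])
  show "AE \<omega> in M. norm (g \<omega> * f \<omega>) \<le> norm (C * f \<omega>)"
  proof (rule AE_I2)
    fix \<omega> assume "\<omega> \<in> space M"
    from assms(3)[OF this] have "\<bar>g \<omega>\<bar> \<le> \<bar>C\<bar>" by linarith
    then show "norm (g \<omega> * f \<omega>) \<le> norm (C * f \<omega>)" by (simp add: abs_mult mult_right_mono)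
  qed
qed (use assms in auto)

lemma increment_mean_zero:
  assumes "0 \<le> s" "s < u" "u \<le> T" "\<phi> \<in> borel_measurable (F s)" "integrable M \<phi>"
  shows "has_bochner_integral M (\<lambda>\<omega>. \<phi> \<omega> * (B u \<omega> - B s \<omega>)) 0"
  using increment_moment[OF assms, of 1] normal_moment_values(1)[of "u - s"] assms by simp

text \<open>The longer increment is split at u. The shared part contributes the variance u - s; the
  increment from u to u' has mean zero against everything known at time u.\<close>

lemma increments_same_start:
  assumes su: "0 \<le> s" "s < u" "u \<le> u'" "u' \<le> T" and \<phi>: "\<phi> \<in> borel_measurable (F s)" "\<And>\<omega>. \<omega> \<in> space M \<Longrightarrow> \<bar>\<phi> \<omega>\<bar> \<le> C"
  shows "has_bochner_integral M (\<lambda>\<omega>. \<phi> \<omega> * ((B u \<omega> - B s \<omega>) * (B u' \<omega> - B s \<omega>))) (expectation \<phi> * (u - s))"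
proof -
  have int: "integrable M \<phi>" by (rule integrable_bounded[OF measurable_F_M[OF \<phi>(1)] \<phi>(2)])
  have 1: "has_bochner_integral M (\<lambda>\<omega>. \<phi> \<omega> * (B u \<omega> - B s \<omega>)^2) (expectation \<phi> * (u - s))"
    using increment_moment[OF su(1,2) _ \<phi>(1) int, of 2] normal_moment_values(2)[of "u - s"] su by simp
  have 2: "has_bochner_integral M (\<lambda>\<omega>. (\<phi> \<omega> * (B u \<omega> - B s \<omega>)) * (B u' \<omega> - B u \<omega>)) 0"
  proof (cases "u < u'")
    case True
    show ?thesis
    proof (rule increment_mean_zero)
      show "integrable M (\<lambda>\<omega>. \<phi> \<omega> * (B u \<omega> - B s \<omega>))"
        using increment_mean_zero[OF su(1,2) _ \<phi>(1) int] su by (auto simp: has_bochner_integral_iff)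
      show "(\<lambda>\<omega>. \<phi> \<omega> * (B u \<omega> - B s \<omega>)) \<in> borel_measurable (F u)"
        using su by (intro borel_measurable_times borel_measurable_diff measurable_F_mono[OF \<phi>(1)] B_measurable measurable_F_mono[OF B_measurable, of s]) auto
    qed (use su True in auto)
  next
    case False then show ?thesis using su by (simp add: has_bochner_integral_zero)
  qed
  show ?thesis using has_bochner_integral_add[OF 1 2]
    by (simp add: power2_eq_square algebra_simps)
qed

text \<open>The earlier increment is split at the later starting point u'. Its part before u' is
  known at time u' and meets an increment of mean zero; for the rest both increments start at u' and
  contribute the length of the overlap.\<close>

lemma elementary_product_aux:
  assumes u: "0 \<le> u" "u < v" "v \<le> T" and u': "0 \<le> u'" "u' < v'" "v' \<le> T" and le: "u \<le> u'"
    and \<xi>: "\<xi> \<in> borel_measurable (F u)" "\<And>\<omega>. \<omega> \<in> space M \<Longrightarrow> \<bar>\<xi> \<omega>\<bar> \<le> C"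
    and \<zeta>: "\<zeta> \<in> borel_measurable (F u')" "\<And>\<omega>. \<omega> \<in> space M \<Longrightarrow> \<bar>\<zeta> \<omega>\<bar> \<le> C'"
  shows "has_bochner_integral M (\<lambda>\<omega>. (\<xi> \<omega> * (B v \<omega> - B u \<omega>)) * (\<zeta> \<omega> * (B v' \<omega> - B u' \<omega>)))
    (expectation (\<lambda>\<omega>. \<xi> \<omega> * \<zeta> \<omega>) * measure lborel ({u<..v} \<inter> {u'<..v'}))"
proof -
  have \<xi>M: "\<xi> \<in> borel_measurable M" and \<zeta>M: "\<zeta> \<in> borel_measurable M"
    using \<xi> \<zeta> measurable_F_M by auto
  have int: "integrable M \<xi>" by (rule integrable_bounded[OF \<xi>M \<xi>(2)])
  have meas: "(\<lambda>\<omega>. \<zeta> \<omega> * (\<xi> \<omega> * (B w \<omega> - B u \<omega>))) \<in> borel_measurable (F u')" if "u < w" "w \<le> u'" for w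
    using that u u' le
    by (intro borel_measurable_times borel_measurable_diff \<zeta> measurable_F_mono[OF \<xi>(1)] measurable_F_mono[OF B_measurable, of w] measurable_F_mono[OF B_measurable, of u]) auto
  have int2: "integrable M (\<lambda>\<omega>. \<zeta> \<omega> * (\<xi> \<omega> * (B w \<omega> - B u \<omega>)))" if "u < w" "w \<le> u'" for w
    by (rule integrable_mult_bounded[OF _ \<zeta>M \<zeta>(2)])
       (use increment_mean_zero[OF u(1) that(1) _ \<xi>(1) int] that u' in \<open>auto simp: has_bochner_integral_iff\<close>)
  have zero: "has_bochner_integral M (\<lambda>\<omega>. (\<zeta> \<omega> * (\<xi> \<omega> * (B w \<omega> - B u \<omega>))) * (B v' \<omega> - B u' \<omega>)) 0" if "u < w" "w \<le> u'" for w
    by (rule increment_mean_zero[OF u' meas[OF that] int2[OF that]])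
  show ?thesis
  proof (cases "v \<le> u'")
    case True
    then have "{u<..v} \<inter> {u'<..v'} = {}" by auto
    then have m: "measure lborel ({u<..v} \<inter> {u'<..v'}) = 0" by (simp only: measure_empty)
    show ?thesis unfolding m using zero[OF u(2) True] by (simp add: algebra_simps)
  next
    case False
    then have m: "measure lborel ({u<..v} \<inter> {u'<..v'}) = min v v' - u'"
      using le u u' by (simp add: Int_greaterThanAtMost max_def min_def)
    have bnd: "\<bar>\<xi> \<omega> * \<zeta> \<omega>\<bar> \<le> C * C'" if "\<omega> \<in> space M" for \<omega>
      unfolding abs_mult using \<xi>(2)[OF that] \<zeta>(2)[OF that] by (intro mult_mono) auto
    have me: "(\<lambda>\<omega>. \<xi> \<omega> * \<zeta> \<omega>) \<in> borel_measurable (F u')"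
      by (intro borel_measurable_times \<zeta> measurable_F_mono[OF \<xi>(1) le])
    have 1: "has_bochner_integral M (\<lambda>\<omega>. (\<xi> \<omega> * \<zeta> \<omega>) * ((B v \<omega> - B u' \<omega>) * (B v' \<omega> - B u' \<omega>)))
      (expectation (\<lambda>\<omega>. \<xi> \<omega> * \<zeta> \<omega>) * (min v v' - u'))"
    proof (cases "v \<le> v'")
      case True
      then show ?thesis using increments_same_start[of u' v v' _ "C * C'", OF _ _ _ _ me bnd] False u u' by simp
    next
      case F: False
      then show ?thesis using increments_same_start[of u' v' v _ "C * C'", OF _ _ _ _ me bnd] False u u'
        by (simp add: mult.commute)
    qed
    have 2: "has_bochner_integral M (\<lambda>\<omega>. (\<zeta> \<omega> * (\<xi> \<omega> * (B u' \<omega> - B u \<omega>))) * (B v' \<omega> - B u' \<omega>)) 0"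
    proof (cases "u < u'")
      case True then show ?thesis by (rule zero) simp
    next
      case False then show ?thesis using le by (simp add: has_bochner_integral_zero)
    qed
    show ?thesis unfolding m using has_bochner_integral_add[OF 1 2] by (simp add: algebra_simps)
  qed
qed

lemma elementary_product:
  assumes u: "0 \<le> u" "u < v" "v \<le> T" and u': "0 \<le> u'" "u' < v'" "v' \<le> T"
    and \<xi>: "\<xi> \<in> borel_measurable (F u)" "\<And>\<omega>. \<omega> \<in> space M \<Longrightarrow> \<bar>\<xi> \<omega>\<bar> \<le> C"
    and \<zeta>: "\<zeta> \<in> borel_measurable (F u')" "\<And>\<omega>. \<omega> \<in> space M \<Longrightarrow> \<bar>\<zeta> \<omega>\<bar> \<le> C'"
  shows "has_bochner_integral M (\<lambda>\<omega>. (\<xi> \<omega> * (B v \<omega> - B u \<omega>)) * (\<zeta> \<omega> * (B v' \<omega> - B u' \<omega>)))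
    (expectation (\<lambda>\<omega>. \<xi> \<omega> * \<zeta> \<omega>) * measure lborel ({u<..v} \<inter> {u'<..v'}))"
proof (cases "u \<le> u'")
  case True from elementary_product_aux[OF u u' this \<xi> \<zeta>] show ?thesis .
next
  case False
  then have "u' \<le> u" by simp
  from elementary_product_aux[OF u' u this \<zeta> \<xi>] show ?thesis by (simp add: mult.commute Int_commute)
qed

text \<open>The intervals may overlap and come in any order. This freedom lets the difference of two
  simple integrals over different partitions be treated as one sum, without a common
  refinement.\<close>

lemma elementary_isometry:
  fixes K :: "'k set" and \<xi> :: "'k \<Rightarrow> 'w \<Rightarrow> real"
  assumes "finite K" and uv: "\<And>k. k \<in> K \<Longrightarrow> 0 \<le> u k \<and> u k < v k \<and> v k \<le> T"
    and \<xi>: "\<And>k. k \<in> K \<Longrightarrow> \<xi> k \<in> borel_measurable (F (u k))"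
    and bnd: "\<And>k. k \<in> K \<Longrightarrow> \<exists>C. \<forall>\<omega>\<in>space M. \<bar>\<xi> k \<omega>\<bar> \<le> C"
  shows "(\<integral>\<^sup>+\<omega>. ennreal ((\<Sum>k\<in>K. \<xi> k \<omega> * (B (v k) \<omega> - B (u k) \<omega>))\<^sup>2) \<partial>M)
    = (\<integral>\<^sup>+\<omega>. (\<integral>\<^sup>+r. ennreal ((\<Sum>k\<in>K. \<xi> k \<omega> * indicator {u k<..v k} r)\<^sup>2) \<partial>lborel) \<partial>M)"
proof -
  obtain C where C: "\<And>k \<omega>. k \<in> K \<Longrightarrow> \<omega> \<in> space M \<Longrightarrow> \<bar>\<xi> k \<omega>\<bar> \<le> C k" using bnd by metis
  define m where "m = (\<lambda>k l. measure lborel ({u k<..v k} \<inter> {u l<..v l}))"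
  have \<xi>M: "\<xi> k \<in> borel_measurable M" if "k \<in> K" for k using measurable_F_M[OF \<xi>[OF that]] .
  have int\<xi>: "integrable M (\<lambda>\<omega>. \<xi> k \<omega> * \<xi> l \<omega>)" if "k \<in> K" "l \<in> K" for k l
    by (rule integrable_mult_bounded[OF integrable_bounded[OF \<xi>M C] \<xi>M C]) (use that in auto)
  define E where "E = (\<Sum>k\<in>K. \<Sum>l\<in>K. expectation (\<lambda>\<omega>. \<xi> k \<omega> * \<xi> l \<omega>) * m k l)"
  have L: "has_bochner_integral M (\<lambda>\<omega>. (\<Sum>k\<in>K. \<xi> k \<omega> * (B (v k) \<omega> - B (u k) \<omega>))\<^sup>2) E"
    unfolding power2_eq_square sum_product E_def m_def
  proof (intro has_bochner_integral_sum)
    fix k l assume k: "k \<in> K" and l: "l \<in> K"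
    show "has_bochner_integral M (\<lambda>\<omega>. \<xi> k \<omega> * (B (v k) \<omega> - B (u k) \<omega>) * (\<xi> l \<omega> * (B (v l) \<omega> - B (u l) \<omega>)))
      (expectation (\<lambda>\<omega>. \<xi> k \<omega> * \<xi> l \<omega>) * measure lborel ({u k<..v k} \<inter> {u l<..v l}))"
      using uv[OF k] uv[OF l] by (intro elementary_product[OF _ _ _ _ _ _ \<xi>[OF k] C[OF k] \<xi>[OF l] C[OF l]]) auto
  qed
  define S where "S = (\<lambda>\<omega>. \<Sum>k\<in>K. \<Sum>l\<in>K. \<xi> k \<omega> * \<xi> l \<omega> * m k l)"
  have inner: "has_bochner_integral lborel (\<lambda>r. (\<Sum>k\<in>K. \<xi> k \<omega> * indicator {u k<..v k} r)\<^sup>2) (S \<omega>)" for \<omega>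
    unfolding power2_eq_square sum_product S_def
  proof (intro has_bochner_integral_sum)
    fix k l assume kl: "k \<in> K" "l \<in> K"
    have "has_bochner_integral lborel (indicator ({u k<..v k} \<inter> {u l<..v l})) (m k l)"
      unfolding m_def 
    proof (rule has_bochner_integral_real_indicator)
      have "emeasure lborel ({u k<..v k} \<inter> {u l<..v l}) \<le> emeasure lborel {u k<..v k}" by (rule emeasure_mono) auto
      also have "\<dots> < \<infinity>" using uv[OF kl(1)] by simp
      finally show "emeasure lborel ({u k<..v k} \<inter> {u l<..v l}) < \<infinity>" .
    qed simp
    from has_bochner_integral_mult_right[OF this, of "\<xi> k \<omega> * \<xi> l \<omega>"]
    show "has_bochner_integral lborel (\<lambda>r. \<xi> k \<omega> * indicator {u k<..v k} r * (\<xi> l \<omega> * indicator {u l<..v l} r)) (\<xi> k \<omega> * \<xi> l \<omega> * m k l)"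
      unfolding indicator_inter_arith by (simp add: mult_ac)
  qed
  have S0: "0 \<le> S \<omega>" for \<omega>
  proof -
    have "0 \<le> (LINT r|lborel. (\<Sum>k\<in>K. \<xi> k \<omega> * indicator {u k<..v k} r)\<^sup>2)" by (rule integral_nonneg_AE) simp
    then show ?thesis using has_bochner_integral_integral_eq[OF inner[of \<omega>]] by simp
  qed
  have S: "has_bochner_integral M S E"
    unfolding S_def E_def
    by (intro has_bochner_integral_sum has_bochner_integral_mult_left has_bochner_integral_integrable int\<xi>)
  have "(\<integral>\<^sup>+\<omega>. ennreal ((\<Sum>k\<in>K. \<xi> k \<omega> * (B (v k) \<omega> - B (u k) \<omega>))\<^sup>2) \<partial>M) = ennreal E"
    using L by (subst nn_integral_eq_integral) (auto simp: has_bochner_integral_iff)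
  moreover have "(\<integral>\<^sup>+r. ennreal ((\<Sum>k\<in>K. \<xi> k \<omega> * indicator {u k<..v k} r)\<^sup>2) \<partial>lborel) = ennreal (S \<omega>)" for \<omega>
    using inner[of \<omega>] by (subst nn_integral_eq_integral) (auto simp: has_bochner_integral_iff)
  moreover have "(\<integral>\<^sup>+\<omega>. ennreal (S \<omega>) \<partial>M) = ennreal E"
    using S S0 by (subst nn_integral_eq_integral) (auto simp: has_bochner_integral_iff)
  ultimately show ?thesis by simp
qed

text \<open>In the expansion of the fourth power the odd moments of the increment vanish. The mixed
  term is split by 6 a^2 b^2 <= a^4 / L + 9 L b^4, and 3 \<delta>^2 <= 3 L \<delta>; this gives the
  constant 12 = 9 + 3. With the length of the whole interval as L, the factor 1 + \<delta> / L on
  the old moment stays bounded when multiplied over all steps.\<close>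

lemma fourth_moment_step:
  assumes s: "0 \<le> s" "s < u" "u \<le> T" "u - s = \<delta>" and S: "S \<in> borel_measurable (F s)" "integrable M (\<lambda>\<omega>. S \<omega> ^ 4)"
    and \<xi>: "\<xi> \<in> borel_measurable (F s)" "\<And>\<omega>. \<omega> \<in> space M \<Longrightarrow> \<bar>\<xi> \<omega>\<bar> \<le> C" and L: "0 < L" "\<delta> \<le> L"
  shows "integrable M (\<lambda>\<omega>. (S \<omega> + \<xi> \<omega> * (B u \<omega> - B s \<omega>)) ^ 4)"
    and "expectation (\<lambda>\<omega>. (S \<omega> + \<xi> \<omega> * (B u \<omega> - B s \<omega>)) ^ 4) \<le>
      (1 + \<delta> / L) * expectation (\<lambda>\<omega>. S \<omega> ^ 4) + 12 * L * \<delta> * expectation (\<lambda>\<omega>. \<xi> \<omega> ^ 4)"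
proof -
  have SM[measurable]: "S \<in> borel_measurable M" and \<xi>M[measurable]: "\<xi> \<in> borel_measurable M"
    using S \<xi> measurable_F_M by auto
  have \<delta>: "\<delta> > 0" using s by simp
  have Sj: "integrable M (\<lambda>\<omega>. S \<omega> ^ j)" if "j \<le> 4" for j
  proof (rule Bochner_Integration.integrable_bound[of _ "\<lambda>\<omega>. 1 + S \<omega> ^ 4"])
    show "AE \<omega> in M. norm (S \<omega> ^ j) \<le> norm (1 + S \<omega> ^ 4)"
    proof (rule AE_I2)
      fix \<omega>
      have "\<bar>S \<omega>\<bar> ^ j \<le> 1 + \<bar>S \<omega>\<bar> ^ 4"
      proof (cases "\<bar>S \<omega>\<bar> \<le> 1")
        case True
        then have "\<bar>S \<omega>\<bar> ^ j \<le> 1" by (simp add: power_le_one)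
        then show ?thesis by (simp add: add_increasing2)
      next
        case False
        then have "\<bar>S \<omega>\<bar> ^ j \<le> \<bar>S \<omega>\<bar> ^ 4" using that by (intro power_increasing) auto
        then show ?thesis by simp
      qed
      then show "norm (S \<omega> ^ j) \<le> norm (1 + S \<omega> ^ 4)" by (simp add: power_abs)
    qed
  qed (use S in auto)
  have \<xi>j: "\<bar>\<xi> \<omega> ^ i\<bar> \<le> C ^ i" if "\<omega> \<in> space M" for \<omega> i
    unfolding power_abs using \<xi>(2)[OF that] by (rule power_mono) simp
  have hb: "has_bochner_integral M (\<lambda>\<omega>. (\<xi> \<omega> ^ i * S \<omega> ^ j) * (B u \<omega> - B s \<omega>) ^ p) (expectation (\<lambda>\<omega>. \<xi> \<omega> ^ i * S \<omega> ^ j) * normal_moment p \<delta>)"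
    if "j \<le> 4" for i j p
    unfolding s(4)[symmetric]
    by (intro increment_moment s integrable_mult_bounded[OF Sj[OF that] _ \<xi>j] borel_measurable_times borel_measurable_power S \<xi>) auto
  note nm = normal_moment_values[OF \<delta>]
  have h0: "has_bochner_integral M (\<lambda>\<omega>. S \<omega> ^ 4) (expectation (\<lambda>\<omega>. S \<omega> ^ 4))"
    by (rule has_bochner_integral_integrable[OF S(2)])
  have h1: "has_bochner_integral M (\<lambda>\<omega>. 4 * (\<xi> \<omega> ^ 1 * S \<omega> ^ 3 * (B u \<omega> - B s \<omega>) ^ 1)) (4 * 0)"
    using hb[of 3 1 1] nm by (intro has_bochner_integral_mult_right) simp
  have h2: "has_bochner_integral M (\<lambda>\<omega>. 6 * (\<xi> \<omega> ^ 2 * S \<omega> ^ 2 * (B u \<omega> - B s \<omega>) ^ 2)) (6 * (expectation (\<lambda>\<omega>. \<xi> \<omega> ^ 2 * S \<omega> ^ 2) * \<delta>))"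
    using hb[of 2 2 2] nm by (intro has_bochner_integral_mult_right) simp
  have h3: "has_bochner_integral M (\<lambda>\<omega>. 4 * (\<xi> \<omega> ^ 3 * S \<omega> ^ 1 * (B u \<omega> - B s \<omega>) ^ 3)) (4 * 0)"
    using hb[of 1 3 3] nm by (intro has_bochner_integral_mult_right) simp
  have h4: "has_bochner_integral M (\<lambda>\<omega>. \<xi> \<omega> ^ 4 * S \<omega> ^ 0 * (B u \<omega> - B s \<omega>) ^ 4) (expectation (\<lambda>\<omega>. \<xi> \<omega> ^ 4) * (3 * \<delta>\<^sup>2))"
    using hb[of 0 4 4] nm by simp
  have id: "(S \<omega> + \<xi> \<omega> * (B u \<omega> - B s \<omega>)) ^ 4 = S \<omega> ^ 4 + 4 * (\<xi> \<omega> ^ 1 * S \<omega> ^ 3 * (B u \<omega> - B s \<omega>) ^ 1)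
     + 6 * (\<xi> \<omega> ^ 2 * S \<omega> ^ 2 * (B u \<omega> - B s \<omega>) ^ 2) + 4 * (\<xi> \<omega> ^ 3 * S \<omega> ^ 1 * (B u \<omega> - B s \<omega>) ^ 3)
     + \<xi> \<omega> ^ 4 * S \<omega> ^ 0 * (B u \<omega> - B s \<omega>) ^ 4" for \<omega>
    by algebra
  have tot: "has_bochner_integral M (\<lambda>\<omega>. (S \<omega> + \<xi> \<omega> * (B u \<omega> - B s \<omega>)) ^ 4)
    (expectation (\<lambda>\<omega>. S \<omega> ^ 4) + 4 * 0 + 6 * (expectation (\<lambda>\<omega>. \<xi> \<omega> ^ 2 * S \<omega> ^ 2) * \<delta>) + 4 * 0 + expectation (\<lambda>\<omega>. \<xi> \<omega> ^ 4) * (3 * \<delta>\<^sup>2))"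
    unfolding id by (intro has_bochner_integral_add h0 h1 h2 h3 h4)
  then show "integrable M (\<lambda>\<omega>. (S \<omega> + \<xi> \<omega> * (B u \<omega> - B s \<omega>)) ^ 4)" by (simp add: has_bochner_integral_iff)
  have int\<xi>4: "integrable M (\<lambda>\<omega>. \<xi> \<omega> ^ 4)" by (rule integrable_bounded[OF _ \<xi>j]) auto
  have "expectation (\<lambda>\<omega>. 6 * (\<xi> \<omega> ^ 2 * S \<omega> ^ 2)) \<le> expectation (\<lambda>\<omega>. (1 / L) * S \<omega> ^ 4 + (9 * L) * \<xi> \<omega> ^ 4)"
  proof (rule integral_mono)
    show "integrable M (\<lambda>\<omega>. 6 * (\<xi> \<omega> ^ 2 * S \<omega> ^ 2))"
      by (intro integrable_mult_right integrable_mult_bounded[OF Sj _ \<xi>j]) auto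
    show "integrable M (\<lambda>\<omega>. (1 / L) * S \<omega> ^ 4 + (9 * L) * \<xi> \<omega> ^ 4)"
      by (intro Bochner_Integration.integrable_add integrable_mult_right S(2) int\<xi>4)
    fix \<omega>
    have "0 \<le> (S \<omega> ^ 2 - 3 * L * \<xi> \<omega> ^ 2)\<^sup>2 / L" using L by simp
    also have "\<dots> = (1 / L) * S \<omega> ^ 4 + (9 * L) * \<xi> \<omega> ^ 4 - 6 * (\<xi> \<omega> ^ 2 * S \<omega> ^ 2)"
      using L by (simp add: field_simps power2_eq_square power4_eq_xxxx)
    finally show "6 * (\<xi> \<omega> ^ 2 * S \<omega> ^ 2) \<le> (1 / L) * S \<omega> ^ 4 + (9 * L) * \<xi> \<omega> ^ 4" by simp
  qed
  also have "\<dots> = (1 / L) * expectation (\<lambda>\<omega>. S \<omega> ^ 4) + (9 * L) * expectation (\<lambda>\<omega>. \<xi> \<omega> ^ 4)"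
    using S(2) int\<xi>4 by simp
  finally have "6 * expectation (\<lambda>\<omega>. \<xi> \<omega> ^ 2 * S \<omega> ^ 2) \<le> (1 / L) * expectation (\<lambda>\<omega>. S \<omega> ^ 4) + (9 * L) * expectation (\<lambda>\<omega>. \<xi> \<omega> ^ 4)"
    by simp
  from mult_right_mono[OF this, of \<delta>] \<delta>
  have "6 * (expectation (\<lambda>\<omega>. \<xi> \<omega> ^ 2 * S \<omega> ^ 2) * \<delta>) \<le> (\<delta> / L) * expectation (\<lambda>\<omega>. S \<omega> ^ 4) + (9 * L) * \<delta> * expectation (\<lambda>\<omega>. \<xi> \<omega> ^ 4)"
    by (simp add: algebra_simps)
  moreover have "expectation (\<lambda>\<omega>. \<xi> \<omega> ^ 4) * (3 * \<delta>\<^sup>2) \<le> 3 * L * \<delta> * expectation (\<lambda>\<omega>. \<xi> \<omega> ^ 4)"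
  proof -
    have "0 \<le> expectation (\<lambda>\<omega>. \<xi> \<omega> ^ 4)" by (rule integral_nonneg_AE) simp
    moreover have "\<delta> * \<delta> \<le> L * \<delta>" using L \<delta> by (intro mult_right_mono) auto
    ultimately have "expectation (\<lambda>\<omega>. \<xi> \<omega> ^ 4) * (\<delta> * \<delta>) \<le> expectation (\<lambda>\<omega>. \<xi> \<omega> ^ 4) * (L * \<delta>)"
      by (intro mult_left_mono)
    then show ?thesis by (simp add: power2_eq_square algebra_simps)
  qed
  ultimately show "expectation (\<lambda>\<omega>. (S \<omega> + \<xi> \<omega> * (B u \<omega> - B s \<omega>)) ^ 4) \<le>
      (1 + \<delta> / L) * expectation (\<lambda>\<omega>. S \<omega> ^ 4) + 12 * L * \<delta> * expectation (\<lambda>\<omega>. \<xi> \<omega> ^ 4)"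
    using has_bochner_integral_integral_eq[OF tot] by (simp add: algebra_simps)
qed

text \<open>Equal steps turn each factor into 1 + 1/n, and (1 + 1/n)^n <= e <= 3. Together with the
  12 of a single step this is the constant 36.\<close>

lemma partition_fourth_moment:
  assumes n: "n > 0" and L: "0 < L" and \<tau>: "\<And>k. \<tau> (Suc k) - \<tau> k = L / real n" "0 \<le> \<tau> 0" "\<tau> n \<le> T"
    and \<xi>: "\<And>k. k < n \<Longrightarrow> \<xi> k \<in> borel_measurable (F (\<tau> k))" "\<And>k. k < n \<Longrightarrow> \<exists>C. \<forall>\<omega>\<in>space M. \<bar>\<xi> k \<omega>\<bar> \<le> C"
  shows "integrable M (\<lambda>\<omega>. (\<Sum>k<n. \<xi> k \<omega> * (B (\<tau> (Suc k)) \<omega> - B (\<tau> k) \<omega>)) ^ 4)" (is ?int)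
    and "expectation (\<lambda>\<omega>. (\<Sum>k<n. \<xi> k \<omega> * (B (\<tau> (Suc k)) \<omega> - B (\<tau> k) \<omega>)) ^ 4)
      \<le> 36 * L * (\<Sum>k<n. (L / real n) * expectation (\<lambda>\<omega>. \<xi> k \<omega> ^ 4))" (is ?le)
proof -
  define \<delta> where "\<delta> = L / real n"
  have \<delta>: "0 < \<delta>" "\<delta> \<le> L" "\<delta> / L = 1 / real n" using n L by (auto simp: \<delta>_def divide_le_eq)
  have Suc_le: "\<tau> k \<le> \<tau> (Suc k)" for k using \<tau>(1)[of k] \<delta> by (simp add: \<delta>_def)
  have mono: "\<tau> k \<le> \<tau> l" if "k \<le> l" for k l
    using lift_Suc_mono_le[of \<tau>, OF Suc_le that] .
  have range: "0 \<le> \<tau> k" for k using mono[of 0 k] \<tau> by simp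
  define S where "S = (\<lambda>j \<omega>. \<Sum>k<j. \<xi> k \<omega> * (B (\<tau> (Suc k)) \<omega> - B (\<tau> k) \<omega>))"
  define e where "e = (\<lambda>k. expectation (\<lambda>\<omega>. \<xi> k \<omega> ^ 4))"
  have e0: "0 \<le> e k" for k unfolding e_def by (rule integral_nonneg_AE) simp
  have "j \<le> n \<Longrightarrow> S j \<in> borel_measurable (F (\<tau> j)) \<and> integrable M (\<lambda>\<omega>. S j \<omega> ^ 4) \<and>
    expectation (\<lambda>\<omega>. S j \<omega> ^ 4) \<le> (1 + 1 / real n) ^ j * (12 * L * (\<Sum>k<j. \<delta> * e k))" for j
  proof (induction j)
    case 0 show ?case by (simp add: S_def)
  next
    case (Suc j)
    then have j: "j < n" and IH: "S j \<in> borel_measurable (F (\<tau> j))" "integrable M (\<lambda>\<omega>. S j \<omega> ^ 4)"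
      "expectation (\<lambda>\<omega>. S j \<omega> ^ 4) \<le> (1 + 1 / real n) ^ j * (12 * L * (\<Sum>k<j. \<delta> * e k))" by auto
    have le: "\<tau> j < \<tau> (Suc j)" "\<tau> (Suc j) - \<tau> j = \<delta>" using \<tau>(1)[of j] \<delta> by (auto simp: \<delta>_def)
    have leT: "\<tau> (Suc j) \<le> T" using mono[of "Suc j" n] j \<tau> by simp
    obtain C where C: "\<And>\<omega>. \<omega> \<in> space M \<Longrightarrow> \<bar>\<xi> j \<omega>\<bar> \<le> C" using \<xi>(2)[OF j] by blast
    have SS: "S (Suc j) \<omega> = S j \<omega> + \<xi> j \<omega> * (B (\<tau> (Suc j)) \<omega> - B (\<tau> j) \<omega>)" for \<omega> by (simp add: S_def)
    note st = fourth_moment_step[OF range le(1) leT le(2) IH(1,2) \<xi>(1)[OF j] C L \<delta>(2)]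
    have m: "S (Suc j) \<in> borel_measurable (F (\<tau> (Suc j)))"
      unfolding SS[abs_def] using le leT range
      by (intro borel_measurable_add borel_measurable_times borel_measurable_diff measurable_F_mono[OF IH(1)]
          measurable_F_mono[OF \<xi>(1)[OF j]] B_measurable measurable_F_mono[OF B_measurable, of "\<tau> j"]) auto
    have "expectation (\<lambda>\<omega>. S (Suc j) \<omega> ^ 4) \<le> (1 + \<delta> / L) * expectation (\<lambda>\<omega>. S j \<omega> ^ 4) + 12 * L * \<delta> * e j"
      using st(2) by (simp add: SS e_def)
    also have "\<dots> \<le> (1 + \<delta> / L) * ((1 + 1 / real n) ^ j * (12 * L * (\<Sum>k<j. \<delta> * e k))) + (1 + 1 / real n) ^ Suc j * (12 * L * \<delta> * e j)"
    \<comment> \<open>The new summand is inflated by (1 + 1/n)^(j + 1), so that the induction keeps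
      one common factor in front of the sum.\<close>
    proof (rule add_mono[OF mult_left_mono[OF IH(3)]])
      have "1 * (12 * L * \<delta> * e j) \<le> (1 + 1 / real n) ^ Suc j * (12 * L * \<delta> * e j)"
        using L \<delta> e0[of j] by (intro mult_right_mono one_le_power) auto
      then show "12 * L * \<delta> * e j \<le> (1 + 1 / real n) ^ Suc j * (12 * L * \<delta> * e j)" by simp
    qed (use L \<delta> in auto)
    also have "\<dots> = (1 + 1 / real n) ^ Suc j * (12 * L * (\<Sum>k<Suc j. \<delta> * e k))"
      unfolding \<delta>(3) by (simp add: algebra_simps)
    finally have le': "expectation (\<lambda>\<omega>. S (Suc j) \<omega> ^ 4) \<le> (1 + 1 / real n) ^ Suc j * (12 * L * (\<Sum>k<Suc j. \<delta> * e k))" .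
    have "integrable M (\<lambda>\<omega>. S (Suc j) \<omega> ^ 4)" using st(1) by (simp add: SS)
    with m le' show ?case by blast
  qed
  from this[of n] have *: "integrable M (\<lambda>\<omega>. S n \<omega> ^ 4)"
    "expectation (\<lambda>\<omega>. S n \<omega> ^ 4) \<le> (1 + 1 / real n) ^ n * (12 * L * (\<Sum>k<n. \<delta> * e k))" by auto
  have "(1 + 1 / real n) ^ n \<le> exp (1 / real n) ^ n"
    using exp_ge_add_one_self[of "1 / real n"] by (intro power_mono) auto
  also have "\<dots> = exp 1" using n by (simp flip: exp_of_nat_mult)
  also have "\<dots> \<le> 3" by (rule exp_le)
  finally have "(1 + 1 / real n) ^ n * (12 * L * (\<Sum>k<n. \<delta> * e k)) \<le> 3 * (12 * L * (\<Sum>k<n. \<delta> * e k))"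
    using L \<delta> e0 by (intro mult_right_mono mult_nonneg_nonneg sum_nonneg) auto
  then have "expectation (\<lambda>\<omega>. S n \<omega> ^ 4) \<le> 36 * L * (\<Sum>k<n. \<delta> * e k)" using *(2) by linarith
  with *(1) show ?int ?le unfolding S_def e_def \<delta>_def by blast+
qed

section \<open>Square integrable limits of simple integrals\<close>

definition on_interval :: "real \<Rightarrow> real \<Rightarrow> (real \<Rightarrow> 'w \<Rightarrow> real) \<Rightarrow> 'w \<times> real \<Rightarrow> real" where
  "on_interval a b H p = H (snd p) (fst p) * indicator {a<..b} (snd p)"

text \<open>\<open>simple_ito\<close> prescribes a simple process on the half-open interval only,
  while \<open>is_ito_integral\<close> measures distances over the closed one; the left endpoint is
  a null set. In terms of \<open>on_interval\<close> the iterated integral is an L2 distance on the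
  product space, to which the triangle inequality applies.\<close>

lemma on_interval_dist:
  assumes [measurable]: "on_interval a b H \<in> borel_measurable (M \<Otimes>\<^sub>M lborel)" "on_interval a b H' \<in> borel_measurable (M \<Otimes>\<^sub>M lborel)"
  shows "(\<integral>\<^sup>+\<omega>. (\<integral>\<^sup>+r\<in>{a..b}. ennreal ((H r \<omega> - H' r \<omega>)\<^sup>2) \<partial>lborel) \<partial>M)
    = sqdist (M \<Otimes>\<^sub>M lborel) (on_interval a b H) (on_interval a b H')"
proof -
  have "sqdist (M \<Otimes>\<^sub>M lborel) (on_interval a b H) (on_interval a b H') =
    (\<integral>\<^sup>+\<omega>. (\<integral>\<^sup>+r. ennreal ((on_interval a b H (\<omega>, r) - on_interval a b H' (\<omega>, r))\<^sup>2) \<partial>lborel) \<partial>M)"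
    unfolding sqdist_def by (rule lborel.nn_integral_fst[symmetric]) measurable
  also have "\<dots> = (\<integral>\<^sup>+\<omega>. (\<integral>\<^sup>+r\<in>{a..b}. ennreal ((H r \<omega> - H' r \<omega>)\<^sup>2) \<partial>lborel) \<partial>M)"
  proof (rule nn_integral_cong, rule nn_integral_cong_AE)
    fix \<omega>
    have "AE r in lborel. r \<noteq> a" by (rule AE_lborel_singleton)
    then show "AE r in lborel. ennreal ((on_interval a b H (\<omega>, r) - on_interval a b H' (\<omega>, r))\<^sup>2) = ennreal ((H r \<omega> - H' r \<omega>)\<^sup>2) * indicator {a..b} r"
      by eventually_elim (auto simp: on_interval_def indicator_def)
  qed
  finally show ?thesis by simp
qed

lemma simple_itoE:
  assumes "simple_ito M F B a b H I" "0 \<le> a" "b \<le> T"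
  obtains n \<tau> \<xi> where "\<And>k. k < n \<Longrightarrow> a \<le> \<tau> k \<and> \<tau> k < \<tau> (Suc k) \<and> \<tau> (Suc k) \<le> b"
    "\<And>k. k < n \<Longrightarrow> \<xi> k \<in> borel_measurable (F (\<tau> k))" "\<And>k. k < n \<Longrightarrow> \<exists>C. \<forall>\<omega>\<in>space M. \<bar>\<xi> k \<omega>\<bar> \<le> C"
    "\<And>\<omega> r. \<omega> \<in> space M \<Longrightarrow> on_interval a b H (\<omega>, r) = (\<Sum>k<n. \<xi> k \<omega> * indicator {\<tau> k<..\<tau> (Suc k)} r)"
    "\<And>\<omega>. \<omega> \<in> space M \<Longrightarrow> I \<omega> = (\<Sum>k<n. \<xi> k \<omega> * (B (\<tau> (Suc k)) \<omega> - B (\<tau> k) \<omega>))"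
proof -
  from assms(1) obtain n \<tau> \<xi> where
    s: "\<tau> 0 = a" "\<tau> n = b" "\<And>k. k<n \<Longrightarrow> \<tau> k < \<tau> (Suc k)"
       "\<And>k. k<n \<Longrightarrow> \<xi> k \<in> borel_measurable (F (\<tau> k)) \<and> (\<exists>C. \<forall>\<omega>\<in>space M. \<bar>\<xi> k \<omega>\<bar> \<le> C)"
       "\<And>r \<omega>. r\<in>{a<..b} \<Longrightarrow> \<omega>\<in>space M \<Longrightarrow> H r \<omega> = (\<Sum>k<n. \<xi> k \<omega> * indicator {\<tau> k<..\<tau> (Suc k)} r)"
       "\<And>\<omega>. \<omega>\<in>space M \<Longrightarrow> I \<omega> = (\<Sum>k<n. \<xi> k \<omega> * (B (\<tau> (Suc k)) \<omega> - B (\<tau> k) \<omega>))"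
    unfolding simple_ito_def by blast
  have ge: "k \<le> n \<Longrightarrow> a \<le> \<tau> k" for k
  proof (induction k)
    case (Suc k) then show ?case using s(3)[of k] by simp
  qed (simp add: s)
  have le: "\<tau> k \<le> b" if "k \<le> n" for k
    using that
  proof (induction k rule: inc_induct)
    case (step k) then show ?case using s(3)[of k] by simp
  qed (simp add: s)
  have rng: "a \<le> \<tau> k \<and> \<tau> k < \<tau> (Suc k) \<and> \<tau> (Suc k) \<le> b" if "k < n" for k
    using ge[of k] le[of "Suc k"] s(3)[OF that] that by simp
  show ?thesis
  proof (rule that[of n \<tau> \<xi>])
    fix \<omega> r assume \<omega>: "\<omega> \<in> space M"
    show "on_interval a b H (\<omega>, r) = (\<Sum>k<n. \<xi> k \<omega> * indicator {\<tau> k<..\<tau> (Suc k)} r)"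
    proof (cases "r \<in> {a<..b}")
      case True then show ?thesis using s(5)[OF True \<omega>] by (simp add: on_interval_def)
    next
      case False
      have "(\<Sum>k<n. \<xi> k \<omega> * indicator {\<tau> k<..\<tau> (Suc k)} r) = 0"
        by (rule sum.neutral) (use rng False in \<open>force simp: indicator_def\<close>)
      then show ?thesis using False by (simp add: on_interval_def)
    qed
  qed (use s rng in auto)
qed

lemma simple_ito_measurable:
  assumes s: "simple_ito M F B a b H I" "0 \<le> a" "b \<le> T"
  shows "I \<in> borel_measurable M" "on_interval a b H \<in> borel_measurable (M \<Otimes>\<^sub>M lborel)"
proof -
  obtain n \<tau> \<xi> where rng: "\<And>k. k < n \<Longrightarrow> a \<le> \<tau> k \<and> \<tau> k < \<tau> (Suc k) \<and> \<tau> (Suc k) \<le> b"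
    and \<xi>: "\<And>k. k < n \<Longrightarrow> \<xi> k \<in> borel_measurable (F (\<tau> k))" "\<And>k. k < n \<Longrightarrow> \<exists>C. \<forall>\<omega>\<in>space M. \<bar>\<xi> k \<omega>\<bar> \<le> C"
    and r: "\<And>\<omega> r. \<omega> \<in> space M \<Longrightarrow> on_interval a b H (\<omega>, r) = (\<Sum>k<n. \<xi> k \<omega> * indicator {\<tau> k<..\<tau> (Suc k)} r)"
    and i: "\<And>\<omega>. \<omega> \<in> space M \<Longrightarrow> I \<omega> = (\<Sum>k<n. \<xi> k \<omega> * (B (\<tau> (Suc k)) \<omega> - B (\<tau> k) \<omega>))"
    by (rule simple_itoE[OF s]) (rule that)
  have \<xi>M: "\<xi> k \<in> borel_measurable M" if "k < n" for k using measurable_F_M[OF \<xi>(1)[OF that]] .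
  have "(\<lambda>\<omega>. \<Sum>k<n. \<xi> k \<omega> * (B (\<tau> (Suc k)) \<omega> - B (\<tau> k) \<omega>)) \<in> borel_measurable M"
  proof (intro borel_measurable_sum borel_measurable_times borel_measurable_diff B_measurable_M)
    fix k assume "k \<in> {..<n}"
    then show "\<tau> k \<in> {0..T}" "\<tau> (Suc k) \<in> {0..T}" using rng[of k] s by auto
  qed (use \<xi>M in auto)
  then show "I \<in> borel_measurable M" by (subst measurable_cong[OF i]) auto
  have "(\<lambda>p. \<Sum>k<n. \<xi> k (fst p) * indicator {\<tau> k<..\<tau> (Suc k)} (snd p)) \<in> borel_measurable (M \<Otimes>\<^sub>M lborel)"
    by (intro borel_measurable_sum borel_measurable_times measurable_compose[OF measurable_fst \<xi>M]
      measurable_compose[OF measurable_snd borel_measurable_indicator]) auto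
  then show "on_interval a b H \<in> borel_measurable (M \<Otimes>\<^sub>M lborel)"
    by (subst measurable_cong[where g="\<lambda>p. \<Sum>k<n. \<xi> k (fst p) * indicator {\<tau> k<..\<tau> (Suc k)} (snd p)"])
       (auto simp: space_pair_measure r)
qed

lemma simple_ito_isometry:
  assumes s: "simple_ito M F B a b H I" "simple_ito M F B a b H' I'" "0 \<le> a" "b \<le> T"
  shows "sqdist M I I' = sqdist (M \<Otimes>\<^sub>M lborel) (on_interval a b H) (on_interval a b H')"
proof -
  obtain n \<tau> \<xi> where rng: "\<And>k. k < n \<Longrightarrow> a \<le> \<tau> k \<and> \<tau> k < \<tau> (Suc k) \<and> \<tau> (Suc k) \<le> b"
    and \<xi>: "\<And>k. k < n \<Longrightarrow> \<xi> k \<in> borel_measurable (F (\<tau> k))" "\<And>k. k < n \<Longrightarrow> \<exists>C. \<forall>\<omega>\<in>space M. \<bar>\<xi> k \<omega>\<bar> \<le> C"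
    and r: "\<And>\<omega> r. \<omega> \<in> space M \<Longrightarrow> on_interval a b H (\<omega>, r) = (\<Sum>k<n. \<xi> k \<omega> * indicator {\<tau> k<..\<tau> (Suc k)} r)"
    and i: "\<And>\<omega>. \<omega> \<in> space M \<Longrightarrow> I \<omega> = (\<Sum>k<n. \<xi> k \<omega> * (B (\<tau> (Suc k)) \<omega> - B (\<tau> k) \<omega>))"
    by (rule simple_itoE[OF s(1,3,4)]) (rule that)
  obtain n' \<tau>' \<xi>' where rng': "\<And>k. k < n' \<Longrightarrow> a \<le> \<tau>' k \<and> \<tau>' k < \<tau>' (Suc k) \<and> \<tau>' (Suc k) \<le> b"
    and \<xi>': "\<And>k. k < n' \<Longrightarrow> \<xi>' k \<in> borel_measurable (F (\<tau>' k))" "\<And>k. k < n' \<Longrightarrow> \<exists>C. \<forall>\<omega>\<in>space M. \<bar>\<xi>' k \<omega>\<bar> \<le> C"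
    and r': "\<And>\<omega> r. \<omega> \<in> space M \<Longrightarrow> on_interval a b H' (\<omega>, r) = (\<Sum>k<n'. \<xi>' k \<omega> * indicator {\<tau>' k<..\<tau>' (Suc k)} r)"
    and i': "\<And>\<omega>. \<omega> \<in> space M \<Longrightarrow> I' \<omega> = (\<Sum>k<n'. \<xi>' k \<omega> * (B (\<tau>' (Suc k)) \<omega> - B (\<tau>' k) \<omega>))"
    by (rule simple_itoE[OF s(2,3,4)]) (rule that)
  \<comment> \<open>Over the disjoint union of both index sets, with the second family of
    coefficients negated, the difference of the two simple integrals is one elementary sum.\<close>
  define K where "K = {..<n} <+> {..<n'}"
  define u where "u = case_sum \<tau> \<tau>'"
  define v where "v = case_sum (\<lambda>k. \<tau> (Suc k)) (\<lambda>k. \<tau>' (Suc k))"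
  define X where "X = case_sum \<xi> (\<lambda>k \<omega>. - \<xi>' k \<omega>)"
  have sumK: "sum f K = (\<Sum>k<n. f (Inl k)) + (\<Sum>k<n'. f (Inr k))" for f :: "nat + nat \<Rightarrow> real"
    unfolding K_def by (subst sum.Plus) auto
  have iso: "(\<integral>\<^sup>+\<omega>. ennreal ((\<Sum>k\<in>K. X k \<omega> * (B (v k) \<omega> - B (u k) \<omega>))\<^sup>2) \<partial>M)
    = (\<integral>\<^sup>+\<omega>. (\<integral>\<^sup>+r. ennreal ((\<Sum>k\<in>K. X k \<omega> * indicator {u k<..v k} r)\<^sup>2) \<partial>lborel) \<partial>M)"
  proof (rule elementary_isometry)
    show "finite K" by (simp add: K_def)
    fix k assume k: "k \<in> K"
    show "0 \<le> u k \<and> u k < v k \<and> v k \<le> T"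
      using k rng rng' s by (force simp: K_def u_def v_def)
    show "X k \<in> borel_measurable (F (u k))"
      using k \<xi>(1) \<xi>'(1) by (auto simp: K_def X_def u_def)
    show "\<exists>C. \<forall>\<omega>\<in>space M. \<bar>X k \<omega>\<bar> \<le> C"
      using k \<xi>(2) \<xi>'(2) by (auto simp: K_def X_def)
  qed
  have "sqdist M I I' = (\<integral>\<^sup>+\<omega>. ennreal ((\<Sum>k\<in>K. X k \<omega> * (B (v k) \<omega> - B (u k) \<omega>))\<^sup>2) \<partial>M)"
    unfolding sqdist_def by (intro nn_integral_cong) (simp add: sumK X_def u_def v_def i i' sum_negf)
  also note iso
  also have "(\<integral>\<^sup>+\<omega>. (\<integral>\<^sup>+r. ennreal ((\<Sum>k\<in>K. X k \<omega> * indicator {u k<..v k} r)\<^sup>2) \<partial>lborel) \<partial>M) =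
    (\<integral>\<^sup>+\<omega>. (\<integral>\<^sup>+r. ennreal ((on_interval a b H (\<omega>, r) - on_interval a b H' (\<omega>, r))\<^sup>2) \<partial>lborel) \<partial>M)"
    by (intro nn_integral_cong) (simp add: sumK X_def u_def v_def r r' sum_negf)
  also have "\<dots> = sqdist (M \<Otimes>\<^sub>M lborel) (on_interval a b H) (on_interval a b H')"
    unfolding sqdist_def
    by (rule lborel.nn_integral_fst) (use simple_ito_measurable(2)[OF s(1,3,4)] simple_ito_measurable(2)[OF s(2,3,4)] in measurable)
  finally show ?thesis .
qed

lemma is_ito_integral_iff:
  assumes [measurable]: "on_interval a b H \<in> borel_measurable (M \<Otimes>\<^sub>M lborel)" and ab: "0 \<le> a" "b \<le> T"
  shows "is_ito_integral M F B a b H Y \<longleftrightarrow> Y \<in> borel_measurable M \<and>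
    (\<exists>Hs Is. (\<forall>n. simple_ito M F B a b (Hs n) (Is n)) \<and>
      (\<lambda>n. sqdist (M \<Otimes>\<^sub>M lborel) (on_interval a b (Hs n)) (on_interval a b H)) \<longlonglongrightarrow> 0 \<and> (\<lambda>n. sqdist M (Is n) Y) \<longlonglongrightarrow> 0)"
proof -
  have *: "(\<integral>\<^sup>+\<omega>. (\<integral>\<^sup>+r\<in>{a..b}. ennreal ((Hs n r \<omega> - H r \<omega>)\<^sup>2) \<partial>lborel) \<partial>M) = sqdist (M \<Otimes>\<^sub>M lborel) (on_interval a b (Hs n)) (on_interval a b H)"
    if "\<forall>n. simple_ito M F B a b (Hs n) (Is n)" for n Hs Is
    using simple_ito_measurable(2)[OF that[rule_format] ab] by (intro on_interval_dist assms)
  have eq: "(\<lambda>n. \<integral>\<^sup>+\<omega>. (\<integral>\<^sup>+r\<in>{a..b}. ennreal ((Hs n r \<omega> - H r \<omega>)\<^sup>2) \<partial>lborel) \<partial>M)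
      = (\<lambda>n. sqdist (M \<Otimes>\<^sub>M lborel) (on_interval a b (Hs n)) (on_interval a b H))" if "\<forall>n. simple_ito M F B a b (Hs n) (Is n)" for Hs Is
    by (intro ext *[OF that])
  have "(\<forall>n. simple_ito M F B a b (Hs n) (Is n)) \<and>
      (\<lambda>n. \<integral>\<^sup>+\<omega>. (\<integral>\<^sup>+r\<in>{a..b}. ennreal ((Hs n r \<omega> - H r \<omega>)\<^sup>2) \<partial>lborel) \<partial>M) \<longlonglongrightarrow> 0 \<and> Q \<longleftrightarrow>
    (\<forall>n. simple_ito M F B a b (Hs n) (Is n)) \<and>
      (\<lambda>n. sqdist (M \<Otimes>\<^sub>M lborel) (on_interval a b (Hs n)) (on_interval a b H)) \<longlonglongrightarrow> 0 \<and> Q" for Hs Is Q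
    using eq[of Hs Is] by (intro conj_cong refl) simp
  then show ?thesis unfolding is_ito_integral_def sqdist_def[of M, symmetric] by simp
qed

text \<open>By the isometry, two approximating sequences of the same integrand have integrals that
  approach each other. Hence the value chosen by \<open>ito_integral\<close> is determined up to a
  null set whenever an integral exists.\<close>

lemma is_ito_integral_unique:
  assumes H[measurable]: "on_interval a b H \<in> borel_measurable (M \<Otimes>\<^sub>M lborel)" and ab: "0 \<le> a" "b \<le> T"
    and Y: "is_ito_integral M F B a b H Y" and Y': "is_ito_integral M F B a b H Y'"
  shows "AE \<omega> in M. Y \<omega> = Y' \<omega>"
proof -
  have [measurable]: "Y \<in> borel_measurable M" "Y' \<in> borel_measurable M" using Y Y' by (auto simp: is_ito_integral_def)
  from Y obtain Hs Is where s: "\<And>n. simple_ito M F B a b (Hs n) (Is n)"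
    and l: "(\<lambda>n. sqdist (M \<Otimes>\<^sub>M lborel) (on_interval a b (Hs n)) (on_interval a b H)) \<longlonglongrightarrow> 0" "(\<lambda>n. sqdist M (Is n) Y) \<longlonglongrightarrow> 0"
    unfolding is_ito_integral_iff[OF H ab] by blast
  from Y' obtain Hs' Is' where s': "\<And>n. simple_ito M F B a b (Hs' n) (Is' n)"
    and l': "(\<lambda>n. sqdist (M \<Otimes>\<^sub>M lborel) (on_interval a b (Hs' n)) (on_interval a b H)) \<longlonglongrightarrow> 0" "(\<lambda>n. sqdist M (Is' n) Y') \<longlonglongrightarrow> 0"
    unfolding is_ito_integral_iff[OF H ab] by blast
  note [measurable] = simple_ito_measurable[OF s ab] simple_ito_measurable[OF s' ab]
  let ?N = "M \<Otimes>\<^sub>M lborel"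
  have le: "sqdist M Y Y' \<le> 2 * sqdist M (Is n) Y + 2 * (2 * (2 * sqdist ?N (on_interval a b (Hs n)) (on_interval a b H) + 2 * sqdist ?N (on_interval a b (Hs' n)) (on_interval a b H)) + 2 * sqdist M (Is' n) Y')" for n
  proof -
    have "sqdist M Y Y' \<le> 2 * sqdist M Y (Is n) + 2 * sqdist M (Is n) Y'" by (rule sqdist_triangle) auto
    also have "sqdist M (Is n) Y' \<le> 2 * sqdist M (Is n) (Is' n) + 2 * sqdist M (Is' n) Y'" by (rule sqdist_triangle) auto
    also have "sqdist M (Is n) (Is' n) = sqdist ?N (on_interval a b (Hs n)) (on_interval a b (Hs' n))"
      by (rule simple_ito_isometry[OF s s' ab])
    also have "\<dots> \<le> 2 * sqdist ?N (on_interval a b (Hs n)) (on_interval a b H) + 2 * sqdist ?N (on_interval a b H) (on_interval a b (Hs' n))"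
      by (rule sqdist_triangle) auto
    finally show ?thesis by (simp add: sqdist_commute mult_left_mono add_left_mono)
  qed
  have "(\<lambda>n. 2 * sqdist M (Is n) Y + 2 * (2 * (2 * sqdist ?N (on_interval a b (Hs n)) (on_interval a b H) + 2 * sqdist ?N (on_interval a b (Hs' n)) (on_interval a b H)) + 2 * sqdist M (Is' n) Y')) \<longlonglongrightarrow> 2 * 0 + 2 * (2 * (2 * 0 + 2 * 0) + 2 * 0)"
    by (intro tendsto_add ennreal_tendsto_cmult l l') auto
  then have "sqdist M Y Y' \<le> 2 * 0 + 2 * (2 * (2 * 0 + 2 * 0) + 2 * 0)" by (rule LIMSEQ_le_const) (use le in blast)
  then have "sqdist M Y Y' = 0" by simp
  then show ?thesis by (intro sqdist_eq_0) auto
qed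

end

section \<open>Approximation by lagged averages\<close>

definition grid :: "real \<Rightarrow> real \<Rightarrow> nat \<Rightarrow> nat \<Rightarrow> real" where
  "grid a b m k = a + (b - a) * real k / real m"

text \<open>Averaging over the preceding cell keeps the step process adapted and, by Jensen, does not increase
  its square or fourth power integral, so no bound on \<open>H\<close> is needed for the approximation; the clipping only
  supplies the bounded coefficients required of a simple process.\<close>

definition lag_avg :: "real \<Rightarrow> real \<Rightarrow> nat \<Rightarrow> (real \<Rightarrow> 'w \<Rightarrow> real) \<Rightarrow> nat \<Rightarrow> 'w \<Rightarrow> real" where
  "lag_avg a b m H k \<omega> = (if k = 0 then 0 else max (- real m) (min (real m)
     (real m / (b - a) * (LINT r:{grid a b m (k - 1)..grid a b m k}|lborel. H r \<omega>))))"

definition lag_step :: "real \<Rightarrow> real \<Rightarrow> nat \<Rightarrow> (real \<Rightarrow> 'w \<Rightarrow> real) \<Rightarrow> real \<Rightarrow> 'w \<Rightarrow> real" where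
  "lag_step a b m H r \<omega> = (\<Sum>k<m. lag_avg a b m H k \<omega> * indicator {grid a b m k<..grid a b m (Suc k)} r)"

definition lag_int :: "(real \<Rightarrow> 'w \<Rightarrow> real) \<Rightarrow> real \<Rightarrow> real \<Rightarrow> nat \<Rightarrow> (real \<Rightarrow> 'w \<Rightarrow> real) \<Rightarrow> 'w \<Rightarrow> real" where
  "lag_int B a b m H \<omega> = (\<Sum>k<m. lag_avg a b m H k \<omega> * (B (grid a b m (Suc k)) \<omega> - B (grid a b m k) \<omega>))"

lemma grid_simps:
  assumes "m > 0"
  shows "grid a b m 0 = a" "grid a b m m = b" "grid a b m (Suc k) - grid a b m k = (b - a) / real m"
  using assms by (auto simp: grid_def field_simps)

lemma grid_mono: "a < b \<Longrightarrow> k \<le> l \<Longrightarrow> grid a b m k \<le> grid a b m l"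
  by (auto simp: grid_def intro!: divide_right_mono)

lemma grid_strict:
  assumes "a < b" "m > 0"
  shows "grid a b m k < grid a b m (Suc k)"
proof -
  have "0 < (b - a) / real m" using assms by simp
  with grid_simps(3)[OF assms(2), of a b k] show ?thesis by linarith
qed

lemma grid_range: "a < b \<Longrightarrow> m > 0 \<Longrightarrow> k \<le> m \<Longrightarrow> a \<le> grid a b m k \<and> grid a b m k \<le> b"
  using grid_mono[of a b 0 k m] grid_mono[of a b k m m] grid_simps[of m a b] by simp

lemma partition_cell:
  fixes \<tau> :: "nat \<Rightarrow> real"
  assumes "r \<in> {\<tau> 0<..\<tau> n}"
  shows "\<exists>k<n. r \<in> {\<tau> k<..\<tau> (Suc k)}"
  using assms
proof (induction n)
  case (Suc n)
  then show ?case by (cases "r \<le> \<tau> n") (auto intro: less_SucI)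
qed simp

lemma step_sum_cell:
  fixes c :: "nat \<Rightarrow> real"
  assumes mono: "\<And>k l. k \<le> l \<Longrightarrow> \<tau> k \<le> (\<tau> l :: real)" and k: "k < n" "r \<in> {\<tau> k<..\<tau> (Suc k)}"
  shows "(\<Sum>j<n. c j * indicator {\<tau> j<..\<tau> (Suc j)} r) = c k"
proof -
  have "c j * indicator {\<tau> j<..\<tau> (Suc j)} r = (if j = k then c k else 0)" for j
  proof (cases j k rule: linorder_cases)
    case less
    then have "\<tau> (Suc j) \<le> \<tau> k" by (intro mono) simp
    then show ?thesis using k less by (auto simp: indicator_def)
  next
    case greater
    then have "\<tau> (Suc k) \<le> \<tau> j" by (intro mono) simp
    then show ?thesis using k greater by (auto simp: indicator_def)
  qed (use k in simp)
  then show ?thesis using k by simp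
qed

lemma step_sum_outside:
  fixes c :: "nat \<Rightarrow> real"
  assumes mono: "\<And>k l. k \<le> l \<Longrightarrow> \<tau> k \<le> (\<tau> l :: real)" and r: "r \<notin> {\<tau> 0<..\<tau> n}"
  shows "(\<Sum>j<n. c j * indicator {\<tau> j<..\<tau> (Suc j)} r) = 0"
proof (rule sum.neutral, rule ballI)
  fix j assume "j \<in> {..<n}"
  then have "\<tau> 0 \<le> \<tau> j" "\<tau> (Suc j) \<le> \<tau> n" by (auto intro: mono)
  then show "c j * indicator {\<tau> j<..\<tau> (Suc j)} r = 0" using r by (auto simp: indicator_def)
qed

lemma step_sum_power:
  fixes c :: "nat \<Rightarrow> real"
  assumes mono: "\<And>k l. k \<le> l \<Longrightarrow> \<tau> k \<le> (\<tau> l :: real)" and "p > 0"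
  shows "(\<Sum>j<n. c j * indicator {\<tau> j<..\<tau> (Suc j)} r) ^ p = (\<Sum>j<n. c j ^ p * indicator {\<tau> j<..\<tau> (Suc j)} r)"
proof (cases "r \<in> {\<tau> 0<..\<tau> n}")
  case True
  then obtain k where "k < n" "r \<in> {\<tau> k<..\<tau> (Suc k)}" using partition_cell by blast
  then show ?thesis using step_sum_cell[of \<tau> k n r, OF mono] by simp
next
  case False then show ?thesis using step_sum_outside[OF mono False] \<open>p > 0\<close> by simp
qed

lemma set_lint_partition:
  fixes f :: "real \<Rightarrow> real"
  assumes mono: "\<And>k l. k \<le> l \<Longrightarrow> \<tau> k \<le> (\<tau> l :: real)" and f: "continuous_on {\<tau> 0..\<tau> n} f"
  shows "(\<Sum>k<n. LINT r:{\<tau> k..\<tau> (Suc k)}|lborel. f r) = (LINT r:{\<tau> 0..\<tau> n}|lborel. f r)"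
proof -
  have eq: "(LINT r:{\<tau> k..\<tau> l}|lborel. f r) = integral {\<tau> k..\<tau> l} f" if "k \<le> l" "l \<le> n" for k l
  proof (rule set_borel_integral_eq_integral(2)[OF borel_integrable_atLeastAtMost'])
    show "continuous_on {\<tau> k..\<tau> l} f"
      by (rule continuous_on_subset[OF f]) (use mono[of 0 k] mono[of l n] that in auto)
  qed
  have "j \<le> n \<Longrightarrow> (\<Sum>k<j. integral {\<tau> k..\<tau> (Suc k)} f) = integral {\<tau> 0..\<tau> j} f" for j
  proof (induction j)
    case (Suc j)
    have "continuous_on {\<tau> 0..\<tau> (Suc j)} f"
      by (rule continuous_on_subset[OF f]) (use mono[of "Suc j" n] Suc.prems in auto)
    then have "integral {\<tau> 0..\<tau> j} f + integral {\<tau> j..\<tau> (Suc j)} f = integral {\<tau> 0..\<tau> (Suc j)} f"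
      by (intro Henstock_Kurzweil_Integration.integral_combine mono integrable_continuous_real) auto
    then show ?case using Suc by simp
  qed simp
  from this[of n] show ?thesis by (simp add: eq)
qed

lemma abs_clip_le: "\<bar>max (- c) (min c x)\<bar> \<le> \<bar>x :: real\<bar>" if "c \<ge> 0"
  using that by (auto simp: max_def min_def)

lemma lag_avg_power_le:
  assumes ab: "a < b" "m > 0" and c: "continuous_on {a..b} (\<lambda>r. H r \<omega>)" and p: "p = 2 \<or> p = 4"
  shows "(\<Sum>k<m. (b - a) / real m * lag_avg a b m H k \<omega> ^ p) \<le> (LINT r:{a..b}|lborel. H r \<omega> ^ p)"
proof -
  define \<delta> where "\<delta> = (b - a) / real m"
  have \<delta>: "\<delta> > 0" using ab by (simp add: \<delta>_def)
  let ?g = "grid a b m"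
  have ep: "even p" using p by auto
  have cg: "continuous_on {?g k..?g l} (\<lambda>r. H r \<omega>)" if "k \<le> m" "l \<le> m" for k l
    by (rule continuous_on_subset[OF c]) (use grid_range[of a b m k] grid_range[of a b m l] ab that in auto)
  have 1: "\<delta> * lag_avg a b m H (Suc k) \<omega> ^ p \<le> (LINT r:{?g k..?g (Suc k)}|lborel. H r \<omega> ^ p)" if "Suc k < m" for k
  proof -
    define I where "I = (LINT r:{?g k..?g (Suc k)}|lborel. H r \<omega>)"
    have le: "?g k \<le> ?g (Suc k)" and d: "?g (Suc k) - ?g k = \<delta>"
      using grid_mono[of a b k "Suc k" m] grid_simps(3)[of m a b k] ab by (auto simp: \<delta>_def)
    have I: "I ^ p \<le> \<delta> ^ (p - 1) * (LINT r:{?g k..?g (Suc k)}|lborel. H r \<omega> ^ p)"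
      using p set_lint_power2_le[OF cg le] set_lint_power4_le[OF cg le] that unfolding d I_def by auto
    have "\<bar>lag_avg a b m H (Suc k) \<omega>\<bar> \<le> \<bar>I / \<delta>\<bar>"
      using abs_clip_le[of "real m" "I / \<delta>"] by (simp add: lag_avg_def I_def \<delta>_def mult.commute)
    then have "\<bar>lag_avg a b m H (Suc k) \<omega>\<bar> ^ p \<le> \<bar>I / \<delta>\<bar> ^ p" by (rule power_mono) simp
    then have "lag_avg a b m H (Suc k) \<omega> ^ p \<le> (I / \<delta>) ^ p" unfolding power_even_abs[OF ep] .
    then have "\<delta> * lag_avg a b m H (Suc k) \<omega> ^ p \<le> \<delta> * (I / \<delta>) ^ p" using \<delta> by simp
    also have "\<dots> = I ^ p / \<delta> ^ (p - 1)"
      using \<delta> p by (auto simp: power_divide power2_eq_square power4_eq_xxxx power3_eq_cube)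
    also have "\<dots> \<le> (LINT r:{?g k..?g (Suc k)}|lborel. H r \<omega> ^ p)"
      using I \<delta> by (simp add: divide_le_eq mult.commute)
    finally show ?thesis .
  qed
  obtain m' where m': "m = Suc m'" using ab(2) by (cases m) auto
  have pos: "0 \<le> (LINT r:{?g m'..?g (Suc m')}|lborel. H r \<omega> ^ p)"
    unfolding set_lebesgue_integral_def by (rule integral_nonneg_AE) (simp add: ep zero_le_even_power)
  have p0: "p > 0" using p by auto
  have "(\<Sum>k<m. \<delta> * lag_avg a b m H k \<omega> ^ p) = (\<Sum>k<m'. \<delta> * lag_avg a b m H (Suc k) \<omega> ^ p)"
    unfolding m' by (subst sum.lessThan_Suc_shift) (use p0 in \<open>simp add: lag_avg_def\<close>)
  also have "\<dots> \<le> (\<Sum>k<m'. LINT r:{?g k..?g (Suc k)}|lborel. H r \<omega> ^ p)"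
    by (intro sum_mono 1) (use m' in auto)
  also have "\<dots> \<le> (\<Sum>k<m. LINT r:{?g k..?g (Suc k)}|lborel. H r \<omega> ^ p)"
    using pos by (simp add: m')
  also have "\<dots> = (LINT r:{?g 0..?g m}|lborel. H r \<omega> ^ p)"
    by (intro set_lint_partition grid_mono ab continuous_intros cg) auto
  finally show ?thesis using ab by (simp add: grid_simps \<delta>_def)
qed

lemma lag_step_power_integral:
  assumes ab: "a < b" "m > 0" and p: "even p" "p > 0"
  shows "(\<integral>\<^sup>+r\<in>{a..b}. ennreal (lag_step a b m H r \<omega> ^ p) \<partial>lborel) = ennreal (\<Sum>k<m. (b - a) / real m * lag_avg a b m H k \<omega> ^ p)"
proof -
  let ?g = "grid a b m"
  have "has_bochner_integral lborel (\<lambda>r. \<Sum>k<m. lag_avg a b m H k \<omega> ^ p * indicator {?g k<..?g (Suc k)} r)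
     (\<Sum>k<m. lag_avg a b m H k \<omega> ^ p * ((b - a) / real m))"
  proof (intro has_bochner_integral_sum has_bochner_integral_mult_right)
    fix k
    have "has_bochner_integral lborel (indicator {?g k<..?g (Suc k)} :: real \<Rightarrow> real) (measure lborel {?g k<..?g (Suc k)})"
      by (rule has_bochner_integral_real_indicator) (use grid_mono[of a b k "Suc k" m] ab in auto)
    then show "has_bochner_integral lborel (indicator {?g k<..?g (Suc k)}) ((b - a) / real m)"
      using grid_mono[of a b k "Suc k" m] ab grid_simps(3)[of m a b k] by simp
  qed
  moreover have "(\<Sum>k<m. lag_avg a b m H k \<omega> ^ p * indicator {?g k<..?g (Suc k)} r) = lag_step a b m H r \<omega> ^ p" for r
    unfolding lag_step_def by (rule step_sum_power[OF grid_mono p(2), symmetric]) (use ab in auto)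
  ultimately have hb: "has_bochner_integral lborel (\<lambda>r. lag_step a b m H r \<omega> ^ p) (\<Sum>k<m. (b - a) / real m * lag_avg a b m H k \<omega> ^ p)"
    by (simp add: mult.commute)
  have "(\<integral>\<^sup>+r\<in>{a..b}. ennreal (lag_step a b m H r \<omega> ^ p) \<partial>lborel) = (\<integral>\<^sup>+r. ennreal (lag_step a b m H r \<omega> ^ p) \<partial>lborel)"
  proof (rule nn_integral_cong)
    fix r
    have "lag_step a b m H r \<omega> = 0" if "r \<notin> {a..b}"
      unfolding lag_step_def by (rule step_sum_outside[OF grid_mono]) (use ab that grid_simps[of m a b] in auto)
    then show "ennreal (lag_step a b m H r \<omega> ^ p) * indicator {a..b} r = ennreal (lag_step a b m H r \<omega> ^ p)"
      using p by (cases "r \<in> {a..b}") auto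
  qed
  also have "\<dots> = ennreal (\<Sum>k<m. (b - a) / real m * lag_avg a b m H k \<omega> ^ p)"
    using hb p by (subst nn_integral_eq_integral) (auto simp: has_bochner_integral_iff zero_le_even_power)
  finally show ?thesis .
qed

lemma lag_step_power_le:
  assumes ab: "a < b" "m > 0" and c: "continuous_on {a..b} (\<lambda>r. H r \<omega>)" and p: "p = 2 \<or> p = 4"
  shows "(\<integral>\<^sup>+r\<in>{a..b}. ennreal (lag_step a b m H r \<omega> ^ p) \<partial>lborel) \<le> (\<integral>\<^sup>+r\<in>{a..b}. ennreal (H r \<omega> ^ p) \<partial>lborel)"
proof -
  have ep: "even p" "p > 0" using p by auto
  have "(\<integral>\<^sup>+r\<in>{a..b}. ennreal (H r \<omega> ^ p) \<partial>lborel) = ennreal (LINT r:{a..b}|lborel. H r \<omega> ^ p)"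
    by (intro nn_integral_eq_set_lint continuous_intros c) (simp add: ep zero_le_even_power)
  then show ?thesis unfolding lag_step_power_integral[OF ab ep]
    using ennreal_leI[OF lag_avg_power_le[where H=H and \<omega>=\<omega>, OF ab c p]] by metis
qed

text \<open>An average inherits the bounds that hold on its cell, and the clipping at m is inactive
  once m exceeds these bounds.\<close>

lemma lag_avg_between:
  assumes ab: "a < b" "m > 0" and c: "continuous_on {a..b} (\<lambda>r. H r \<omega>)" and k: "0 < k" "k \<le> m"
    and bnd: "\<And>q. q \<in> {grid a b m (k - 1)..grid a b m k} \<Longrightarrow> lo \<le> H q \<omega> \<and> H q \<omega> \<le> hi"
    and clip: "- real m \<le> lo" "hi \<le> real m"
  shows "lo \<le> lag_avg a b m H k \<omega> \<and> lag_avg a b m H k \<omega> \<le> hi"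
proof -
  let ?u = "grid a b m (k - 1)" and ?v = "grid a b m k"
  have d: "?v - ?u = (b - a) / real m" using grid_simps(3)[of m a b "k - 1"] ab k by simp
  have le: "?u \<le> ?v" using grid_mono[of a b "k - 1" k m] ab by simp
  have cg: "continuous_on {?u..?v} (\<lambda>r. H r \<omega>)"
    by (rule continuous_on_subset[OF c]) (use grid_range[of a b m "k - 1"] grid_range[of a b m k] ab k in auto)
  have const: "(LINT r:{?u..?v}|lborel. y) = y * (b - a) / real m" for y :: real
    using le d by (simp add: set_lebesgue_integral_def mult.commute)
  have "(LINT r:{?u..?v}|lborel. lo) \<le> (LINT r:{?u..?v}|lborel. H r \<omega>)"
    by (intro set_lint_mono_cont cg continuous_intros) (use bnd in auto)
  moreover have "(LINT r:{?u..?v}|lborel. H r \<omega>) \<le> (LINT r:{?u..?v}|lborel. hi)"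
    by (intro set_lint_mono_cont cg continuous_intros) (use bnd in auto)
  ultimately have "lo \<le> real m / (b - a) * (LINT r:{?u..?v}|lborel. H r \<omega>)"
    "real m / (b - a) * (LINT r:{?u..?v}|lborel. H r \<omega>) \<le> hi"
    unfolding const using ab by (auto simp: field_simps)
  then show ?thesis using k clip by (simp add: lag_avg_def)
qed

lemma lag_step_cell:
  assumes ab: "a < b" "m > 0" and r: "r \<in> {a<..b}"
  obtains k where "k < m" "r \<in> {grid a b m k<..grid a b m (Suc k)}" "lag_step a b m H r \<omega> = lag_avg a b m H k \<omega>"
proof -
  obtain k where k: "k < m" "r \<in> {grid a b m k<..grid a b m (Suc k)}"
    using partition_cell[of r "grid a b m" m] r grid_simps[of m a b] ab by auto
  show ?thesis
    by (rule that[OF k]) (unfold lag_step_def, rule step_sum_cell[OF grid_mono[OF ab(1)] k])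
qed

lemma lag_step_tendsto:
  assumes ab: "a < b" and c: "continuous_on {a..b} (\<lambda>r. H r \<omega>)" and r: "r \<in> {a<..b}"
  shows "(\<lambda>m. lag_step a b (Suc m) H r \<omega>) \<longlonglongrightarrow> H r \<omega>"
proof (rule metric_LIMSEQ_I)
  fix e :: real assume e: "e > 0"
  have "r \<in> {a..b}" using r by auto
  from c[unfolded continuous_on_iff, rule_format, OF this half_gt_zero[OF e]]
  obtain d where d: "d > 0" "\<And>q. q \<in> {a..b} \<Longrightarrow> dist q r < d \<Longrightarrow> dist (H q \<omega>) (H r \<omega>) < e / 2" by blast
  \<comment> \<open>The choice of \<open>N\<close> serves three ends: two mesh widths fit into the
    continuity radius d; two mesh widths fit between a and r, so r is not in the first cell; and the
    clipping level exceeds the values near r.\<close>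
  obtain N :: nat where N: "max (2 * (b - a) / min d (r - a)) (\<bar>H r \<omega>\<bar> + e) < real N" using reals_Archimedean2 by blast
  show "\<exists>n0. \<forall>n\<ge>n0. dist (lag_step a b (Suc n) H r \<omega>) (H r \<omega>) < e"
  proof (intro exI allI impI)
    fix n assume n: "n \<ge> N"
    let ?m = "Suc n"
    have m: "2 * (b - a) / min d (r - a) < real ?m" "\<bar>H r \<omega>\<bar> + e < real ?m" using N n by auto
    have dr: "min d (r - a) > 0" using d r by auto
    have small: "2 * ((b - a) / real ?m) < min d (r - a)"
      using m(1) dr by (simp add: field_simps del: min_less_iff_conj)
    have sp: "(b - a) / real ?m > 0" using ab by simp
    obtain k where k: "k < ?m" "r \<in> {grid a b ?m k<..grid a b ?m (Suc k)}" "lag_step a b ?m H r \<omega> = lag_avg a b ?m H k \<omega>"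
      using lag_step_cell[OF ab _ r, of ?m H \<omega>] by auto
    have k0: "k \<noteq> 0"
    proof
      assume "k = 0"
      then have "r \<le> a + (b - a) / real ?m" using k(2) grid_simps(3)[of ?m a b 0] grid_simps(1)[of ?m a b] by simp
      then show False using small sp by linarith
    qed
    then obtain j where j: "k = Suc j" by (cases k) auto
    have rng: "a \<le> grid a b ?m j" "grid a b ?m k \<le> b" using grid_range[of a b ?m j] grid_range[of a b ?m k] ab k j by auto
    have "H r \<omega> - e / 2 \<le> lag_avg a b ?m H k \<omega> \<and> lag_avg a b ?m H k \<omega> \<le> H r \<omega> + e / 2"
    proof (rule lag_avg_between[where H=H and \<omega>=\<omega>, OF ab _ c])
      fix q assume q: "q \<in> {grid a b ?m (k - 1)..grid a b ?m k}"
      define \<delta> where "\<delta> = (b - a) / real ?m"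
      have "grid a b ?m (Suc j) - grid a b ?m j = \<delta>" "grid a b ?m (Suc (Suc j)) - grid a b ?m (Suc j) = \<delta>"
        unfolding \<delta>_def by (rule grid_simps(3); simp)+
      then have "r - q \<le> 2 * \<delta>" using q k(2) unfolding j by simp
      then have "r - q \<le> 2 * ((b - a) / real ?m)" by (simp only: \<delta>_def)
      moreover have "q < r" using q k(2) by auto
      ultimately have "dist q r < d" using small by (auto simp: dist_real_def)
      moreover have "q \<in> {a..b}" using q rng j by auto
      ultimately have "dist (H q \<omega>) (H r \<omega>) < e / 2" using d by blast
      then show "H r \<omega> - e / 2 \<le> H q \<omega> \<and> H q \<omega> \<le> H r \<omega> + e / 2" unfolding dist_real_def by (simp only: abs_less_iff) linarith
    qed (use k0 k m e in auto)
    then show "dist (lag_step a b ?m H r \<omega>) (H r \<omega>) < e" using k(3) e by (auto simp: dist_real_def abs_less_iff)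
  qed
qed

lemma lag_step_bound:
  assumes ab: "a < b" "m > 0" and c: "continuous_on {a..b} (\<lambda>r. H r \<omega>)" and C: "\<And>r. r \<in> {a..b} \<Longrightarrow> \<bar>H r \<omega>\<bar> \<le> C" and r: "r \<in> {a<..b}"
  shows "\<bar>lag_step a b m H r \<omega>\<bar> \<le> C"
proof -
  have C0: "0 \<le> C" using C[of a] ab by auto
  obtain k where k: "k < m" "lag_step a b m H r \<omega> = lag_avg a b m H k \<omega>" using lag_step_cell[OF ab r, of H \<omega>] by metis
  show ?thesis
  proof (cases "k = 0")
    case True then show ?thesis using k C0 by (simp add: lag_avg_def)
  next
    case False
    let ?u = "grid a b m (k - 1)" and ?v = "grid a b m k"
    have d: "?v - ?u = (b - a) / real m" using grid_simps(3)[of m a b "k - 1"] ab False by simp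
    have le: "?u \<le> ?v" using grid_mono[of a b "k - 1" k m] ab by simp
    have sub: "{?u..?v} \<subseteq> {a..b}" using grid_range[of a b m "k - 1"] grid_range[of a b m k] ab k by auto
    have cg: "continuous_on {?u..?v} (\<lambda>r. H r \<omega>)" by (rule continuous_on_subset[OF c sub])
    have const: "(LINT r:{?u..?v}|lborel. y) = y * (b - a) / real m" for y :: real
      using le d by (simp add: set_lebesgue_integral_def mult.commute)
    have bnd: "- C \<le> H r \<omega> \<and> H r \<omega> \<le> C" if "r \<in> {?u..?v}" for r
    proof -
      have "r \<in> {a..b}" using sub that by blast
      from C[OF this] show ?thesis by linarith
    qed
    have "(LINT r:{?u..?v}|lborel. - C) \<le> (LINT r:{?u..?v}|lborel. H r \<omega>)"
      by (intro set_lint_mono_cont cg continuous_intros) (use bnd in auto)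
    moreover have "(LINT r:{?u..?v}|lborel. H r \<omega>) \<le> (LINT r:{?u..?v}|lborel. C)"
      by (intro set_lint_mono_cont cg continuous_intros) (use bnd in auto)
    ultimately have "\<bar>real m / (b - a) * (LINT r:{?u..?v}|lborel. H r \<omega>)\<bar> \<le> C"
      unfolding const using ab by (auto simp: field_simps abs_le_iff)
    then have "\<bar>lag_avg a b m H k \<omega>\<bar> \<le> C" using abs_clip_le[of "real m" "real m / (b - a) * (LINT r:{?u..?v}|lborel. H r \<omega>)"] False
      by (simp add: lag_avg_def)
    then show ?thesis using k by simp
  qed
qed

text \<open>Dominated convergence along a single path, the dominating constant being 4 C^2 for a
  bound C of that path on the compact interval. No bound uniform over the paths is
  available.\<close>

lemma lag_step_L2_path:
  assumes ab: "a < b" and c: "continuous_on {a..b} (\<lambda>r. H r \<omega>)"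
  shows "(\<lambda>m. \<integral>\<^sup>+r\<in>{a..b}. ennreal ((lag_step a b (Suc m) H r \<omega> - H r \<omega>)\<^sup>2) \<partial>lborel) \<longlonglongrightarrow> 0"
proof -
  have "compact ((\<lambda>r. H r \<omega>) ` {a..b})" by (rule compact_continuous_image[OF c compact_Icc])
  then have "\<exists>C. \<forall>r\<in>{a..b}. \<bar>H r \<omega>\<bar> \<le> C"
    by (auto dest!: compact_imp_bounded simp: bounded_iff)
  then obtain C where C: "\<And>r. r \<in> {a..b} \<Longrightarrow> \<bar>H r \<omega>\<bar> \<le> C" by blast
  have C0: "0 \<le> C" using C[of a] ab by auto
  have Hm[measurable]: "(\<lambda>r. indicator {a..b} r * H r \<omega>) \<in> borel_measurable borel"
    using borel_integrable_atLeastAtMost'[OF c] by (auto simp: set_integrable_def dest: borel_measurable_integrable)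
  have sm[measurable]: "(\<lambda>r. lag_step a b (Suc m) H r \<omega>) \<in> borel_measurable borel" for m
    unfolding lag_step_def by measurable
  let ?u = "\<lambda>m r. ennreal ((lag_step a b (Suc m) H r \<omega> - indicator {a..b} r * H r \<omega>)\<^sup>2) * indicator {a..b} r"
  have "(\<lambda>m. \<integral>\<^sup>+r. ?u m r \<partial>lborel) \<longlonglongrightarrow> (\<integral>\<^sup>+r. 0 \<partial>(lborel :: real measure))"
  proof (rule nn_integral_dominated_convergence[where w="\<lambda>r. ennreal (4 * C\<^sup>2) * indicator {a..b} r"])
    have ae: "AE r in (lborel :: real measure). r \<noteq> a" by (rule AE_lborel_singleton)
    show "AE r in lborel. ?u m r \<le> ennreal (4 * C\<^sup>2) * indicator {a..b} r" for m
      using ae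
    proof eventually_elim
      case (elim r)
      show ?case
      proof (cases "r \<in> {a..b}")
        case True
        with elim have "r \<in> {a<..b}" by auto
        from lag_step_bound[of a b "Suc m" H \<omega>, OF ab _ c C this] C[OF True]
        have "\<bar>lag_step a b (Suc m) H r \<omega> - H r \<omega>\<bar> \<le> 2 * C" by simp
        from power_mono[OF this, of 2] have "(lag_step a b (Suc m) H r \<omega> - H r \<omega>)\<^sup>2 \<le> 4 * C\<^sup>2" by (simp add: power_mult_distrib)
        then show ?thesis using True by (simp add: ennreal_leI)
      qed simp
    qed
    show "AE r in lborel. (\<lambda>m. ?u m r) \<longlonglongrightarrow> 0"
      using ae
    proof eventually_elim
      case (elim r)
      show ?case
      proof (cases "r \<in> {a..b}")
        case True
        with elim have r: "r \<in> {a<..b}" by auto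
        have "(\<lambda>m. ennreal ((lag_step a b (Suc m) H r \<omega> - H r \<omega>)\<^sup>2)) \<longlonglongrightarrow> ennreal ((H r \<omega> - H r \<omega>)\<^sup>2)"
          by (intro tendsto_ennrealI tendsto_intros lag_step_tendsto[where H=H and \<omega>=\<omega>, OF ab c r])
        then show ?thesis using True by simp
      qed simp
    qed
    show "(\<integral>\<^sup>+r. ennreal (4 * C\<^sup>2) * indicator {a..b} r \<partial>lborel) < \<infinity>"
      using ab by (simp add: nn_integral_cmult ennreal_mult_less_top)
  qed measurable
  moreover have "(\<integral>\<^sup>+r. ?u m r \<partial>lborel) = (\<integral>\<^sup>+r\<in>{a..b}. ennreal ((lag_step a b (Suc m) H r \<omega> - H r \<omega>)\<^sup>2) \<partial>lborel)" for m
    by (intro nn_integral_cong) (auto simp: indicator_def)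
  ultimately show ?thesis by simp
qed

section \<open>The stochastic integral of continuous adapted processes\<close>

context ito_driver
begin

definition adapted_continuous :: "real \<Rightarrow> real \<Rightarrow> (real \<Rightarrow> 'w \<Rightarrow> real) \<Rightarrow> bool" where
  "adapted_continuous a b H \<longleftrightarrow> (\<forall>r\<in>{a..b}. H r \<in> borel_measurable (F r)) \<and>
     (\<forall>\<omega>\<in>space M. continuous_on {a..b} (\<lambda>r. H r \<omega>))"

text \<open>Used with p = 2 and p = 4 for integrands, and with p = 1 for nonnegative processes,
  where the truncation performed by \<open>ennreal\<close> has no effect.\<close>

definition mean_power :: "nat \<Rightarrow> real \<Rightarrow> real \<Rightarrow> (real \<Rightarrow> 'w \<Rightarrow> real) \<Rightarrow> ennreal" where
  "mean_power p a b H = (\<integral>\<^sup>+\<omega>. (\<integral>\<^sup>+r\<in>{a..b}. ennreal (H r \<omega> ^ p) \<partial>lborel) \<partial>M)"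

lemma adapted_continuousD:
  assumes "adapted_continuous a b H"
  shows "\<And>r. r \<in> {a..b} \<Longrightarrow> H r \<in> borel_measurable (F r)" "\<And>r. r \<in> {a..b} \<Longrightarrow> H r \<in> borel_measurable M"
    "\<And>\<omega>. \<omega> \<in> space M \<Longrightarrow> continuous_on {a..b} (\<lambda>r. H r \<omega>)"
  using assms by (auto simp: adapted_continuous_def intro: measurable_F_M)

lemma adapted_continuous_subset:
  assumes H: "adapted_continuous a b H" and "a \<le> a'" "b' \<le> b"
  shows "adapted_continuous a' b' H"
proof -
  have "{a'..b'} \<subseteq> {a..b}" using assms by auto
  then show ?thesis using H unfolding adapted_continuous_def by (blast intro: continuous_on_subset)
qed

lemma adapted_continuous_pair_measurable:
  assumes "adapted_continuous a b H"
  shows "on_interval a b H \<in> borel_measurable (M \<Otimes>\<^sub>M lborel)"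
  unfolding on_interval_def[abs_def]
  by (rule borel_measurable_pair_on[where u=a and v=b]) (use adapted_continuousD[OF assms] in auto)

lemma adapted_continuous_path_power_measurable:
  assumes H: "adapted_continuous a b H"
  shows "(\<lambda>\<omega>. \<integral>\<^sup>+r\<in>{a..b}. ennreal (H r \<omega> ^ p) \<partial>lborel) \<in> borel_measurable M"
proof -
  have [measurable]: "(\<lambda>x. H (snd x) (fst x) * indicator {a..b} (snd x)) \<in> borel_measurable (M \<Otimes>\<^sub>M lborel)"
    by (rule borel_measurable_pair_on[where u=a and v=b]) (use adapted_continuousD[OF H] in auto)
  have "(\<lambda>x. ennreal ((H (snd x) (fst x) * indicator {a..b} (snd x)) ^ p) * indicator {a..b} (snd x)) \<in> borel_measurable (M \<Otimes>\<^sub>M lborel)"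
    by measurable
  then have "case_prod (\<lambda>\<omega> r. ennreal ((H r \<omega> * indicator {a..b} r) ^ p) * indicator {a..b} r) \<in> borel_measurable (M \<Otimes>\<^sub>M lborel)"
    by (simp add: case_prod_beta')
  from lborel.borel_measurable_nn_integral[OF this]
  have "(\<lambda>\<omega>. \<integral>\<^sup>+r. ennreal ((H r \<omega> * indicator {a..b} r) ^ p) * indicator {a..b} r \<partial>lborel) \<in> borel_measurable M" .
  also have "(\<lambda>\<omega>. \<integral>\<^sup>+r. ennreal ((H r \<omega> * indicator {a..b} r) ^ p) * indicator {a..b} r \<partial>lborel) = (\<lambda>\<omega>. \<integral>\<^sup>+r\<in>{a..b}. ennreal (H r \<omega> ^ p) \<partial>lborel)"
    by (intro ext nn_integral_cong) (auto simp: indicator_def)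
  finally show ?thesis .
qed

lemma lag_avg_measurable:
  assumes H: "adapted_continuous a b H" and ab: "a < b" "m > 0" and k: "k \<le> m"
  shows "lag_avg a b m H k \<in> borel_measurable (F (grid a b m k))"
proof (cases "k = 0")
  case True then show ?thesis by (simp add: lag_avg_def[abs_def])
next
  case False
  have rng: "a \<le> grid a b m (k - 1)" "grid a b m k \<le> b" using grid_range[of a b m "k - 1"] grid_range[of a b m k] ab k by auto
  have "(\<lambda>\<omega>. LINT r:{grid a b m (k - 1)..grid a b m k}|lborel. H r \<omega>) \<in> borel_measurable (F (grid a b m k))"
  proof (rule borel_measurable_path_integral)
    fix r assume "r \<in> {grid a b m (k - 1)..grid a b m k}"
    then show "H r \<in> borel_measurable (F (grid a b m k))"
      using rng by (intro measurable_F_mono[OF adapted_continuousD(1)[OF H]]) auto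
  next
    fix \<omega> assume "\<omega> \<in> space (F (grid a b m k))"
    then show "continuous_on {grid a b m (k - 1)..grid a b m k} (\<lambda>r. H r \<omega>)"
      using rng by (intro continuous_on_subset[OF adapted_continuousD(3)[OF H]]) (auto simp: space_F)
  qed
  then show ?thesis using False by (simp add: lag_avg_def[abs_def])
qed

lemma lag_avg_bounded: "\<bar>lag_avg a b m H k \<omega>\<bar> \<le> real m"
  by (auto simp: lag_avg_def)

lemma lag_simple_ito:
  assumes H: "adapted_continuous a b H" and ab: "a < b" "m > 0"
  shows "simple_ito M F B a b (lag_step a b m H) (lag_int B a b m H)"
  unfolding simple_ito_def
  by (intro exI[of _ m] exI[of _ "grid a b m"] exI[of _ "lag_avg a b m H"])
     (use ab grid_strict[OF ab] lag_avg_measurable[OF H ab] lag_avg_bounded in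
       \<open>auto simp: grid_simps lag_step_def lag_int_def intro!: exI[of _ "real m"]\<close>)

text \<open>A second dominated convergence, now over the sample space. The squared distance along a
  path is at most four times the square integral of that path, because the lagged averages do not
  increase square integrals, and by hypothesis this majorant has a finite mean.\<close>

lemma lag_step_L2:
  assumes H: "adapted_continuous a b H" and ab: "0 \<le> a" "a < b" "b \<le> T" and fin: "mean_power 2 a b H < \<infinity>"
  shows "(\<lambda>m. sqdist (M \<Otimes>\<^sub>M lborel) (on_interval a b (lag_step a b (Suc m) H)) (on_interval a b H)) \<longlonglongrightarrow> 0"
proof -
  note Hm[measurable] = adapted_continuous_pair_measurable[OF H]
  have s: "simple_ito M F B a b (lag_step a b (Suc m) H) (lag_int B a b (Suc m) H)" for m
    by (rule lag_simple_ito[OF H ab(2)]) simp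
  note sm[measurable] = simple_ito_measurable(2)[OF s ab(1,3)]
  let ?h = "\<lambda>\<omega>. \<integral>\<^sup>+r\<in>{a..b}. ennreal (H r \<omega> ^ 2) \<partial>lborel"
  let ?G = "\<lambda>m \<omega>. \<integral>\<^sup>+r. ennreal ((on_interval a b (lag_step a b (Suc m) H) (\<omega>, r) - on_interval a b H (\<omega>, r))\<^sup>2) \<partial>lborel"
  have G: "?G m \<omega> = (\<integral>\<^sup>+r\<in>{a..b}. ennreal ((lag_step a b (Suc m) H r \<omega> - H r \<omega>)\<^sup>2) \<partial>lborel)" for m \<omega>
  proof (rule nn_integral_cong_AE)
    have "AE r in lborel. r \<noteq> a" by (rule AE_lborel_singleton)
    then show "AE r in lborel. ennreal ((on_interval a b (lag_step a b (Suc m) H) (\<omega>, r) - on_interval a b H (\<omega>, r))\<^sup>2)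
       = ennreal ((lag_step a b (Suc m) H r \<omega> - H r \<omega>)\<^sup>2) * indicator {a..b} r"
      by eventually_elim (auto simp: on_interval_def indicator_def)
  qed
  have hm[measurable]: "?h \<in> borel_measurable M" by (rule adapted_continuous_path_power_measurable[OF H])
  have "(\<lambda>m. \<integral>\<^sup>+\<omega>. ?G m \<omega> \<partial>M) \<longlonglongrightarrow> (\<integral>\<^sup>+\<omega>. 0 \<partial>M)"
  proof (rule nn_integral_dominated_convergence[where w="\<lambda>\<omega>. 4 * ?h \<omega>"])
    show "?G m \<in> borel_measurable M" for m
      by (rule lborel.borel_measurable_nn_integral) measurable
    show "AE \<omega> in M. ?G m \<omega> \<le> 4 * ?h \<omega>" for m
    proof (rule AE_I2)
      fix \<omega> assume \<omega>: "\<omega> \<in> space M"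
      note c = adapted_continuousD(3)[OF H \<omega>]
      have mm[measurable]: "(\<lambda>r. on_interval a b (lag_step a b (Suc m) H) (\<omega>, r)) \<in> borel_measurable lborel"
        "(\<lambda>r. on_interval a b H (\<omega>, r)) \<in> borel_measurable lborel"
        using measurable_compose[OF measurable_Pair1'[OF \<omega>] sm[of m]] measurable_compose[OF measurable_Pair1'[OF \<omega>] Hm] by auto
      have 1: "(\<integral>\<^sup>+r. ennreal (on_interval a b K (\<omega>, r) ^ 2) \<partial>lborel) \<le> (\<integral>\<^sup>+r\<in>{a..b}. ennreal (K r \<omega> ^ 2) \<partial>lborel)" for K
        by (rule nn_integral_mono) (auto simp: on_interval_def indicator_def)
      have "?G m \<omega> \<le> (\<integral>\<^sup>+r. 2 * ennreal (on_interval a b (lag_step a b (Suc m) H) (\<omega>, r) ^ 2) + 2 * ennreal (on_interval a b H (\<omega>, r) ^ 2) \<partial>lborel)"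
      proof (rule nn_integral_mono)
        fix r
        have "ennreal ((on_interval a b (lag_step a b (Suc m) H) (\<omega>, r) - on_interval a b H (\<omega>, r))\<^sup>2) \<le>
          ennreal (2 * (on_interval a b (lag_step a b (Suc m) H) (\<omega>, r) - 0) ^ 2 + 2 * (0 - on_interval a b H (\<omega>, r)) ^ 2)"
          by (rule ennreal_leI[OF power2_diff_triangle])
        then show "ennreal ((on_interval a b (lag_step a b (Suc m) H) (\<omega>, r) - on_interval a b H (\<omega>, r))\<^sup>2) \<le>
          2 * ennreal (on_interval a b (lag_step a b (Suc m) H) (\<omega>, r) ^ 2) + 2 * ennreal (on_interval a b H (\<omega>, r) ^ 2)"
          by (simp add: ennreal_mult)
      qed
      also have "\<dots> = 2 * (\<integral>\<^sup>+r. ennreal (on_interval a b (lag_step a b (Suc m) H) (\<omega>, r) ^ 2) \<partial>lborel) + 2 * (\<integral>\<^sup>+r. ennreal (on_interval a b H (\<omega>, r) ^ 2) \<partial>lborel)"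
        by (subst nn_integral_add) (auto simp: nn_integral_cmult)
      also have "\<dots> \<le> 2 * ?h \<omega> + 2 * ?h \<omega>"
        using lag_step_power_le[where H=H and \<omega>=\<omega> and m="Suc m" and p=2, OF ab(2) _ c]
        by (intro add_mono mult_left_mono order.trans[OF 1]) auto
      also have "\<dots> = 4 * ?h \<omega>" by (simp flip: distrib_right)
      finally show "?G m \<omega> \<le> 4 * ?h \<omega>" .
    qed
    show "(\<integral>\<^sup>+\<omega>. 4 * ?h \<omega> \<partial>M) < \<infinity>"
      using fin by (simp add: nn_integral_cmult mean_power_def ennreal_mult_less_top)
    show "AE \<omega> in M. (\<lambda>m. ?G m \<omega>) \<longlonglongrightarrow> 0"
      unfolding G by (intro AE_I2 lag_step_L2_path ab adapted_continuousD(3)[OF H])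
  qed measurable
  moreover have "(\<integral>\<^sup>+\<omega>. ?G m \<omega> \<partial>M) = sqdist (M \<Otimes>\<^sub>M lborel) (on_interval a b (lag_step a b (Suc m) H)) (on_interval a b H)" for m
    unfolding sqdist_def by (rule lborel.nn_integral_fst) measurable
  ultimately show ?thesis by simp
qed

text \<open>The isometry carries the L2 convergence of the step processes over to their integrals,
  which are therefore Cauchy. The convergence of the explicit sums is kept in the conclusion, since
  moment bounds and locality are proved on exactly this sequence.\<close>

lemma lag_ito_exists:
  assumes H: "adapted_continuous a b H" and ab: "0 \<le> a" "a < b" "b \<le> T" and fin: "mean_power 2 a b H < \<infinity>"
  obtains Y where "is_ito_integral M F B a b H Y" "(\<lambda>m. sqdist M (lag_int B a b (Suc m) H) Y) \<longlonglongrightarrow> 0"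
proof -
  note Hm[measurable] = adapted_continuous_pair_measurable[OF H]
  have s: "simple_ito M F B a b (lag_step a b (Suc m) H) (lag_int B a b (Suc m) H)" for m
    by (rule lag_simple_ito[OF H ab(2)]) simp
  note sm[measurable] = simple_ito_measurable[OF s ab(1,3)]
  note lim = lag_step_L2[OF H ab fin]
  obtain Y where Y: "Y \<in> borel_measurable M" "(\<lambda>m. sqdist M (lag_int B a b (Suc m) H) Y) \<longlonglongrightarrow> 0"
  proof (rule sqdist_complete[of "\<lambda>m. lag_int B a b (Suc m) H" M])
    fix e :: real assume e: "e > 0"
    have "eventually (\<lambda>m. sqdist (M \<Otimes>\<^sub>M lborel) (on_interval a b (lag_step a b (Suc m) H)) (on_interval a b H) < ennreal (e / 4)) sequentially"
      using lim by (rule order_tendstoD) (use e in simp)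
    then obtain n0 where n0: "\<And>m. m \<ge> n0 \<Longrightarrow> sqdist (M \<Otimes>\<^sub>M lborel) (on_interval a b (lag_step a b (Suc m) H)) (on_interval a b H) \<le> ennreal (e / 4)"
      unfolding eventually_sequentially by (meson less_imp_le)
    show "\<exists>n0. \<forall>m\<ge>n0. \<forall>n\<ge>n0. sqdist M (lag_int B a b (Suc m) H) (lag_int B a b (Suc n) H) \<le> ennreal e"
    proof (intro exI allI impI)
      fix m n assume mn: "m \<ge> n0" "n \<ge> n0"
      have "sqdist M (lag_int B a b (Suc m) H) (lag_int B a b (Suc n) H) =
        sqdist (M \<Otimes>\<^sub>M lborel) (on_interval a b (lag_step a b (Suc m) H)) (on_interval a b (lag_step a b (Suc n) H))"
        by (rule simple_ito_isometry[OF s s ab(1,3)])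
      also have "\<dots> \<le> 2 * sqdist (M \<Otimes>\<^sub>M lborel) (on_interval a b (lag_step a b (Suc m) H)) (on_interval a b H) + 2 * sqdist (M \<Otimes>\<^sub>M lborel) (on_interval a b H) (on_interval a b (lag_step a b (Suc n) H))"
        by (rule sqdist_triangle) measurable
      also have "\<dots> \<le> 2 * ennreal (e / 4) + 2 * ennreal (e / 4)"
        by (intro add_mono mult_left_mono n0[OF mn(1)] n0[OF mn(2), unfolded sqdist_commute[of _ _ "on_interval a b H"]]) auto
      also have "\<dots> = ennreal e" using e by (simp flip: ennreal_plus ennreal_mult' ennreal_numeral)
      finally show "sqdist M (lag_int B a b (Suc m) H) (lag_int B a b (Suc n) H) \<le> ennreal e" .
    qed
  qed measurable
  have "is_ito_integral M F B a b H Y"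
    unfolding is_ito_integral_iff[OF Hm ab(1,3)] using Y lim s
    by (intro conjI exI[of _ "\<lambda>m. lag_step a b (Suc m) H"] exI[of _ "\<lambda>m. lag_int B a b (Suc m) H"]) auto
  with Y that show ?thesis by blast
qed

lemma simple_ito_zero:
  assumes "a < b"
  shows "simple_ito M F B a b (\<lambda>_ _. 0) (\<lambda>_. 0)"
  unfolding simple_ito_def
  by (intro exI[of _ 1] exI[of _ "\<lambda>k. if k = 0 then a else b"] exI[of _ "\<lambda>_ _. 0"]) (use assms in auto)

text \<open>The converse of existence: a simple process is bounded, hence square integrable over the
  bounded interval, and some simple process lies at finite distance from \<open>H\<close>. For
  continuous adapted integrands, having an integral thus amounts to \<open>mean_power 2\<close>
  being finite.\<close>

lemma is_ito_integral_finite: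
  assumes H: "adapted_continuous a b H" and ab: "0 \<le> a" "b \<le> T" and Y: "is_ito_integral M F B a b H Y"
  shows "mean_power 2 a b H < \<infinity>"
proof -
  note Hm[measurable] = adapted_continuous_pair_measurable[OF H]
  let ?N = "M \<Otimes>\<^sub>M (lborel :: real measure)"
  from Y obtain Hs Is where s: "\<And>n. simple_ito M F B a b (Hs n) (Is n)"
    and l: "(\<lambda>n. sqdist ?N (on_interval a b (Hs n)) (on_interval a b H)) \<longlonglongrightarrow> 0"
    unfolding is_ito_integral_iff[OF Hm ab] by blast
  have "eventually (\<lambda>n. sqdist ?N (on_interval a b (Hs n)) (on_interval a b H) < \<top>) sequentially"
    using l by (rule order_tendstoD) simp
  then obtain n where n: "sqdist ?N (on_interval a b (Hs n)) (on_interval a b H) < \<top>" by (auto simp: eventually_sequentially)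
  note sm[measurable] = simple_ito_measurable(2)[OF s ab]
  obtain K \<tau> \<xi> where \<xi>: "\<And>k. k < K \<Longrightarrow> \<exists>C. \<forall>\<omega>\<in>space M. \<bar>\<xi> k \<omega>\<bar> \<le> C"
    and r: "\<And>\<omega> r. \<omega> \<in> space M \<Longrightarrow> on_interval a b (Hs n) (\<omega>, r) = (\<Sum>k<K. \<xi> k \<omega> * indicator {\<tau> k<..\<tau> (Suc k)} r)"
    by (rule simple_itoE[OF s[of n] ab]) (rule that)
  from \<xi> obtain C where C: "\<And>k \<omega>. k < K \<Longrightarrow> \<omega> \<in> space M \<Longrightarrow> \<bar>\<xi> k \<omega>\<bar> \<le> C k" by metis
  have bnd: "\<bar>on_interval a b (Hs n) (\<omega>, r)\<bar> \<le> (\<Sum>k<K. \<bar>C k\<bar>)" if "\<omega> \<in> space M" for \<omega> r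
    unfolding r[OF that]
  proof (rule order.trans[OF sum_abs], rule sum_mono)
    fix k assume "k \<in> {..<K}"
    then have "\<bar>\<xi> k \<omega>\<bar> \<le> C k" using C that by auto
    then show "\<bar>\<xi> k \<omega> * indicator {\<tau> k<..\<tau> (Suc k)} r\<bar> \<le> \<bar>C k\<bar>" by (auto simp: indicator_def)
  qed
  let ?C = "\<Sum>k<K. \<bar>C k\<bar>"
  have "sqdist ?N (on_interval a b (Hs n)) (\<lambda>_. 0) = (\<integral>\<^sup>+\<omega>. (\<integral>\<^sup>+r. ennreal ((on_interval a b (Hs n) (\<omega>, r) - 0)\<^sup>2) \<partial>lborel) \<partial>M)"
    unfolding sqdist_def by (rule lborel.nn_integral_fst[symmetric]) measurable
  also have "\<dots> \<le> (\<integral>\<^sup>+\<omega>. (\<integral>\<^sup>+r. ennreal (?C\<^sup>2) * indicator {a..b} r \<partial>lborel) \<partial>M)"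
  proof (rule nn_integral_mono, rule nn_integral_mono)
    fix \<omega> r assume "\<omega> \<in> space M"
    from bnd[OF this, of r] have "(on_interval a b (Hs n) (\<omega>, r))\<^sup>2 \<le> ?C\<^sup>2" by (simp add: abs_le_square_iff[symmetric] sum_nonneg)
    then show "ennreal ((on_interval a b (Hs n) (\<omega>, r) - 0)\<^sup>2) \<le> ennreal (?C\<^sup>2) * indicator {a..b} r"
      by (auto simp: on_interval_def indicator_def ennreal_leI)
  qed
  also have "\<dots> < \<infinity>" by (simp add: nn_integral_cmult emeasure_space_1 ennreal_mult_less_top emeasure_lborel_Icc_eq)
  finally have f: "sqdist ?N (on_interval a b (Hs n)) (\<lambda>_. 0) < \<infinity>" .
  have "sqdist ?N (on_interval a b H) (\<lambda>_. 0) \<le> 2 * sqdist ?N (on_interval a b H) (on_interval a b (Hs n)) + 2 * sqdist ?N (on_interval a b (Hs n)) (\<lambda>_. 0)"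
    by (rule sqdist_triangle) measurable
  also have "\<dots> < \<infinity>" using n f by (simp add: sqdist_commute[of _ "on_interval a b H"] ennreal_mult_less_top)
  also have "sqdist ?N (on_interval a b H) (\<lambda>_. 0) = sqdist ?N (on_interval a b H) (on_interval a b (\<lambda>_ _. 0))" by (simp add: on_interval_def[abs_def])
  also have "\<dots> = mean_power 2 a b H"
    by (subst on_interval_dist[symmetric]) (auto simp: mean_power_def on_interval_def[of _ _ "\<lambda>_ _. 0", abs_def])
  finally show ?thesis .
qed

text \<open>By uniqueness, every integral is the limit of the one canonical sequence, whichever
  approximation its existence came from.\<close>

lemma is_ito_integral_lag_limit:
  assumes H: "adapted_continuous a b H" and ab: "0 \<le> a" "a < b" "b \<le> T" and Y: "is_ito_integral M F B a b H Y"
  shows "(\<lambda>m. sqdist M (lag_int B a b (Suc m) H) Y) \<longlonglongrightarrow> 0"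
proof -
  obtain Y' where Y': "is_ito_integral M F B a b H Y'" "(\<lambda>m. sqdist M (lag_int B a b (Suc m) H) Y') \<longlonglongrightarrow> 0"
    using lag_ito_exists[OF H ab is_ito_integral_finite[OF H ab(1,3) Y]] .
  have "AE \<omega> in M. Y \<omega> = Y' \<omega>"
    by (rule is_ito_integral_unique[OF adapted_continuous_pair_measurable[OF H] ab(1,3) Y Y'(1)])
  then have "sqdist M f Y' = sqdist M f Y" for f unfolding sqdist_def by (intro nn_integral_cong_AE) auto
  with Y' show ?thesis by simp
qed

lemma lag_int_measurable:
  assumes H: "adapted_continuous a b H" and ab: "0 \<le> a" "a < b" "b \<le> T"
  shows "lag_int B a b (Suc m) H \<in> borel_measurable M"
  by (rule simple_ito_measurable(1)[OF lag_simple_ito[OF H ab(2)] ab(1,3)]) simp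

lemma is_ito_integral_measurable: "is_ito_integral M F B a b H Y \<Longrightarrow> Y \<in> borel_measurable M"
  by (simp add: is_ito_integral_def)

section \<open>Moments and locality of the stochastic integral\<close>

lemma ito_second_moment:
  assumes H: "adapted_continuous a b H" and ab: "0 \<le> a" "a < b" "b \<le> T" and Y: "is_ito_integral M F B a b H Y"
  shows "(\<integral>\<^sup>+\<omega>. ennreal (Y \<omega> ^ 2) \<partial>M) \<le> mean_power 2 a b H"
proof (rule nn_integral_Fatou_sqdist[OF lag_int_measurable[OF H ab] is_ito_integral_measurable[OF Y] is_ito_integral_lag_limit[OF H ab Y]])
  fix m
  have s: "simple_ito M F B a b (lag_step a b (Suc m) H) (lag_int B a b (Suc m) H)"
    by (rule lag_simple_ito[OF H ab(2)]) simp
  have "(\<integral>\<^sup>+\<omega>. ennreal (lag_int B a b (Suc m) H \<omega> ^ 2) \<partial>M) = sqdist M (lag_int B a b (Suc m) H) (\<lambda>_. 0)"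
    by (simp add: sqdist_def)
  also have "\<dots> = sqdist (M \<Otimes>\<^sub>M lborel) (on_interval a b (lag_step a b (Suc m) H)) (on_interval a b (\<lambda>_ _. 0))"
    by (rule simple_ito_isometry[OF s simple_ito_zero[OF ab(2)] ab(1,3)])
  also have "\<dots> = (\<integral>\<^sup>+\<omega>. (\<integral>\<^sup>+r\<in>{a..b}. ennreal ((lag_step a b (Suc m) H r \<omega> - 0)\<^sup>2) \<partial>lborel) \<partial>M)"
    by (rule on_interval_dist[symmetric]) (use simple_ito_measurable(2)[OF s ab(1,3)] in \<open>auto simp: on_interval_def[of _ _ "\<lambda>_ _. 0", abs_def]\<close>)
  also have "\<dots> \<le> mean_power 2 a b H"
    unfolding mean_power_def
  proof (rule nn_integral_mono)
    fix \<omega> assume "\<omega> \<in> space M"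
    then show "(\<integral>\<^sup>+r\<in>{a..b}. ennreal ((lag_step a b (Suc m) H r \<omega> - 0)\<^sup>2) \<partial>lborel) \<le> (\<integral>\<^sup>+r\<in>{a..b}. ennreal (H r \<omega> ^ 2) \<partial>lborel)"
      using lag_step_power_le[where H=H and \<omega>=\<omega> and m="Suc m" and p=2, OF ab(2) _ adapted_continuousD(3)[OF H]] by simp
  qed
  finally show "(\<integral>\<^sup>+\<omega>. ennreal (lag_int B a b (Suc m) H \<omega> ^ 2) \<partial>M) \<le> mean_power 2 a b H" .
qed (intro continuous_intros)

text \<open>The equidistant partition estimate applies to the lagged sums, and averaging does not
  increase the fourth power integral. The right-hand side may be infinite, so no fourth moment has
  to be known beforehand.\<close>

lemma ito_fourth_moment:
  assumes H: "adapted_continuous a b H" and ab: "0 \<le> a" "a < b" "b \<le> T" and Y: "is_ito_integral M F B a b H Y"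
  shows "(\<integral>\<^sup>+\<omega>. ennreal (Y \<omega> ^ 4) \<partial>M) \<le> ennreal (36 * (b - a)) * mean_power 4 a b H"
proof (rule nn_integral_Fatou_sqdist[OF lag_int_measurable[OF H ab] is_ito_integral_measurable[OF Y] is_ito_integral_lag_limit[OF H ab Y]])
  fix m0
  define m where "m = Suc m0"
  have m: "m > 0" by (simp add: m_def)
  have lm: "lag_avg a b m H k \<in> borel_measurable (F (grid a b m k))" if "k < m" for k
    by (rule lag_avg_measurable[OF H ab(2) m]) (use that in simp)
  have li: "integrable M (\<lambda>\<omega>. lag_avg a b m H k \<omega> ^ 4)" if "k < m" for k
  proof (rule integrable_bounded)
    show "(\<lambda>\<omega>. lag_avg a b m H k \<omega> ^ 4) \<in> borel_measurable M"
      by (intro borel_measurable_power measurable_F_M[OF lm[OF that]])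
    show "\<bar>lag_avg a b m H k \<omega> ^ 4\<bar> \<le> real m ^ 4" for \<omega>
      unfolding power_abs by (rule power_mono[OF lag_avg_bounded]) simp
  qed
  let ?S = "\<lambda>\<omega>. \<Sum>k<m. (b - a) / real m * lag_avg a b m H k \<omega> ^ 4"
  have pf: "integrable M (\<lambda>\<omega>. lag_int B a b m H \<omega> ^ 4)"
    "expectation (\<lambda>\<omega>. lag_int B a b m H \<omega> ^ 4) \<le> 36 * (b - a) * (\<Sum>k<m. ((b - a) / real m) * expectation (\<lambda>\<omega>. lag_avg a b m H k \<omega> ^ 4))"
  proof -
    have ex: "\<exists>C. \<forall>\<omega>\<in>space M. \<bar>lag_avg a b m H k \<omega>\<bar> \<le> C" for k by (rule exI[of _ "real m"]) (simp add: lag_avg_bounded)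
    have g: "0 < b - a" "\<And>k. grid a b m (Suc k) - grid a b m k = (b - a) / real m" "0 \<le> grid a b m 0" "grid a b m m \<le> T"
      using ab grid_simps[OF m, of a b] by auto
    note pf = partition_fourth_moment[of m "b - a" "grid a b m" "lag_avg a b m H", OF m g lm ex]
    show "integrable M (\<lambda>\<omega>. lag_int B a b m H \<omega> ^ 4)" unfolding lag_int_def by (rule pf(1))
    show "expectation (\<lambda>\<omega>. lag_int B a b m H \<omega> ^ 4) \<le> 36 * (b - a) * (\<Sum>k<m. ((b - a) / real m) * expectation (\<lambda>\<omega>. lag_avg a b m H k \<omega> ^ 4))"
      unfolding lag_int_def by (rule pf(2))
  qed
  have "(\<integral>\<^sup>+\<omega>. ennreal (lag_int B a b m H \<omega> ^ 4) \<partial>M) = ennreal (expectation (\<lambda>\<omega>. lag_int B a b m H \<omega> ^ 4))"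
    using pf(1) by (intro nn_integral_eq_integral) auto
  also have "\<dots> \<le> ennreal (36 * (b - a) * expectation ?S)"
    using pf(2) li by (intro ennreal_leI) (simp add: Bochner_Integration.integral_sum)
  also have "\<dots> = ennreal (36 * (b - a)) * ennreal (expectation ?S)"
    using ab by (intro ennreal_mult') simp
  also have "ennreal (expectation ?S) = (\<integral>\<^sup>+\<omega>. ennreal (?S \<omega>) \<partial>M)"
    using li ab by (intro nn_integral_eq_integral[symmetric] Bochner_Integration.integrable_sum integrable_mult_right AE_I2 sum_nonneg) auto
  also have "\<dots> \<le> mean_power 4 a b H"
    unfolding mean_power_def
  proof (rule nn_integral_mono)
    fix \<omega> assume \<omega>: "\<omega> \<in> space M"
    show "ennreal (?S \<omega>) \<le> (\<integral>\<^sup>+r\<in>{a..b}. ennreal (H r \<omega> ^ 4) \<partial>lborel)"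
      using lag_step_power_le[where H=H and \<omega>=\<omega> and m=m and p=4, OF ab(2) m adapted_continuousD(3)[OF H \<omega>]]
        lag_step_power_integral[of a b m 4 H \<omega>] ab m by simp
  qed
  finally show "(\<integral>\<^sup>+\<omega>. ennreal (lag_int B a b (Suc m0) H \<omega> ^ 4) \<partial>M) \<le> ennreal (36 * (b - a)) * mean_power 4 a b H"
    by (simp add: mult_left_mono m_def)
qed (intro continuous_intros)

lemma lag_int_local:
  assumes ab: "a < b" and eq: "\<And>r. r \<in> {a..b} \<Longrightarrow> H r \<omega> = H' r \<omega>"
  shows "lag_int B a b (Suc m) H \<omega> = lag_int B a b (Suc m) H' \<omega>"
proof -
  have "lag_avg a b (Suc m) H k \<omega> = lag_avg a b (Suc m) H' k \<omega>" if "k < Suc m" for k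
  proof (cases "k = 0")
    case False
    have "(LINT r:{grid a b (Suc m) (k - 1)..grid a b (Suc m) k}|lborel. H r \<omega>) = (LINT r:{grid a b (Suc m) (k - 1)..grid a b (Suc m) k}|lborel. H' r \<omega>)"
    proof (intro set_lebesgue_integral_cong allI impI eq)
      fix r assume r: "r \<in> {grid a b (Suc m) (k - 1)..grid a b (Suc m) k}"
      have "k - 1 \<le> Suc m" "k \<le> Suc m" using that by auto
      then show "r \<in> {a..b}" using grid_range[OF ab, of "Suc m" "k - 1"] grid_range[OF ab, of "Suc m" k] r by simp
    qed simp
    then show ?thesis by (simp add: lag_avg_def)
  qed (simp add: lag_avg_def)
  then show ?thesis by (simp add: lag_int_def del: sum.lessThan_Suc)
qed

text \<open>The lagged sum at \<omega> depends on the integrand only through its path at \<omega>,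
  so the sums coincide exactly where the paths do; an almost surely convergent subsequence of the
  differences transfers this to the limits. An equality that holds only on an event can thus be used
  although the integral is defined globally.\<close>

lemma ito_integral_local:
  assumes H: "adapted_continuous a b H" and H': "adapted_continuous a b H'" and ab: "0 \<le> a" "a < b" "b \<le> T"
    and Y: "is_ito_integral M F B a b H Y" and Y': "is_ito_integral M F B a b H' Y'"
  shows "AE \<omega> in M. (\<forall>r\<in>{a..b}. H r \<omega> = H' r \<omega>) \<longrightarrow> Y \<omega> = Y' \<omega>"
proof -
  note [measurable] = lag_int_measurable[OF H ab] lag_int_measurable[OF H' ab] is_ito_integral_measurable[OF Y] is_ito_integral_measurable[OF Y']
  let ?d = "\<lambda>m \<omega>. lag_int B a b (Suc m) H \<omega> - lag_int B a b (Suc m) H' \<omega>"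
  have "(\<lambda>m. sqdist M (?d m) (\<lambda>\<omega>. Y \<omega> - Y' \<omega>)) \<longlonglongrightarrow> 0"
  proof (rule tendsto_sandwich[OF _ _ tendsto_const])
    have "sqdist M (?d m) (\<lambda>\<omega>. Y \<omega> - Y' \<omega>) \<le> 2 * sqdist M (lag_int B a b (Suc m) H) Y + 2 * sqdist M (lag_int B a b (Suc m) H') Y'" for m
    proof -
      have "sqdist M (?d m) (\<lambda>\<omega>. Y \<omega> - Y' \<omega>) \<le> 2 * sqdist M (?d m) (\<lambda>\<omega>. Y \<omega> - lag_int B a b (Suc m) H' \<omega>)
        + 2 * sqdist M (\<lambda>\<omega>. Y \<omega> - lag_int B a b (Suc m) H' \<omega>) (\<lambda>\<omega>. Y \<omega> - Y' \<omega>)"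
        by (rule sqdist_triangle) measurable
      also have "\<dots> = 2 * sqdist M (lag_int B a b (Suc m) H) Y + 2 * sqdist M Y' (lag_int B a b (Suc m) H')"
        by (simp add: sqdist_def algebra_simps)
      finally show ?thesis by (simp add: sqdist_commute)
    qed
    then show "\<forall>\<^sub>F m in sequentially. sqdist M (?d m) (\<lambda>\<omega>. Y \<omega> - Y' \<omega>) \<le> 2 * sqdist M (lag_int B a b (Suc m) H) Y + 2 * sqdist M (lag_int B a b (Suc m) H') Y'"
      by simp
    have "(\<lambda>m. 2 * sqdist M (lag_int B a b (Suc m) H) Y + 2 * sqdist M (lag_int B a b (Suc m) H') Y') \<longlonglongrightarrow> 2 * 0 + 2 * 0"
      by (intro tendsto_add ennreal_tendsto_cmult is_ito_integral_lag_limit H H' ab Y Y') auto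
    then show "(\<lambda>m. 2 * sqdist M (lag_int B a b (Suc m) H) Y + 2 * sqdist M (lag_int B a b (Suc m) H') Y') \<longlonglongrightarrow> 0" by simp
  qed simp
  then obtain r :: "nat \<Rightarrow> nat" where r: "AE \<omega> in M. (\<lambda>n. ?d (r n) \<omega>) \<longlonglongrightarrow> Y \<omega> - Y' \<omega>"
    by (rule sqdist_AE_subseq[rotated 2]) measurable
  then show ?thesis
  proof eventually_elim
    case (elim \<omega>)
    show ?case
    proof
      assume eq: "\<forall>r\<in>{a..b}. H r \<omega> = H' r \<omega>"
      have "?d (r n) \<omega> = 0" for n using lag_int_local[OF ab(2), where H=H and H'=H' and \<omega>=\<omega> and m="r n"] eq by simp
      then have "(\<lambda>_. 0) \<longlonglongrightarrow> Y \<omega> - Y' \<omega>" using elim by simp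
      then show "Y \<omega> = Y' \<omega>" using LIMSEQ_unique tendsto_const by fastforce
    qed
  qed
qed

text \<open>A strictly increasing partition that begins and ends at \<open>a\<close> has no steps,
  so n = 0 is forced and the integrand is arbitrary.\<close>

lemma simple_ito_degenerate:
  "simple_ito M F B a a H I \<longleftrightarrow> (\<forall>\<omega>\<in>space M. I \<omega> = 0)"
proof
  assume "simple_ito M F B a a H I"
  then obtain n \<tau> \<xi> where s: "\<tau> 0 = a" "\<tau> n = a" "\<And>k. k<n \<Longrightarrow> \<tau> k < (\<tau> (Suc k) :: real)"
       "\<And>\<omega>. \<omega>\<in>space M \<Longrightarrow> I \<omega> = (\<Sum>k<n. \<xi> k \<omega> * (B (\<tau> (Suc k)) \<omega> - B (\<tau> k) \<omega>))"
    unfolding simple_ito_def by blast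
  have "k \<le> n \<Longrightarrow> k > 0 \<Longrightarrow> a < \<tau> k" for k
  proof (induction k)
    case (Suc k) then show ?case using s(1) s(3)[of k] by (cases "k = 0") auto
  qed simp
  from this[of n] have "n = 0" using s by auto
  then show "\<forall>\<omega>\<in>space M. I \<omega> = 0" using s by simp
next
  assume "\<forall>\<omega>\<in>space M. I \<omega> = 0"
  then show "simple_ito M F B a a H I"
    unfolding simple_ito_def by (intro exI[of _ 0] exI[of _ "\<lambda>_. a"]) auto
qed

text \<open>The equations are also posed at the starting time, where the interval is a point. There
  the integral exists for every integrand, since the distance condition concerns a null set of
  times.\<close>

lemma ito_integral_degenerate: "AE \<omega> in M. ito_integral M F B a a H \<omega> = 0"
proof -
  have z: "(\<integral>\<^sup>+r\<in>{a..a}. f r \<partial>lborel) = 0" for f :: "real \<Rightarrow> ennreal"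
  proof -
    have "AE r in (lborel :: real measure). r \<noteq> a" by (rule AE_lborel_singleton)
    then have "AE r in lborel. f r * indicator {a..a} r = 0" by eventually_elim auto
    then have "(\<integral>\<^sup>+r\<in>{a..a}. f r \<partial>lborel) = (\<integral>\<^sup>+r. 0 \<partial>(lborel :: real measure))" by (rule nn_integral_cong_AE)
    then show ?thesis by simp
  qed
  have "is_ito_integral M F B a a H (\<lambda>_. 0)"
    unfolding is_ito_integral_def z by (intro conjI exI[of _ "\<lambda>_. H"] exI[of _ "\<lambda>_ _. 0"]) (auto simp: simple_ito_degenerate)
  then have "is_ito_integral M F B a a H (ito_integral M F B a a H)" unfolding ito_integral_def by (rule someI[where P="is_ito_integral M F B a a H"])
  then obtain Hs Is where m[measurable]: "ito_integral M F B a a H \<in> borel_measurable M" and s: "\<And>n. simple_ito M F B a a (Hs n) (Is n)"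
    and l: "(\<lambda>n. sqdist M (Is n) (ito_integral M F B a a H)) \<longlonglongrightarrow> 0" unfolding is_ito_integral_def sqdist_def by blast
  have "sqdist M (Is n) (ito_integral M F B a a H) = sqdist M (\<lambda>_. 0) (ito_integral M F B a a H)" for n
    by (rule sqdist_cong) (use s simple_ito_degenerate in auto)
  then have "sqdist M (\<lambda>_. 0) (ito_integral M F B a a H) = 0" using l by (simp add: LIMSEQ_const_iff)
  then have "AE \<omega> in M. 0 = ito_integral M F B a a H \<omega>" by (intro sqdist_eq_0) auto
  then show ?thesis by eventually_elim simp
qed

lemma is_ito_integral_ito_integral:
  assumes H: "adapted_continuous a b H" and ab: "0 \<le> a" "a < b" "b \<le> T" and fin: "mean_power 2 a b H < \<infinity>"
  shows "is_ito_integral M F B a b H (ito_integral M F B a b H)"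
proof -
  obtain Y where "is_ito_integral M F B a b H Y" using lag_ito_exists[OF H ab fin] .
  then show ?thesis unfolding ito_integral_def by (rule someI[where P="is_ito_integral M F B a b H"])
qed

end

section \<open>Moments of equations with linear growth\<close>

lemma sum_power_le:
  fixes x :: "'k \<Rightarrow> real"
  assumes "finite S" and p: "p = 2 \<or> p = 4"
  shows "(\<Sum>k\<in>S. x k) ^ p \<le> real (card S) ^ (p - 1) * (\<Sum>k\<in>S. x k ^ p)"
proof -
  have sq: "(\<Sum>k\<in>S. y k)\<^sup>2 \<le> real (card S) * (\<Sum>k\<in>S. (y k)\<^sup>2)" for y :: "'k \<Rightarrow> real"
    using sum_squared_le_sum_of_squares[of y S] assms by (simp add: mult.commute)
  have "(\<Sum>k\<in>S. x k) ^ 4 = ((\<Sum>k\<in>S. x k)\<^sup>2)\<^sup>2" by simp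
  also have "\<dots> \<le> (real (card S) * (\<Sum>k\<in>S. (x k)\<^sup>2))\<^sup>2" by (rule power_mono[OF sq]) simp
  also have "\<dots> = (real (card S))\<^sup>2 * (\<Sum>k\<in>S. (x k)\<^sup>2)\<^sup>2" by (simp add: power_mult_distrib)
  also have "\<dots> \<le> (real (card S))\<^sup>2 * (real (card S) * (\<Sum>k\<in>S. ((x k)\<^sup>2)\<^sup>2))" by (rule mult_left_mono[OF sq]) simp
  also have "\<dots> = real (card S) ^ 3 * (\<Sum>k\<in>S. x k ^ 4)" by (simp add: power3_eq_cube power2_eq_square power4_eq_xxxx mult.assoc)
  finally show ?thesis using p sq[of x] by auto
qed

lemma power2_le_one_plus_power4: "(x::real)\<^sup>2 \<le> 1 + x ^ 4"
proof -
  have "0 \<le> (x\<^sup>2 - 1)\<^sup>2 + x\<^sup>2" by simp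
  then show ?thesis by (simp add: power2_eq_square power4_eq_xxxx algebra_simps)
qed

lemma three_power_le:
  fixes x y z :: real
  assumes p: "p = 2 \<or> p = 4"
  shows "(x + y + z) ^ p \<le> 3 ^ (p - 1) * (x ^ p + y ^ p + z ^ p)"
  using sum_power_le[of "{0,1,2::nat}" p "\<lambda>k. if k = 0 then x else if k = 1 then y else z"] p by (simp add: algebra_simps)

lemma set_lint_mono_upper:
  fixes f :: "real \<Rightarrow> real"
  assumes f: "continuous_on {t..b} f" "\<And>r. r \<in> {t..b} \<Longrightarrow> 0 \<le> f r" and rs: "r \<le> s" "s \<le> b"
  shows "(LINT q:{t..r}|lborel. f q) \<le> (LINT q:{t..s}|lborel. f q)"
proof -
  have "ennreal (LINT q:{t..r}|lborel. f q) = (\<integral>\<^sup>+q\<in>{t..r}. ennreal (f q) \<partial>lborel)"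
    by (rule nn_integral_eq_set_lint[symmetric]) (use f rs in \<open>auto intro: continuous_on_subset\<close>)
  also have "\<dots> \<le> (\<integral>\<^sup>+q\<in>{t..s}. ennreal (f q) \<partial>lborel)"
    by (rule nn_integral_mono) (use rs in \<open>auto simp: indicator_def\<close>)
  also have "\<dots> = ennreal (LINT q:{t..s}|lborel. f q)"
    by (rule nn_integral_eq_set_lint) (use f rs in \<open>auto intro: continuous_on_subset\<close>)
  finally have le: "ennreal (LINT q:{t..r}|lborel. f q) \<le> ennreal (LINT q:{t..s}|lborel. f q)" .
  have "0 \<le> (LINT q:{t..s}|lborel. f q)"
    unfolding set_lebesgue_integral_def by (rule integral_nonneg_AE) (use f(2) rs in \<open>auto simp: indicator_def\<close>)
  then show ?thesis using le by (simp add: ennreal_le_iff)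
qed

lemma continuous_on_set_lint:
  fixes f :: "real \<Rightarrow> real"
  assumes "continuous_on {t..b} f"
  shows "continuous_on {t..b} (\<lambda>s. LINT q:{t..s}|lborel. f q)"
proof -
  have "(LINT q:{t..s}|lborel. f q) = integral {t..s} f" if "s \<in> {t..b}" for s
    by (rule set_borel_integral_eq_integral(2)[OF borel_integrable_atLeastAtMost'])
       (use assms that in \<open>auto intro: continuous_on_subset\<close>)
  moreover have "continuous_on {t..b} (\<lambda>s. integral {t..s} f)"
    by (rule indefinite_integral_continuous_1[OF integrable_continuous_real[OF assms]])
  ultimately show ?thesis by (subst continuous_on_cong[OF refl, where g="\<lambda>s. integral {t..s} f"]) auto
qed

lemma set_lint_singleton: "(LINT q:{t..t}|lborel. f q) = (0::real)" for f :: "real \<Rightarrow> real"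
proof -
  have "(\<lambda>q. indicator {t..t} q *\<^sub>R f q) = (\<lambda>q. indicator {t} q *\<^sub>R f t)" by (auto simp: indicator_def)
  then show ?thesis by (simp add: set_lebesgue_integral_def)
qed

text \<open>The running integral Q is continuous and nondecreasing, so the times with Q < K lie in
  an initial interval at whose end Q is at most K. If Q exceeds K at the end, that point comes from
  the intermediate value theorem.\<close>

lemma nn_integral_cutoff_le:
  fixes f :: "real \<Rightarrow> real"
  assumes f: "continuous_on {t..b} f" "\<And>r. r \<in> {t..b} \<Longrightarrow> 0 \<le> f r" and "t \<le> b" "0 < K"
  shows "(\<integral>\<^sup>+r\<in>{t..b}. ennreal (f r) * indicator {r. (LINT q:{t..r}|lborel. f q) < K} r \<partial>lborel) \<le> ennreal K"
proof -
  define Q where "Q = (\<lambda>r. LINT q:{t..r}|lborel. f q)"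
  have mono: "Q r \<le> Q s" if "r \<le> s" "s \<le> b" for r s
    unfolding Q_def by (rule set_lint_mono_upper[OF f that])
  have "\<exists>\<tau>\<in>{t..b}. Q \<tau> \<le> K \<and> (\<forall>r\<in>{t..b}. Q r < K \<longrightarrow> r \<le> \<tau>)"
  proof (cases "Q b \<le> K")
    case True then show ?thesis using \<open>t \<le> b\<close> by auto
  next
    case False
    have "\<exists>\<tau>. t \<le> \<tau> \<and> \<tau> \<le> b \<and> Q \<tau> = K"
      by (rule IVT') (use False assms continuous_on_set_lint[OF f(1)] set_lint_singleton[of t f] in \<open>auto simp: Q_def\<close>)
    then obtain \<tau> where \<tau>: "t \<le> \<tau>" "\<tau> \<le> b" "Q \<tau> = K" by blast
    have "r \<le> \<tau>" if "r \<in> {t..b}" "Q r < K" for r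
      using mono[of \<tau> r] that \<tau> by (cases "r \<le> \<tau>") auto
    then show ?thesis using \<tau> by (intro bexI[of _ \<tau>]) auto
  qed
  then obtain \<tau> where \<tau>: "\<tau> \<in> {t..b}" "Q \<tau> \<le> K" "\<And>r. r \<in> {t..b} \<Longrightarrow> Q r < K \<Longrightarrow> r \<le> \<tau>" by blast
  have "(\<integral>\<^sup>+r\<in>{t..b}. ennreal (f r) * indicator {r. Q r < K} r \<partial>lborel) \<le> (\<integral>\<^sup>+r\<in>{t..\<tau>}. ennreal (f r) \<partial>lborel)"
    by (rule nn_integral_mono) (use \<tau>(3) in \<open>auto simp: indicator_def\<close>)
  also have "\<dots> = ennreal (Q \<tau>)"
    unfolding Q_def by (rule nn_integral_eq_set_lint) (use f \<tau> in \<open>auto intro: continuous_on_subset\<close>)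
  also have "\<dots> \<le> ennreal K" using \<tau> by (intro ennreal_leI)
  finally show ?thesis by (simp add: Q_def)
qed

section \<open>Moments of processes from a cut-off inequality\<close>

context ito_driver
begin

lemma adapted_continuous_path_integral:
  assumes H: "adapted_continuous t b H"
  shows "adapted_continuous t b (\<lambda>s \<omega>. LINT r:{t..s}|lborel. H r \<omega>)"
  unfolding adapted_continuous_def
proof (intro conjI ballI)
  fix s assume s: "s \<in> {t..b}"
  show "(\<lambda>\<omega>. LINT r:{t..s}|lborel. H r \<omega>) \<in> borel_measurable (F s)"
  proof (rule borel_measurable_path_integral)
    fix r assume "r \<in> {t..s}"
    then show "H r \<in> borel_measurable (F s)" using s by (intro measurable_F_mono[OF adapted_continuousD(1)[OF H]]) auto
  next
    fix \<omega> assume "\<omega> \<in> space (F s)"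
    then show "continuous_on {t..s} (\<lambda>r. H r \<omega>)"
      using s by (intro continuous_on_subset[OF adapted_continuousD(3)[OF H]]) (auto simp: space_F)
  qed
next
  fix \<omega> assume "\<omega> \<in> space M"
  then show "continuous_on {t..b} (\<lambda>s. LINT r:{t..s}|lborel. H r \<omega>)"
    by (intro continuous_on_set_lint adapted_continuousD(3)[OF H])
qed

lemma nn_integral_swap:
  fixes f :: "real \<Rightarrow> 'w \<Rightarrow> ennreal"
  assumes "(\<lambda>p. f (snd p) (fst p)) \<in> borel_measurable (M \<Otimes>\<^sub>M lborel)"
  shows "(\<integral>\<^sup>+\<omega>. (\<integral>\<^sup>+r. f r \<omega> \<partial>lborel) \<partial>M) = (\<integral>\<^sup>+r. (\<integral>\<^sup>+\<omega>. f r \<omega> \<partial>M) \<partial>lborel)"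
proof -
  interpret p: pair_sigma_finite M "lborel :: real measure" ..
  have "case_prod (\<lambda>\<omega> r. f r \<omega>) \<in> borel_measurable (M \<Otimes>\<^sub>M lborel)" using assms by (simp add: case_prod_beta')
  from p.Fubini'[OF this] show ?thesis by simp
qed

lemma mean_power_swap:
  assumes H: "adapted_continuous a b H"
  shows "mean_power p a b H = (\<integral>\<^sup>+r\<in>{a..b}. (\<integral>\<^sup>+\<omega>. ennreal (H r \<omega> ^ p) \<partial>M) \<partial>lborel)"
proof -
  have [measurable]: "(\<lambda>x. H (snd x) (fst x) * indicator {a..b} (snd x)) \<in> borel_measurable (M \<Otimes>\<^sub>M lborel)"
    by (rule borel_measurable_pair_on[where u=a and v=b]) (use adapted_continuousD[OF H] in auto)
  have "(\<lambda>x. ennreal ((H (snd x) (fst x) * indicator {a..b} (snd x)) ^ p) * indicator {a..b} (snd x)) \<in> borel_measurable (M \<Otimes>\<^sub>M lborel)"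
    by measurable
  from nn_integral_swap[of "\<lambda>r \<omega>. ennreal ((H r \<omega> * indicator {a..b} r) ^ p) * indicator {a..b} r", OF this]
  have "(\<integral>\<^sup>+\<omega>. (\<integral>\<^sup>+r. ennreal ((H r \<omega> * indicator {a..b} r) ^ p) * indicator {a..b} r \<partial>lborel) \<partial>M)
    = (\<integral>\<^sup>+r. (\<integral>\<^sup>+\<omega>. ennreal ((H r \<omega> * indicator {a..b} r) ^ p) * indicator {a..b} r \<partial>M) \<partial>lborel)" .
  moreover have "(\<integral>\<^sup>+\<omega>. (\<integral>\<^sup>+r. ennreal ((H r \<omega> * indicator {a..b} r) ^ p) * indicator {a..b} r \<partial>lborel) \<partial>M) = mean_power p a b H"
    unfolding mean_power_def by (intro nn_integral_cong) (auto simp: indicator_def)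
  moreover have "(\<integral>\<^sup>+r. (\<integral>\<^sup>+\<omega>. ennreal ((H r \<omega> * indicator {a..b} r) ^ p) * indicator {a..b} r \<partial>M) \<partial>lborel) = (\<integral>\<^sup>+r\<in>{a..b}. (\<integral>\<^sup>+\<omega>. ennreal (H r \<omega> ^ p) \<partial>M) \<partial>lborel)"
    by (intro nn_integral_cong) (auto simp: indicator_def)
  ultimately show ?thesis by simp
qed

text \<open>The bound is asked for on the open interval only, the endpoints being null. The
  continuation argument relies on this, since it knows bounds only strictly before the supremum of
  the admissible times.\<close>

lemma mean_power_le:
  assumes H: "adapted_continuous a b H" and "a \<le> b" "0 \<le> c" and le: "\<And>r. r \<in> {a<..<b} \<Longrightarrow> (\<integral>\<^sup>+\<omega>. ennreal (H r \<omega> ^ p) \<partial>M) \<le> ennreal c"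
  shows "mean_power p a b H \<le> ennreal (c * (b - a))"
proof -
  have "mean_power p a b H \<le> (\<integral>\<^sup>+r. ennreal c * indicator {a..b} r \<partial>lborel)"
    unfolding mean_power_swap[OF H]
  proof (rule nn_integral_mono_AE)
    have "AE r in lborel. r \<noteq> a" "AE r in lborel. r \<noteq> b" by (rule AE_lborel_singleton)+
    then show "AE r in lborel. (\<integral>\<^sup>+\<omega>. ennreal (H r \<omega> ^ p) \<partial>M) * indicator {a..b} r \<le> ennreal c * indicator {a..b} r"
    proof eventually_elim
      case (elim r)
      then show ?case using le[of r] by (cases "r \<in> {a..b}") auto
    qed
  qed
  also have "\<dots> = ennreal (c * (b - a))" using assms by (simp add: nn_integral_cmult ennreal_mult')
  finally show ?thesis .
qed

lemma mean_power_mono: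
  assumes "\<And>r \<omega>. r \<in> {a..b} \<Longrightarrow> \<omega> \<in> space M \<Longrightarrow> H r \<omega> ^ p \<le> H' r \<omega> ^ p'"
  shows "mean_power p a b H \<le> mean_power p' a b H'"
  unfolding mean_power_def by (intro nn_integral_mono) (use assms in \<open>auto simp: indicator_def intro!: ennreal_leI\<close>)

lemma mean_power_subset: "b \<le> b' \<Longrightarrow> mean_power p a b H \<le> mean_power p a b' H"
  unfolding mean_power_def by (intro nn_integral_mono) (auto simp: indicator_def)

text \<open>One factor b - a stems from the fourth moment inequality and the other from integrating
  the uniform bound over time; together they give the quadratic order that cancels the denominator
  in the end.\<close>

lemma ito_fourth_moment_uniform:
  assumes H: "adapted_continuous a b H" and ab: "0 \<le> a" "a < b" "b \<le> T" and "0 \<le> c"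
    and le: "\<And>r. r \<in> {a<..b} \<Longrightarrow> (\<integral>\<^sup>+\<omega>. ennreal (H r \<omega> ^ 4) \<partial>M) \<le> ennreal c"
  shows "is_ito_integral M F B a b H (ito_integral M F B a b H)"
    and "(\<integral>\<^sup>+\<omega>. ennreal (ito_integral M F B a b H \<omega> ^ 4) \<partial>M) \<le> ennreal (36 * c * (b - a)\<^sup>2)"
proof -
  have m4: "mean_power 4 a b H \<le> ennreal (c * (b - a))" by (rule mean_power_le[OF H]) (use ab le \<open>0 \<le> c\<close> in auto)
  have "mean_power 2 a b H \<le> ennreal ((1 + c) * (b - a))"
  proof (rule mean_power_le[OF H])
    fix r assume r: "r \<in> {a<..<b}"
    have [measurable]: "H r \<in> borel_measurable M" using adapted_continuousD(2)[OF H] r by auto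
    have "(\<integral>\<^sup>+\<omega>. ennreal (H r \<omega> ^ 2) \<partial>M) \<le> (\<integral>\<^sup>+\<omega>. 1 + ennreal (H r \<omega> ^ 4) \<partial>M)"
    proof (rule nn_integral_mono)
      fix \<omega>
      have "ennreal (H r \<omega> ^ 2) \<le> ennreal (1 + H r \<omega> ^ 4)" by (rule ennreal_leI[OF power2_le_one_plus_power4])
      then show "ennreal (H r \<omega> ^ 2) \<le> 1 + ennreal (H r \<omega> ^ 4)" by simp
    qed
    also have "\<dots> = 1 + (\<integral>\<^sup>+\<omega>. ennreal (H r \<omega> ^ 4) \<partial>M)" by (subst nn_integral_add) (auto simp: emeasure_space_1)
    also have "\<dots> \<le> 1 + ennreal c" using le[of r] r by (intro add_left_mono) auto
    also have "\<dots> = ennreal (1 + c)" using \<open>0 \<le> c\<close> by simp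
    finally show "(\<integral>\<^sup>+\<omega>. ennreal (H r \<omega> ^ 2) \<partial>M) \<le> ennreal (1 + c)" .
  qed (use ab \<open>0 \<le> c\<close> in auto)
  then have fin: "mean_power 2 a b H < \<infinity>" by (rule le_less_trans) simp
  show ii: "is_ito_integral M F B a b H (ito_integral M F B a b H)" by (rule is_ito_integral_ito_integral[OF H ab fin])
  have "(\<integral>\<^sup>+\<omega>. ennreal (ito_integral M F B a b H \<omega> ^ 4) \<partial>M) \<le> ennreal (36 * (b - a)) * mean_power 4 a b H"
    by (rule ito_fourth_moment[OF H ab ii])
  also have "\<dots> \<le> ennreal (36 * (b - a)) * ennreal (c * (b - a))" by (rule mult_left_mono[OF m4]) simp
  also have "\<dots> = ennreal (36 * c * (b - a)\<^sup>2)"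
    using ab by (subst ennreal_mult'[symmetric]) (auto simp: power2_eq_square algebra_simps)
  finally show "(\<integral>\<^sup>+\<omega>. ennreal (ito_integral M F B a b H \<omega> ^ 4) \<partial>M) \<le> ennreal (36 * c * (b - a)\<^sup>2)" .
qed

lemma cutoff_pair_measurable:
  assumes N: "adapted_continuous t b N" and s: "s \<le> b"
  shows "(\<lambda>p. ennreal (N (snd p) (fst p)) * indicator {\<omega>. (LINT q:{t..snd p}|lborel. N q \<omega>) < K} (fst p) * indicator {t..s} (snd p)) \<in> borel_measurable (M \<Otimes>\<^sub>M lborel)"
proof -
  define Q where "Q = (\<lambda>r \<omega>. LINT q:{t..r}|lborel. N q \<omega>)"
  note Q = adapted_continuous_path_integral[OF N, folded Q_def]
  have [measurable]: "(\<lambda>p. N (snd p) (fst p) * indicator {t..s} (snd p)) \<in> borel_measurable (M \<Otimes>\<^sub>M lborel)"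
    by (rule borel_measurable_pair_on[where u=t and v=b]) (use s adapted_continuousD[OF N] in auto)
  have [measurable]: "(\<lambda>p. Q (snd p) (fst p) * indicator {t..s} (snd p)) \<in> borel_measurable (M \<Otimes>\<^sub>M lborel)"
    by (rule borel_measurable_pair_on[where u=t and v=b]) (use s adapted_continuousD[OF Q] in auto)
  have "(\<lambda>p. if Q (snd p) (fst p) * indicator {t..s} (snd p) < K then ennreal (N (snd p) (fst p) * indicator {t..s} (snd p)) else 0) \<in> borel_measurable (M \<Otimes>\<^sub>M lborel)"
    by measurable
  also have "(\<lambda>p. if Q (snd p) (fst p) * indicator {t..s} (snd p) < K then ennreal (N (snd p) (fst p) * indicator {t..s} (snd p)) else 0)
    = (\<lambda>p. ennreal (N (snd p) (fst p)) * indicator {\<omega>. (LINT q:{t..snd p}|lborel. N q \<omega>) < K} (fst p) * indicator {t..s} (snd p))"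
    by (auto simp: fun_eq_iff indicator_def Q_def)
  finally show ?thesis .
qed

text \<open>The cutoff \<open>\<integral>\<^sub>t\<^sup>r N < K\<close> takes the place of a stopping time: the cut-off mean of \<open>N\<close> is integrable
  in time (by \<open>K\<close>) without any moment assumption.  The two levels \<open>L < K\<close> leave room for a continuous
  truncation of the integrand.\<close>

lemma cutoff_gronwall:
  assumes N: "adapted_continuous t b N" and nn: "\<And>r \<omega>. r \<in> {t..b} \<Longrightarrow> \<omega> \<in> space M \<Longrightarrow> 0 \<le> N r \<omega>"
    and ineq: "\<And>K L s. 0 < L \<Longrightarrow> L < K \<Longrightarrow> s \<in> {t<..b} \<Longrightarrow>
      (\<integral>\<^sup>+\<omega>. ennreal (N s \<omega>) * indicator {\<omega>. (LINT q:{t..s}|lborel. N q \<omega>) \<le> L} \<omega> \<partial>M) \<le> ennreal A + ennreal C *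
        (\<integral>\<^sup>+\<omega>. (\<integral>\<^sup>+r\<in>{t..s}. ennreal (N r \<omega>) * indicator {\<omega>. (LINT q:{t..r}|lborel. N q \<omega>) < K} \<omega> \<partial>lborel) \<partial>M)"
    and AC: "0 \<le> A" "0 < C" and s: "s \<in> {t<..b}"
  shows "(\<integral>\<^sup>+\<omega>. ennreal (N s \<omega>) \<partial>M) \<le> ennreal (2 * A * exp (2 * C * (s - t)))"
proof -
  define Q where "Q = (\<lambda>r \<omega>. LINT q:{t..r}|lborel. N q \<omega>)"
  note Q = adapted_continuous_path_integral[OF N, folded Q_def]
  define v where "v = (\<lambda>K r. \<integral>\<^sup>+\<omega>. ennreal (N r \<omega>) * indicator {\<omega>. Q r \<omega> < K} \<omega> \<partial>M)"
  have swap: "(\<integral>\<^sup>+\<omega>. (\<integral>\<^sup>+r\<in>{t..s}. ennreal (N r \<omega>) * indicator {\<omega>. Q r \<omega> < K} \<omega> \<partial>lborel) \<partial>M) = (\<integral>\<^sup>+r\<in>{t..s}. v K r \<partial>lborel)"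
    if "s \<le> b" for s K
  proof -
    have "(\<integral>\<^sup>+\<omega>. (\<integral>\<^sup>+r\<in>{t..s}. ennreal (N r \<omega>) * indicator {\<omega>. Q r \<omega> < K} \<omega> \<partial>lborel) \<partial>M)
      = (\<integral>\<^sup>+r. (\<integral>\<^sup>+\<omega>. ennreal (N r \<omega>) * indicator {\<omega>. Q r \<omega> < K} \<omega> * indicator {t..s} r \<partial>M) \<partial>lborel)"
      by (rule nn_integral_swap) (use cutoff_pair_measurable[OF N that] in \<open>simp add: Q_def\<close>)
    also have "\<dots> = (\<integral>\<^sup>+r\<in>{t..s}. v K r \<partial>lborel)"
      unfolding v_def by (intro nn_integral_cong) (auto simp: indicator_def)
    finally show ?thesis .
  qed
  have Ns: "N r \<in> borel_measurable M" "Q r \<in> borel_measurable M" if "r \<in> {t..b}" for r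
    using adapted_continuousD(2)[OF N that] adapted_continuousD(2)[OF Q that] by auto
  have v_le: "v K s \<le> ennreal (2 * A * exp (2 * C * (s - t)))" if K: "K > 0" for K
  proof (rule gronwall_nn_integral[OF _ _ AC(2,1) s])
    have "(\<integral>\<^sup>+r\<in>{t..b}. v K r \<partial>lborel) = (\<integral>\<^sup>+\<omega>. (\<integral>\<^sup>+r\<in>{t..b}. ennreal (N r \<omega>) * indicator {\<omega>. Q r \<omega> < K} \<omega> \<partial>lborel) \<partial>M)"
      by (rule swap[symmetric]) simp
    also have "\<dots> \<le> (\<integral>\<^sup>+\<omega>. ennreal K \<partial>M)"
    proof (rule nn_integral_mono)
      fix \<omega> assume \<omega>: "\<omega> \<in> space M"
      have "(\<integral>\<^sup>+r\<in>{t..b}. ennreal (N r \<omega>) * indicator {r. Q r \<omega> < K} r \<partial>lborel) \<le> ennreal K"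
        unfolding Q_def by (rule nn_integral_cutoff_le) (use adapted_continuousD(3)[OF N \<omega>] nn[OF _ \<omega>] s K in auto)
      then show "(\<integral>\<^sup>+r\<in>{t..b}. ennreal (N r \<omega>) * indicator {\<omega>. Q r \<omega> < K} \<omega> \<partial>lborel) \<le> ennreal K"
        by (simp add: indicator_def)
    qed
    also have "\<dots> < \<infinity>" by (simp add: emeasure_space_1)
    finally show "(\<integral>\<^sup>+r\<in>{t..b}. v K r \<partial>lborel) < \<infinity>" .
    fix s assume s: "s \<in> {t<..b}"
    then have [measurable]: "N s \<in> borel_measurable M" "Q s \<in> borel_measurable M" using Ns by auto
    \<comment> \<open>The levels \<open>L n\<close> increase to \<open>K\<close>, so the events Q <=
      L n exhaust the event Q < K. Fatou then yields an inequality with the same \<open>K\<close> on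
      both sides, as Gronwall requires.\<close>
    define L where "L = (\<lambda>n::nat. K * (1 - 1 / (real n + 2)))"
    have L: "0 < L n" "L n < K" for n using K by (auto simp: L_def field_simps intro!: add_pos_nonneg)
    have Llim: "L \<longlonglongrightarrow> K"
    proof -
      have "(\<lambda>n. 1 / (real n + 2)) \<longlonglongrightarrow> 0"
        using LIMSEQ_ignore_initial_segment[OF lim_1_over_n, of 2] by (simp add: add.commute)
      then have "L \<longlonglongrightarrow> K * (1 - 0)" unfolding L_def by (intro tendsto_intros)
      then show ?thesis by simp
    qed
    have "v K s = (\<integral>\<^sup>+\<omega>. liminf (\<lambda>n. ennreal (N s \<omega>) * indicator {\<omega>. Q s \<omega> \<le> L n} \<omega>) \<partial>M)"
      unfolding v_def
    proof (rule nn_integral_cong)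
      fix \<omega>
      have "(\<lambda>n. ennreal (N s \<omega>) * indicator {\<omega>. Q s \<omega> \<le> L n} \<omega>) \<longlonglongrightarrow> ennreal (N s \<omega>) * indicator {\<omega>. Q s \<omega> < K} \<omega>"
      proof (cases "Q s \<omega> < K")
        case True
        have "eventually (\<lambda>n. Q s \<omega> < L n) sequentially" by (rule order_tendstoD(1)[OF Llim True])
        then have "eventually (\<lambda>n. ennreal (N s \<omega>) * indicator {\<omega>. Q s \<omega> \<le> L n} \<omega> = ennreal (N s \<omega>) * indicator {\<omega>. Q s \<omega> < K} \<omega>) sequentially"
          by eventually_elim (use True in simp)
        then show ?thesis by (rule tendsto_eventually)
      next
        case False
        then have "\<not> Q s \<omega> \<le> L n" for n using L(2)[of n] by simp
        then show ?thesis using False by simp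
      qed
      from lim_imp_Liminf[OF sequentially_bot this]
      show "ennreal (N s \<omega>) * indicator {\<omega>. Q s \<omega> < K} \<omega> = liminf (\<lambda>n. ennreal (N s \<omega>) * indicator {\<omega>. Q s \<omega> \<le> L n} \<omega>)" by simp
    qed
    also have "\<dots> \<le> liminf (\<lambda>n. \<integral>\<^sup>+\<omega>. ennreal (N s \<omega>) * indicator {\<omega>. Q s \<omega> \<le> L n} \<omega> \<partial>M)"
      by (rule nn_integral_liminf) (simp add: indicator_def)
    also have "\<dots> \<le> limsup (\<lambda>n. \<integral>\<^sup>+\<omega>. ennreal (N s \<omega>) * indicator {\<omega>. Q s \<omega> \<le> L n} \<omega> \<partial>M)"
      by (rule Liminf_le_Limsup) simp
    also have "\<dots> \<le> ennreal A + ennreal C * (\<integral>\<^sup>+r\<in>{t..s}. v K r \<partial>lborel)"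
      by (rule Limsup_bounded, rule always_eventually, rule allI)
         (use ineq[OF L s] swap[of s K] s in \<open>simp add: Q_def\<close>)
    finally show "v K s \<le> ennreal A + ennreal C * (\<integral>\<^sup>+r\<in>{t..s}. v K r \<partial>lborel)" .
  qed
  have [measurable]: "N s \<in> borel_measurable M" "Q s \<in> borel_measurable M" using Ns s by auto
  have "(\<integral>\<^sup>+\<omega>. ennreal (N s \<omega>) \<partial>M) = (\<integral>\<^sup>+\<omega>. liminf (\<lambda>n. ennreal (N s \<omega>) * indicator {\<omega>. Q s \<omega> < real (Suc n)} \<omega>) \<partial>M)"
  proof (rule nn_integral_cong)
    fix \<omega>
    \<comment> \<open>The running integral is a finite number on each path, so the cutoff is
      eventually void and Fatou removes it.\<close>
    obtain n0 where n0: "Q s \<omega> < real n0" using reals_Archimedean2 by blast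
    have "eventually (\<lambda>n. ennreal (N s \<omega>) * indicator {\<omega>. Q s \<omega> < real (Suc n)} \<omega> = ennreal (N s \<omega>)) sequentially"
      by (rule eventually_sequentiallyI[of n0]) (use n0 in auto)
    then have "(\<lambda>n. ennreal (N s \<omega>) * indicator {\<omega>. Q s \<omega> < real (Suc n)} \<omega>) \<longlonglongrightarrow> ennreal (N s \<omega>)" by (rule tendsto_eventually)
    from lim_imp_Liminf[OF sequentially_bot this]
    show "ennreal (N s \<omega>) = liminf (\<lambda>n. ennreal (N s \<omega>) * indicator {\<omega>. Q s \<omega> < real (Suc n)} \<omega>)" by simp
  qed
  also have "\<dots> \<le> liminf (\<lambda>n. v (real (Suc n)) s)"
    unfolding v_def by (rule nn_integral_liminf) (simp add: indicator_def)
  also have "\<dots> \<le> limsup (\<lambda>n. v (real (Suc n)) s)" by (rule Liminf_le_Limsup) simp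
  also have "\<dots> \<le> ennreal (2 * A * exp (2 * C * (s - t)))"
    by (rule Limsup_bounded, rule always_eventually, rule allI) (rule v_le, simp)
  finally show ?thesis .
qed

end

context ito_driver
begin

lemma adapted_continuous_compose:
  assumes "adapted_continuous a b H" "continuous_on UNIV (\<phi> :: real \<Rightarrow> real)"
  shows "adapted_continuous a b (\<lambda>r \<omega>. \<phi> (H r \<omega>))"
  using assms unfolding adapted_continuous_def
  by (auto intro: borel_measurable_continuous_on continuous_on_compose2[OF assms(2)])

lemma adapted_continuous_mult:
  "adapted_continuous a b H \<Longrightarrow> adapted_continuous a b H' \<Longrightarrow> adapted_continuous a b (\<lambda>r \<omega>. H r \<omega> * H' r \<omega>)"
  unfolding adapted_continuous_def by (auto intro!: continuous_intros borel_measurable_times)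

lemma adapted_continuous_const: "adapted_continuous a b (\<lambda>r \<omega>. c)"
  unfolding adapted_continuous_def by (auto intro!: continuous_intros)

lemma adapted_continuous_add:
  "adapted_continuous a b H \<Longrightarrow> adapted_continuous a b H' \<Longrightarrow> adapted_continuous a b (\<lambda>r \<omega>. H r \<omega> + H' r \<omega>)"
  unfolding adapted_continuous_def by (auto intro!: continuous_intros borel_measurable_add)

lemma adapted_continuous_sum:
  "(\<And>k. k \<in> S \<Longrightarrow> adapted_continuous a b (H k)) \<Longrightarrow> adapted_continuous a b (\<lambda>r \<omega>. \<Sum>k\<in>S. H k r \<omega>)"
  unfolding adapted_continuous_def by (auto intro!: continuous_intros borel_measurable_sum)

end

text \<open>The summand 1 is carried as an additional index, hence \<open>'i option\<close> and the
  count \<open>CARD('i) + 1\<close> in the power mean inequality.\<close>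

lemma one_plus_sum_power_le:
  fixes x :: "'i::finite \<Rightarrow> real"
  assumes p: "p = 2 \<or> p = 4"
  shows "(1 + (\<Sum>k\<in>UNIV. x k)) ^ p \<le> real (CARD('i) + 1) ^ (p - 1) * (1 + (\<Sum>k\<in>UNIV. x k ^ p))"
proof -
  have s: "(\<Sum>k\<in>UNIV. f k) = f None + (\<Sum>i\<in>UNIV. f (Some i))" for f :: "'i option \<Rightarrow> real"
    unfolding UNIV_option_conv by (subst sum.insert) (auto simp: sum.reindex)
  have "CARD('i option) = CARD('i) + 1" by simp
  then show ?thesis using sum_power_le[of "UNIV :: 'i option set" p "case_option 1 x"] p unfolding s by simp
qed

text \<open>A system written in scalar coordinates: indices are coordinates for \<open>X\<close> and
  pairs of matrix indices for \<open>D\<close>. The coefficients are processes, not functions of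
  \<open>U\<close>, because those of the variational equation also involve \<open>X\<close>. Growth
  in \<open>U\<close> is the only quantitative requirement on them.\<close>

locale linear_growth_sde =
  fixes M :: "'w measure" and F :: "real \<Rightarrow> 'w measure" and T :: real
    and B :: "'j::finite \<Rightarrow> real \<Rightarrow> 'w \<Rightarrow> real" and U :: "'i::finite \<Rightarrow> real \<Rightarrow> 'w \<Rightarrow> real"
    and \<alpha> :: "'i \<Rightarrow> real \<Rightarrow> 'w \<Rightarrow> real" and \<eta> :: "'i \<Rightarrow> 'j \<Rightarrow> real \<Rightarrow> 'w \<Rightarrow> real"
    and u :: "'i \<Rightarrow> real" and C t :: real
  assumes driver: "\<And>j. ito_driver M F T (B j)"
    and t: "0 \<le> t" "t < T" and C: "0 < C"
    and U: "\<And>i. ito_driver.adapted_continuous M F t T (U i)"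
    and \<alpha>: "\<And>i. ito_driver.adapted_continuous M F t T (\<alpha> i)"
    and \<eta>: "\<And>i j. ito_driver.adapted_continuous M F t T (\<eta> i j)"
    and \<alpha>_growth: "\<And>i r \<omega>. r \<in> {t..T} \<Longrightarrow> \<omega> \<in> space M \<Longrightarrow> \<bar>\<alpha> i r \<omega>\<bar> \<le> C * (1 + (\<Sum>k\<in>UNIV. \<bar>U k r \<omega>\<bar>))"
    and \<eta>_growth: "\<And>i j r \<omega>. r \<in> {t..T} \<Longrightarrow> \<omega> \<in> space M \<Longrightarrow> \<bar>\<eta> i j r \<omega>\<bar> \<le> C * (1 + (\<Sum>k\<in>UNIV. \<bar>U k r \<omega>\<bar>))"
    and equation: "\<And>i s. s \<in> {t..T} \<Longrightarrow> AE \<omega> in M. U i s \<omega> = u i + (LINT r:{t..s}|lborel. \<alpha> i r \<omega>)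
      + (\<Sum>j\<in>UNIV. ito_integral M F (B j) t s (\<eta> i j) \<omega>)"
begin

sublocale drv: ito_driver M F T "B j" for j by (rule driver)

text \<open>With the summand 1 included, linear growth becomes homogeneous: the p-th power of a
  coefficient is at most a constant times \<open>npow p\<close>, so the integral inequality closes
  on a single quantity.\<close>

definition npow :: "nat \<Rightarrow> real \<Rightarrow> 'w \<Rightarrow> real" where
  "npow p r \<omega> = 1 + (\<Sum>k\<in>UNIV. U k r \<omega> ^ p)"

definition growth :: "nat \<Rightarrow> real" where
  "growth p = C ^ p * real (CARD('i) + 1) ^ (p - 1)"

definition initial :: "nat \<Rightarrow> real" where
  "initial p = 1 + 3 ^ (p - 1) * (\<Sum>k\<in>UNIV. u k ^ p)"

text \<open>In these constants 3^(p - 1) comes from splitting a coordinate into initial value, drift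
  and noise, T^(p - 1) from Jensen for the drift integral, and \<open>CARD('j)\<close> from the sum
  over the drivers. The starting time is estimated away by T.\<close>

definition drift_rate :: "nat \<Rightarrow> real" where
  "drift_rate p = 3 ^ (p - 1) * real CARD('i) * T ^ (p - 1) * growth p"

definition noise_factor :: "nat \<Rightarrow> real" where
  "noise_factor p = (3 * real CARD('j)) ^ (p - 1)"

lemma T_pos: "T > 0" using t by simp

lemma growth_pos: "growth p > 0" using C by (simp add: growth_def)

lemma noise_factor_pos: "noise_factor p > 0" by (simp add: noise_factor_def)

lemma drift_rate_pos: "drift_rate p > 0" using growth_pos[of p] T_pos by (simp add: drift_rate_def)

lemma initial_ge_1: "even p \<Longrightarrow> 1 \<le> initial p"
  by (simp add: initial_def sum_nonneg zero_le_even_power)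

lemma npow_ge_1: "even p \<Longrightarrow> 1 \<le> npow p r \<omega>"
  by (simp add: npow_def sum_nonneg zero_le_even_power)

lemma npow_adapted: "drv.adapted_continuous t T (npow p)"
  unfolding npow_def[abs_def]
  by (intro drv.adapted_continuous_add drv.adapted_continuous_const drv.adapted_continuous_sum drv.adapted_continuous_compose[OF U] continuous_intros)

lemma coefficient_power_le:
  assumes x: "\<bar>x\<bar> \<le> C * (1 + (\<Sum>k\<in>UNIV. \<bar>U k r \<omega>\<bar>))" and p: "p = 2 \<or> p = 4"
  shows "x ^ p \<le> growth p * npow p r \<omega>"
proof -
  have ep: "even p" using p by auto
  have "x ^ p = \<bar>x\<bar> ^ p" using ep by (simp add: power_even_abs)
  also have "\<dots> \<le> (C * (1 + (\<Sum>k\<in>UNIV. \<bar>U k r \<omega>\<bar>))) ^ p" by (rule power_mono[OF x]) simp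
  also have "\<dots> = C ^ p * (1 + (\<Sum>k\<in>UNIV. \<bar>U k r \<omega>\<bar>)) ^ p" by (simp add: power_mult_distrib)
  also have "\<dots> \<le> C ^ p * (real (CARD('i) + 1) ^ (p - 1) * (1 + (\<Sum>k\<in>UNIV. \<bar>U k r \<omega>\<bar> ^ p)))"
    using one_plus_sum_power_le[OF p, of "\<lambda>k. \<bar>U k r \<omega>\<bar>"] C by (intro mult_left_mono) auto
  also have "\<dots> = growth p * npow p r \<omega>" using ep by (simp add: growth_def npow_def power_even_abs mult.assoc)
  finally show ?thesis .
qed

lemma drift_power_le:
  assumes s: "s \<in> {t..T}" and \<omega>: "\<omega> \<in> space M" and p: "p = 2 \<or> p = 4"
  shows "(LINT r:{t..s}|lborel. \<alpha> i r \<omega>) ^ p \<le> (s - t) ^ (p - 1) * growth p * (LINT r:{t..s}|lborel. npow p r \<omega>)"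
proof -
  have ca: "continuous_on {t..s} (\<lambda>r. \<alpha> i r \<omega>)" and cn: "continuous_on {t..s} (\<lambda>r. npow p r \<omega>)"
    using drv.adapted_continuousD(3)[OF \<alpha> \<omega>, of i] drv.adapted_continuousD(3)[OF npow_adapted \<omega>, of p] s
    by (auto elim!: continuous_on_subset)
  have le: "t \<le> s" using s by auto
  have "(LINT r:{t..s}|lborel. \<alpha> i r \<omega>) ^ p \<le> (s - t) ^ (p - 1) * (LINT r:{t..s}|lborel. \<alpha> i r \<omega> ^ p)"
    using p set_lint_power2_le[OF ca le] set_lint_power4_le[OF ca le] by auto
  also have "\<dots> \<le> (s - t) ^ (p - 1) * (LINT r:{t..s}|lborel. growth p * npow p r \<omega>)"
  proof (intro mult_left_mono set_lint_mono_cont continuous_intros ca cn)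
    fix r assume "r \<in> {t..s}"
    then show "\<alpha> i r \<omega> ^ p \<le> growth p * npow p r \<omega>"
      using s by (intro coefficient_power_le[OF \<alpha>_growth p] \<omega>) auto
  qed (use s in simp)
  finally show ?thesis by (simp add: mult.assoc)
qed

text \<open>The estimate at a single \<omega>, with arbitrary numbers \<open>I i j\<close> in place
  of the stochastic integrals. It serves for p = 4 with truncated integrals and for p = 2 with
  integrals whose existence is still open.\<close>

lemma npow_pointwise:
  fixes I :: "'i \<Rightarrow> 'j \<Rightarrow> real"
  assumes s: "s \<in> {t..T}" and \<omega>: "\<omega> \<in> space M" and p: "p = 2 \<or> p = 4"
    and eq: "\<And>i. U i s \<omega> = u i + (LINT r:{t..s}|lborel. \<alpha> i r \<omega>) + (\<Sum>j\<in>UNIV. I i j)"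
  shows "ennreal (npow p s \<omega>) \<le> ennreal (initial p) + ennreal (drift_rate p) * (\<integral>\<^sup>+r\<in>{t..s}. ennreal (npow p r \<omega>) \<partial>lborel)
    + (\<Sum>i\<in>UNIV. \<Sum>j\<in>UNIV. ennreal (noise_factor p) * ennreal (I i j ^ p))"
proof -
  have ep: "even p" using p by auto
  define R where "R = (LINT r:{t..s}|lborel. npow p r \<omega>)"
  have cn: "continuous_on {t..s} (\<lambda>r. npow p r \<omega>)"
    using drv.adapted_continuousD(3)[OF npow_adapted \<omega>, of p] s by (auto elim!: continuous_on_subset)
  have np: "0 \<le> npow p r \<omega>" for r using npow_ge_1[OF ep, of r \<omega>] by simp
  have R: "(\<integral>\<^sup>+r\<in>{t..s}. ennreal (npow p r \<omega>) \<partial>lborel) = ennreal R"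
    unfolding R_def by (rule nn_integral_eq_set_lint[OF cn np])
  have R0: "0 \<le> R" unfolding R_def set_lebesgue_integral_def by (rule integral_nonneg_AE) (simp add: np)
  have each: "U i s \<omega> ^ p \<le> 3 ^ (p - 1) * u i ^ p + 3 ^ (p - 1) * T ^ (p - 1) * growth p * R + (\<Sum>j\<in>UNIV. noise_factor p * I i j ^ p)" for i
  proof -
    have "U i s \<omega> ^ p \<le> 3 ^ (p - 1) * (u i ^ p + (LINT r:{t..s}|lborel. \<alpha> i r \<omega>) ^ p + (\<Sum>j\<in>UNIV. I i j) ^ p)"
      unfolding eq[of i] by (rule three_power_le[OF p])
    also have "\<dots> \<le> 3 ^ (p - 1) * (u i ^ p + T ^ (p - 1) * growth p * R + real CARD('j) ^ (p - 1) * (\<Sum>j\<in>UNIV. I i j ^ p))"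
    proof (intro mult_left_mono add_mono order.refl)
      have "(LINT r:{t..s}|lborel. \<alpha> i r \<omega>) ^ p \<le> (s - t) ^ (p - 1) * (growth p * R)"
        using drift_power_le[OF s \<omega> p, of i] by (simp add: R_def mult.assoc)
      also have "\<dots> \<le> T ^ (p - 1) * (growth p * R)"
        using s t R0 growth_pos[of p] by (intro mult_right_mono power_mono) auto
      finally show "(LINT r:{t..s}|lborel. \<alpha> i r \<omega>) ^ p \<le> T ^ (p - 1) * growth p * R" by (simp add: mult.assoc)
      show "(\<Sum>j\<in>UNIV. I i j) ^ p \<le> real CARD('j) ^ (p - 1) * (\<Sum>j\<in>UNIV. I i j ^ p)"
        using sum_power_le[of "UNIV :: 'j set" p "I i"] p by simp
    qed simp
    also have "\<dots> = 3 ^ (p - 1) * u i ^ p + 3 ^ (p - 1) * T ^ (p - 1) * growth p * R + (\<Sum>j\<in>UNIV. noise_factor p * I i j ^ p)"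
      by (simp add: noise_factor_def power_mult_distrib sum_distrib_left[symmetric] distrib_left mult.assoc)
    finally show ?thesis .
  qed
  have "npow p s \<omega> \<le> 1 + (\<Sum>i\<in>UNIV. 3 ^ (p - 1) * u i ^ p + 3 ^ (p - 1) * T ^ (p - 1) * growth p * R + (\<Sum>j\<in>UNIV. noise_factor p * I i j ^ p))"
    unfolding npow_def by (intro add_left_mono sum_mono each)
  also have "\<dots> = initial p + drift_rate p * R + (\<Sum>i\<in>UNIV. \<Sum>j\<in>UNIV. noise_factor p * I i j ^ p)"
    by (simp add: sum.distrib initial_def drift_rate_def sum_distrib_left mult.assoc mult.left_commute)
  finally have "ennreal (npow p s \<omega>) \<le> ennreal (initial p + drift_rate p * R + (\<Sum>i\<in>UNIV. \<Sum>j\<in>UNIV. noise_factor p * I i j ^ p))"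
    by (rule ennreal_leI)
  also have "\<dots> = ennreal (initial p) + ennreal (drift_rate p * R) + ennreal (\<Sum>i\<in>UNIV. \<Sum>j\<in>UNIV. noise_factor p * I i j ^ p)"
  proof -
    have "0 \<le> initial p" "0 \<le> drift_rate p * R" using initial_ge_1[OF ep] drift_rate_pos[of p] R0 by auto
    moreover have "0 \<le> (\<Sum>i\<in>UNIV. \<Sum>j\<in>UNIV. noise_factor p * I i j ^ p)"
      using noise_factor_pos[of p] ep by (intro sum_nonneg mult_nonneg_nonneg) (auto simp: zero_le_even_power)
    ultimately show ?thesis by (simp add: ennreal_plus)
  qed
  also have "ennreal (\<Sum>i\<in>UNIV. \<Sum>j\<in>UNIV. noise_factor p * I i j ^ p) = (\<Sum>i\<in>UNIV. \<Sum>j\<in>UNIV. ennreal (noise_factor p) * ennreal (I i j ^ p))"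
    using noise_factor_pos[of p] ep
    by (simp add: sum_ennreal[symmetric] sum_nonneg zero_le_even_power ennreal_mult')
  also have "ennreal (drift_rate p * R) = ennreal (drift_rate p) * (\<integral>\<^sup>+r\<in>{t..s}. ennreal (npow p r \<omega>) \<partial>lborel)"
    unfolding R using drift_rate_pos[of p] by (intro ennreal_mult') simp
  finally show ?thesis .
qed

definition rate4 :: real where
  "rate4 = drift_rate 4 + real CARD('i) * real CARD('j) * noise_factor 4 * (36 * T) * growth 4"

definition bound4 :: real where
  "bound4 = 2 * initial 4 * exp (2 * rate4 * T)"

lemma rate4_pos: "rate4 > 0"
  unfolding rate4_def using drift_rate_pos[of 4] noise_factor_pos[of 4] growth_pos[of 4] T_pos by (intro add_pos_pos) auto

lemma bound4_pos: "bound4 > 0"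
  unfolding bound4_def using initial_ge_1[of 4] by simp

text \<open>The noise is estimated through integrands truncated at the running integral of
  \<open>npow 4\<close>. Their fourth powers are dominated by the cut-off process itself, so the
  inequality required by \<open>cutoff_gronwall\<close> closes with no fourth moment known in
  advance. Finite \<open>mean_power 2\<close> of the coefficients guarantees that the integrals in
  the equation are genuine.\<close>

lemma fourth_moment_bound:
  assumes b: "t < b" "b \<le> T" and fin: "\<And>i j. drv.mean_power 2 t b (\<eta> i j) < \<infinity>" and s: "s \<in> {t<..b}"
  shows "(\<integral>\<^sup>+\<omega>. ennreal (npow 4 s \<omega>) \<partial>M) \<le> ennreal bound4"
proof -
  define N where "N = npow 4"
  have N: "drv.adapted_continuous t b N" unfolding N_def
    by (rule drv.adapted_continuous_subset[OF npow_adapted]) (use b in auto)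
  have N0: "0 \<le> N r \<omega>" for r \<omega> using npow_ge_1[of 4 r \<omega>] by (simp add: N_def)
  define Q where "Q = (\<lambda>r \<omega>. LINT q:{t..r}|lborel. N q \<omega>)"
  have Q: "drv.adapted_continuous t b Q" unfolding Q_def by (rule drv.adapted_continuous_path_integral[OF N])
  have Qmono: "Q r \<omega> \<le> Q s \<omega>" if "r \<le> s" "s \<le> b" "\<omega> \<in> space M" for r s \<omega>
    unfolding Q_def by (rule set_lint_mono_upper[OF drv.adapted_continuousD(3)[OF N that(3)] N0 that(1,2)])
  have "(\<integral>\<^sup>+\<omega>. ennreal (N s \<omega>) \<partial>M) \<le> ennreal (2 * initial 4 * exp (2 * rate4 * (s - t)))"
  proof (rule drv.cutoff_gronwall[OF N N0 _ _ rate4_pos s])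
    show "0 \<le> initial 4" using initial_ge_1[of 4] by simp
    fix K L s :: real assume KL: "0 < L" "L < K" and s: "s \<in> {t<..b}"
    \<comment> \<open>The cutoff is a ramp: 1 while Q <= L, 0 once Q >= K. An indicator would
      destroy the continuity on which the integration theory rests.\<close>
    define cut where "cut = (\<lambda>r \<omega>. max 0 (min 1 ((K - Q r \<omega>) / (K - L))))"
    have cut01: "0 \<le> cut r \<omega>" "cut r \<omega> \<le> 1" for r \<omega> by (auto simp: cut_def)
    have cut1: "cut r \<omega> = 1" if "Q r \<omega> \<le> L" for r \<omega> using that KL by (simp add: cut_def)
    have cut0: "cut r \<omega> = 0" if "K \<le> Q r \<omega>" for r \<omega> using that KL by (simp add: cut_def divide_nonpos_pos)
    have cut: "drv.adapted_continuous t b cut" unfolding cut_def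
      by (rule drv.adapted_continuous_compose[OF Q]) (use KL in \<open>intro continuous_intros; simp\<close>)
    define h where "h = (\<lambda>i j r \<omega>. \<eta> i j r \<omega> * cut r \<omega>)"
    have \<eta>b: "drv.adapted_continuous t b (\<eta> i j)" for i j by (rule drv.adapted_continuous_subset[OF \<eta>]) (use b in auto)
    have sT: "0 \<le> t" "t < s" "s \<le> T" using s b t by auto
    have \<eta>s: "drv.adapted_continuous t s (\<eta> i j)" and hs: "drv.adapted_continuous t s (h i j)" for i j
      by (rule drv.adapted_continuous_subset[OF \<eta>b], use s in auto)
         (unfold h_def, rule drv.adapted_continuous_subset[OF drv.adapted_continuous_mult[OF \<eta>b cut]], use s in auto)
    have fin\<eta>: "drv.mean_power 2 t s (\<eta> i j) < \<infinity>" for i j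
      using drv.mean_power_subset[of s b 2 t "\<eta> i j"] fin[of i j] s by (auto intro: le_less_trans)
    have finh: "drv.mean_power 2 t s (h i j) < \<infinity>" for i j
    proof (rule le_less_trans[OF drv.mean_power_mono fin\<eta>])
      fix r \<omega>
      have "\<bar>h i j r \<omega>\<bar> \<le> \<bar>\<eta> i j r \<omega>\<bar>" unfolding h_def abs_mult using cut01[of r \<omega>] by (simp add: mult_left_le)
      then show "h i j r \<omega> ^ 2 \<le> \<eta> i j r \<omega> ^ 2" by (simp add: abs_le_square_iff)
    qed
    define Y where "Y = (\<lambda>i j. ito_integral M F (B j) t s (h i j))"
    have Y: "is_ito_integral M F (B j) t s (h i j) (Y i j)" for i j
      unfolding Y_def by (rule drv.is_ito_integral_ito_integral[OF hs sT finh])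
    have I: "is_ito_integral M F (B j) t s (\<eta> i j) (ito_integral M F (B j) t s (\<eta> i j))" for i j
      by (rule drv.is_ito_integral_ito_integral[OF \<eta>s sT fin\<eta>])
    have Ym[measurable]: "Y i j \<in> borel_measurable M" for i j using Y by (simp add: is_ito_integral_def)
    define R where "R = (\<lambda>\<omega>. \<integral>\<^sup>+r\<in>{t..s}. ennreal (N r \<omega>) * indicator {\<omega>. Q r \<omega> < K} \<omega> \<partial>lborel)"
    have Rm[measurable]: "R \<in> borel_measurable M"
    proof -
      have "case_prod (\<lambda>\<omega> r. ennreal (N r \<omega>) * indicator {\<omega>. Q r \<omega> < K} \<omega> * indicator {t..s} r) \<in> borel_measurable (M \<Otimes>\<^sub>M lborel)"
        using drv.cutoff_pair_measurable[OF N, of s K] s by (simp add: case_prod_beta' Q_def)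
      from lborel.borel_measurable_nn_integral[OF this] show ?thesis unfolding R_def .
    qed
    have "AE \<omega> in M. \<forall>i\<in>UNIV. U i s \<omega> = u i + (LINT r:{t..s}|lborel. \<alpha> i r \<omega>) + (\<Sum>j\<in>UNIV. ito_integral M F (B j) t s (\<eta> i j) \<omega>)"
      by (rule AE_finite_allI) (use equation sT in auto)
    moreover have "AE \<omega> in M. \<forall>i\<in>UNIV. \<forall>j\<in>UNIV. (\<forall>r\<in>{t..s}. \<eta> i j r \<omega> = h i j r \<omega>) \<longrightarrow> ito_integral M F (B j) t s (\<eta> i j) \<omega> = Y i j \<omega>"
      by (intro AE_finite_allI finite_UNIV drv.ito_integral_local[OF \<eta>s hs sT I Y]) auto
    ultimately have ae: "AE \<omega> in M. ennreal (N s \<omega>) * indicator {\<omega>. Q s \<omega> \<le> L} \<omega> \<le>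
       ennreal (initial 4) + ennreal (drift_rate 4) * R \<omega> + (\<Sum>i\<in>UNIV. \<Sum>j\<in>UNIV. ennreal (noise_factor 4) * ennreal (Y i j \<omega> ^ 4))"
      using AE_space
    proof eventually_elim
      case (elim \<omega>)
      show ?case
      proof (cases "Q s \<omega> \<le> L")
        case True
        \<comment> \<open>Since Q is nondecreasing, Q s <= L keeps the ramp at 1 on all of [t, s].
          Locality then replaces the integral of the equation by the truncated one on this
          event.\<close>
        have Qr: "Q r \<omega> \<le> L" if "r \<le> s" for r using Qmono[of r s \<omega>] that s elim(3) True by auto
        have hI: "ito_integral M F (B j) t s (\<eta> i j) \<omega> = Y i j \<omega>" for i j
          using elim(2) Qr cut1 by (simp add: h_def)
        have "ennreal (npow 4 s \<omega>) \<le> ennreal (initial 4) + ennreal (drift_rate 4) * (\<integral>\<^sup>+r\<in>{t..s}. ennreal (npow 4 r \<omega>) \<partial>lborel)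
          + (\<Sum>i\<in>UNIV. \<Sum>j\<in>UNIV. ennreal (noise_factor 4) * ennreal (Y i j \<omega> ^ 4))"
          by (rule npow_pointwise) (use sT elim hI in auto)
        also have "(\<integral>\<^sup>+r\<in>{t..s}. ennreal (npow 4 r \<omega>) \<partial>lborel) = R \<omega>"
          unfolding R_def N_def[symmetric]
        proof (rule nn_integral_cong)
          fix r
          show "ennreal (N r \<omega>) * indicator {t..s} r = ennreal (N r \<omega>) * indicator {\<omega>. Q r \<omega> < K} \<omega> * indicator {t..s} r"
            using Qr[of r] KL by (auto simp: indicator_def)
        qed
        finally show ?thesis using True by (simp add: N_def)
      qed simp
    qed
    have EY: "(\<integral>\<^sup>+\<omega>. ennreal (Y i j \<omega> ^ 4) \<partial>M) \<le> ennreal (36 * T * growth 4) * (\<integral>\<^sup>+\<omega>. R \<omega> \<partial>M)" for i j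
    proof -
      have "(\<integral>\<^sup>+\<omega>. ennreal (Y i j \<omega> ^ 4) \<partial>M) \<le> ennreal (36 * (s - t)) * drv.mean_power 4 t s (h i j)"
        by (rule drv.ito_fourth_moment[OF hs sT Y])
      also have "\<dots> \<le> ennreal (36 * T) * drv.mean_power 4 t s (h i j)"
        using sT by (intro mult_right_mono ennreal_leI) auto
      also have "drv.mean_power 4 t s (h i j) \<le> (\<integral>\<^sup>+\<omega>. ennreal (growth 4) * R \<omega> \<partial>M)"
        unfolding drv.mean_power_def
      proof (rule nn_integral_mono)
        fix \<omega> assume \<omega>: "\<omega> \<in> space M"
        have "(\<integral>\<^sup>+r\<in>{t..s}. ennreal (h i j r \<omega> ^ 4) \<partial>lborel) \<le> (\<integral>\<^sup>+r. ennreal (growth 4) * (ennreal (N r \<omega>) * indicator {\<omega>. Q r \<omega> < K} \<omega> * indicator {t..s} r) \<partial>lborel)"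
        proof (rule nn_integral_mono)
          fix r
          show "ennreal (h i j r \<omega> ^ 4) * indicator {t..s} r \<le> ennreal (growth 4) * (ennreal (N r \<omega>) * indicator {\<omega>. Q r \<omega> < K} \<omega> * indicator {t..s} r)"
          proof (cases "r \<in> {t..s} \<and> Q r \<omega> < K")
            case True
            then have rT: "r \<in> {t..T}" using sT by auto
            have "h i j r \<omega> ^ 4 = \<eta> i j r \<omega> ^ 4 * cut r \<omega> ^ 4" by (simp add: h_def power_mult_distrib)
            also have "\<dots> \<le> \<eta> i j r \<omega> ^ 4" using cut01[of r \<omega>] by (simp add: mult_left_le power_le_one)
            also have "\<dots> \<le> growth 4 * N r \<omega>"
              unfolding N_def by (rule coefficient_power_le[OF \<eta>_growth[OF rT \<omega>]]) simp
            finally have "ennreal (h i j r \<omega> ^ 4) \<le> ennreal (growth 4 * N r \<omega>)" by (rule ennreal_leI)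
            then show ?thesis using True growth_pos[of 4] by (simp add: ennreal_mult')
          next
            case False
            then show ?thesis using cut0[of r \<omega>] by (auto simp: h_def)
          qed
        qed
        also have "\<dots> = ennreal (growth 4) * R \<omega>"
        proof -
          have [measurable]: "(\<lambda>r. ennreal (N r \<omega>) * indicator {\<omega>. Q r \<omega> < K} \<omega> * indicator {t..s} r) \<in> borel_measurable lborel"
            using measurable_compose[OF measurable_Pair1'[OF \<omega>] drv.cutoff_pair_measurable[OF N, of s K]] s by (simp add: Q_def)
          show ?thesis unfolding R_def by (rule nn_integral_cmult) measurable
        qed
        finally show "(\<integral>\<^sup>+r\<in>{t..s}. ennreal (h i j r \<omega> ^ 4) \<partial>lborel) \<le> ennreal (growth 4) * R \<omega>" .
      qed
      also have "(\<integral>\<^sup>+\<omega>. ennreal (growth 4) * R \<omega> \<partial>M) = ennreal (growth 4) * (\<integral>\<^sup>+\<omega>. R \<omega> \<partial>M)"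
        by (rule nn_integral_cmult) measurable
      finally show ?thesis using T_pos by (simp add: ennreal_mult' mult.assoc mult_left_mono)
    qed
    have "(\<integral>\<^sup>+\<omega>. ennreal (N s \<omega>) * indicator {\<omega>. Q s \<omega> \<le> L} \<omega> \<partial>M) \<le>
      (\<integral>\<^sup>+\<omega>. ennreal (initial 4) + ennreal (drift_rate 4) * R \<omega> + (\<Sum>i\<in>UNIV. \<Sum>j\<in>UNIV. ennreal (noise_factor 4) * ennreal (Y i j \<omega> ^ 4)) \<partial>M)"
      by (rule nn_integral_mono_AE[OF ae])
    also have "\<dots> = ennreal (initial 4) + ennreal (drift_rate 4) * (\<integral>\<^sup>+\<omega>. R \<omega> \<partial>M) + (\<Sum>i\<in>UNIV. \<Sum>j\<in>UNIV. ennreal (noise_factor 4) * (\<integral>\<^sup>+\<omega>. ennreal (Y i j \<omega> ^ 4) \<partial>M))"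
      by (simp add: nn_integral_add nn_integral_cmult nn_integral_sum drv.emeasure_space_1)
    also have "\<dots> \<le> ennreal (initial 4) + ennreal (drift_rate 4) * (\<integral>\<^sup>+\<omega>. R \<omega> \<partial>M) + (\<Sum>i\<in>(UNIV::'i set). \<Sum>j\<in>(UNIV::'j set). ennreal (noise_factor 4) * (ennreal (36 * T * growth 4) * (\<integral>\<^sup>+\<omega>. R \<omega> \<partial>M)))"
      by (intro add_left_mono sum_mono mult_left_mono EY) simp
    also have "\<dots> = ennreal (initial 4) + (ennreal (drift_rate 4) + ennreal (real CARD('i)) * ennreal (real CARD('j)) * ennreal (noise_factor 4) * ennreal (36 * T * growth 4)) * (\<integral>\<^sup>+\<omega>. R \<omega> \<partial>M)"
      by (simp add: distrib_right mult.assoc ennreal_of_nat_eq_real_of_nat add.assoc)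
    also have "ennreal (drift_rate 4) + ennreal (real CARD('i)) * ennreal (real CARD('j)) * ennreal (noise_factor 4) * ennreal (36 * T * growth 4) = ennreal rate4"
    proof -
      have "ennreal rate4 = ennreal (drift_rate 4) + ennreal (real CARD('i) * real CARD('j) * noise_factor 4 * (36 * T * growth 4))"
        unfolding rate4_def mult.assoc using drift_rate_pos[of 4] noise_factor_pos[of 4] growth_pos[of 4] T_pos
        by (intro ennreal_plus) auto
      then show ?thesis using noise_factor_pos[of 4] by (simp add: ennreal_mult' mult.assoc)
    qed
    finally show "(\<integral>\<^sup>+\<omega>. ennreal (N s \<omega>) * indicator {\<omega>. (LINT q:{t..s}|lborel. N q \<omega>) \<le> L} \<omega> \<partial>M) \<le> ennreal (initial 4) + ennreal rate4 *
        (\<integral>\<^sup>+\<omega>. (\<integral>\<^sup>+r\<in>{t..s}. ennreal (N r \<omega>) * indicator {\<omega>. (LINT q:{t..r}|lborel. N q \<omega>) < K} \<omega> \<partial>lborel) \<partial>M)"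
      by (simp add: R_def Q_def)
  qed
  also have "\<dots> \<le> ennreal bound4"
    unfolding bound4_def using s b t rate4_pos initial_ge_1[of 4] by (intro ennreal_leI) auto
  finally show ?thesis by (simp add: N_def)
qed

end

lemma (in ito_driver) mean_power_1_cmult:
  assumes H: "adapted_continuous a b H" and "0 \<le> c"
  shows "mean_power 1 a b (\<lambda>r \<omega>. c * H r \<omega>) = ennreal c * mean_power 1 a b H"
proof -
  have "mean_power 1 a b (\<lambda>r \<omega>. c * H r \<omega>) = (\<integral>\<^sup>+\<omega>. ennreal c * (\<integral>\<^sup>+r\<in>{a..b}. ennreal (H r \<omega> ^ 1) \<partial>lborel) \<partial>M)"
    unfolding mean_power_def
  proof (rule nn_integral_cong)
    fix \<omega> assume \<omega>: "\<omega> \<in> space M"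
    have "(\<lambda>r. indicator {a..b} r * H r \<omega>) \<in> borel_measurable borel"
      using borel_integrable_atLeastAtMost'[OF adapted_continuousD(3)[OF H \<omega>]] by (auto simp: set_integrable_def dest: borel_measurable_integrable)
    then have "(\<lambda>r. ennreal (indicator {a..b} r * H r \<omega>)) \<in> borel_measurable lborel" by measurable
    also have "(\<lambda>r. ennreal (indicator {a..b} r * H r \<omega>)) = (\<lambda>r. ennreal (H r \<omega> ^ 1) * indicator {a..b} r)"
      by (auto simp: indicator_def)
    finally have [measurable]: "(\<lambda>r. ennreal (H r \<omega> ^ 1) * indicator {a..b} r) \<in> borel_measurable lborel" .
    have "(\<integral>\<^sup>+r\<in>{a..b}. ennreal ((c * H r \<omega>) ^ 1) \<partial>lborel) = (\<integral>\<^sup>+r. ennreal c * (ennreal (H r \<omega> ^ 1) * indicator {a..b} r) \<partial>lborel)"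
      using \<open>0 \<le> c\<close> by (intro nn_integral_cong) (simp add: ennreal_mult' mult.assoc)
    also have "\<dots> = ennreal c * (\<integral>\<^sup>+r\<in>{a..b}. ennreal (H r \<omega> ^ 1) \<partial>lborel)" by (rule nn_integral_cmult) measurable
    finally show "(\<integral>\<^sup>+r\<in>{a..b}. ennreal ((c * H r \<omega>) ^ 1) \<partial>lborel) = ennreal c * (\<integral>\<^sup>+r\<in>{a..b}. ennreal (H r \<omega> ^ 1) \<partial>lborel)" .
  qed
  also have "\<dots> = ennreal c * mean_power 1 a b H"
    unfolding mean_power_def by (rule nn_integral_cmult[OF adapted_continuous_path_power_measurable[OF H]])
  finally show ?thesis .
qed

section \<open>Square integrability of the coefficients by continuation in time\<close>

context linear_growth_sde
begin

abbreviation energy :: "real \<Rightarrow> ennreal" where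
  "energy s \<equiv> drv.mean_power 1 t s (npow 2)"

definition bound2 :: real where
  "bound2 = real CARD('i) + bound4"

lemma \<eta>_mean_power_finite:
  assumes s: "s \<le> T" and fin: "energy s < \<infinity>"
  shows "drv.mean_power 2 t s (\<eta> i j) < \<infinity>"
proof -
  have N: "drv.adapted_continuous t s (npow 2)" by (rule drv.adapted_continuous_subset[OF npow_adapted]) (use s in auto)
  have "drv.mean_power 2 t s (\<eta> i j) \<le> drv.mean_power 1 t s (\<lambda>r \<omega>. growth 2 * npow 2 r \<omega>)"
  proof (rule drv.mean_power_mono)
    fix r \<omega> assume "r \<in> {t..s}" "\<omega> \<in> space M"
    then show "\<eta> i j r \<omega> ^ 2 \<le> (growth 2 * npow 2 r \<omega>) ^ 1"
      using coefficient_power_le[OF \<eta>_growth, of r \<omega> 2 i j] s by simp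
  qed
  also have "\<dots> = ennreal (growth 2) * energy s"
    by (rule drv.mean_power_1_cmult[OF N]) (use growth_pos[of 2] in simp)
  also have "\<dots> < \<infinity>" using fin by (simp add: ennreal_mult_less_top)
  finally show ?thesis .
qed

text \<open>Mere finiteness of the energy up to s is upgraded to a bound that does not depend on s:
  the fourth moment estimate becomes available, and x^2 <= 1 + x^4. This makes the set of times with
  finite energy closed.\<close>

lemma npow2_bound:
  assumes s: "s \<le> T" and fin: "energy s < \<infinity>" and r: "r \<in> {t<..s}"
  shows "(\<integral>\<^sup>+\<omega>. ennreal (npow 2 r \<omega>) \<partial>M) \<le> ennreal bound2"
proof -
  have [measurable]: "npow 4 r \<in> borel_measurable M" using drv.adapted_continuousD(2)[OF npow_adapted] s r by auto
  have "(\<integral>\<^sup>+\<omega>. ennreal (npow 2 r \<omega>) \<partial>M) \<le> (\<integral>\<^sup>+\<omega>. ennreal (real CARD('i)) + ennreal (npow 4 r \<omega>) \<partial>M)"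
  proof (rule nn_integral_mono)
    fix \<omega>
    have "(\<Sum>k\<in>UNIV. (U k r \<omega>)\<^sup>2) \<le> (\<Sum>k\<in>UNIV. 1 + U k r \<omega> ^ 4)" by (intro sum_mono power2_le_one_plus_power4)
    then have "npow 2 r \<omega> \<le> real CARD('i) + npow 4 r \<omega>" by (simp add: npow_def sum.distrib)
    then have "ennreal (npow 2 r \<omega>) \<le> ennreal (real CARD('i) + npow 4 r \<omega>)" by (rule ennreal_leI)
    also have "\<dots> = ennreal (real CARD('i)) + ennreal (npow 4 r \<omega>)"
      using npow_ge_1[of 4 r \<omega>] by (intro ennreal_plus) auto
    finally show "ennreal (npow 2 r \<omega>) \<le> ennreal (real CARD('i)) + ennreal (npow 4 r \<omega>)" .
  qed
  also have "\<dots> = ennreal (real CARD('i)) + (\<integral>\<^sup>+\<omega>. ennreal (npow 4 r \<omega>) \<partial>M)"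
    by (subst nn_integral_add) (auto simp: drv.emeasure_space_1)
  also have "\<dots> \<le> ennreal (real CARD('i)) + ennreal bound4"
    by (intro add_left_mono fourth_moment_bound[of s]) (use s r \<eta>_mean_power_finite[OF s fin] in auto)
  also have "\<dots> = ennreal bound2" unfolding bound2_def using bound4_pos by (intro ennreal_plus[symmetric]) auto
  finally show ?thesis .
qed

lemma bound2_pos: "bound2 > 0" using bound4_pos by (simp add: bound2_def add_nonneg_pos)

lemma ito_second_moment_finite:
  assumes s: "t \<le> s" "s \<le> T" and fin: "energy s < \<infinity>"
  shows "(\<integral>\<^sup>+\<omega>. ennreal (ito_integral M F (B j) t s (\<eta> i j) \<omega> ^ 2) \<partial>M) < \<infinity>"
proof (cases "s = t")
  case True
  have "(\<integral>\<^sup>+\<omega>. ennreal (ito_integral M F (B j) t s (\<eta> i j) \<omega> ^ 2) \<partial>M) = (\<integral>\<^sup>+\<omega>. 0 \<partial>M)"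
    unfolding True by (rule nn_integral_cong_AE) (use drv.ito_integral_degenerate in \<open>auto elim: eventually_mono\<close>)
  then show ?thesis by simp
next
  case False
  have H: "drv.adapted_continuous t s (\<eta> i j)" by (rule drv.adapted_continuous_subset[OF \<eta>]) (use s in auto)
  have ts: "0 \<le> t" "t < s" "s \<le> T" using False s t by auto
  note fin2 = \<eta>_mean_power_finite[OF s(2) fin]
  show ?thesis
    by (rule le_less_trans[OF drv.ito_second_moment[OF H ts drv.is_ito_integral_ito_integral[OF H ts fin2]] fin2])
qed

text \<open>A stochastic integral that does not exist has one and the same unspecified value,
  \<open>SOME Y. False\<close>, whatever its integrand and interval.  Path continuity at \<open>\<sigma>\<close> forces this value to be
  square integrable as soon as it occurs in the equation just to the right of \<open>\<sigma>\<close>.\<close>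

lemma junk_value_square_integrable:
  fixes c :: "'w \<Rightarrow> real"
  assumes \<sigma>: "t \<le> \<sigma>" "\<sigma> < s1" "s1 \<le> T" and fin: "energy \<sigma> < \<infinity>"
    and junk: "j0 \<in> J" "\<And>j s. j \<in> J \<Longrightarrow> s \<in> {\<sigma><..s1} \<Longrightarrow> ito_integral M F (B j) t s (\<eta> i j) = c"
    and good: "\<And>j s. j \<notin> J \<Longrightarrow> s \<in> {\<sigma><..s1} \<Longrightarrow> is_ito_integral M F (B j) t s (\<eta> i j) (ito_integral M F (B j) t s (\<eta> i j))"
  shows "\<exists>Cc. Cc \<in> borel_measurable M \<and> (\<integral>\<^sup>+\<omega>. Cc \<omega> \<partial>M) < \<infinity> \<and> (AE \<omega> in M. ennreal ((c \<omega>)\<^sup>2) \<le> Cc \<omega>)"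
proof -
  \<comment> \<open>A sequence of times decreasing to \<sigma>, inside the range where each integral
    either exists or equals \<open>c\<close>.\<close>
  define s where "s = (\<lambda>k::nat. \<sigma> + (s1 - \<sigma>) / real (Suc k))"
  have s: "s k \<in> {\<sigma><..s1}" for k
  proof -
    have "(s1 - \<sigma>) / real (Suc k) \<le> (s1 - \<sigma>) / 1" using \<sigma> by (intro divide_left_mono) auto
    moreover have "(s1 - \<sigma>) / real (Suc k) > 0" using \<sigma> by simp
    ultimately show ?thesis unfolding s_def by simp
  qed
  have sT: "s k \<in> {t..T}" for k using s[of k] \<sigma> by auto
  have slim: "s \<longlonglongrightarrow> \<sigma>"
  proof -
    have "(\<lambda>k. (s1 - \<sigma>) * (1 / real (Suc k))) \<longlonglongrightarrow> (s1 - \<sigma>) * 0"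
      by (intro tendsto_mult tendsto_const LIMSEQ_Suc[OF lim_1_over_n])
    then have "(\<lambda>k. \<sigma> + (s1 - \<sigma>) * (1 / real (Suc k))) \<longlonglongrightarrow> \<sigma> + (s1 - \<sigma>) * 0" by (intro tendsto_add tendsto_const)
    then show ?thesis by (simp add: s_def[abs_def])
  qed
  have \<sigma>T: "\<sigma> \<in> {t..T}" using \<sigma> by auto
  \<comment> \<open>By the equation, \<open>E\<close> is the sum of the stochastic integrals, yet it
    is expressed by continuous processes and so has a limit at \<sigma>. There the integrals are
    genuine, because the energy is finite, and \<open>E\<close> is square integrable.\<close>
  define E where "E = (\<lambda>r \<omega>. U i r \<omega> - u i - (LINT q:{t..r}|lborel. \<alpha> i q \<omega>))"
  note A = drv.adapted_continuous_path_integral[OF \<alpha>, of i]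
  have Em[measurable]: "E \<sigma> \<in> borel_measurable M"
    unfolding E_def using drv.adapted_continuousD(2)[OF U \<sigma>T, of i] drv.adapted_continuousD(2)[OF A \<sigma>T] by measurable
  have Elim: "(\<lambda>k. E (s k) \<omega>) \<longlonglongrightarrow> E \<sigma> \<omega>" if "\<omega> \<in> space M" for \<omega>
    unfolding E_def
    by (intro tendsto_diff tendsto_const continuous_on_tendsto_compose[OF drv.adapted_continuousD(3)[OF U that] slim \<sigma>T]
        continuous_on_tendsto_compose[OF drv.adapted_continuousD(3)[OF A that] slim \<sigma>T] always_eventually allI sT)
  define V where "V = (\<lambda>k \<omega>. \<Sum>j\<in>-J. ito_integral M F (B j) t (s k) (\<eta> i j) \<omega>)"
  have gm: "ito_integral M F (B j) t (s k) (\<eta> i j) \<in> borel_measurable M" if "j \<notin> J" for j k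
    using good[OF that s] by (simp add: is_ito_integral_def)
  have Vm[measurable]: "V k \<in> borel_measurable M" for k
    unfolding V_def by (intro borel_measurable_sum gm) auto
  \<comment> \<open>At time \<open>s k\<close> the sum \<open>E\<close> equals \<open>card J\<close>
    times \<open>c\<close> plus \<open>V k\<close>, and \<open>J\<close> is nonempty, so c^2 <= 2
    E^2 + 2 V^2. Pathwise, \<open>E\<close> converges and the 1 absorbs the difference; for
    \<open>V k\<close> only second moments are bounded, uniformly in k, so a liminf is taken and
    Fatou bounds its integral. The liminf is a measurable majorant, since measurability of the
    unspecified \<open>c\<close> is not known beforehand.\<close>
  define Cc where "Cc = (\<lambda>\<omega>. liminf (\<lambda>k. ennreal (2 * ((E \<sigma> \<omega>)\<^sup>2 + 1)) + ennreal (2 * (V k \<omega>)\<^sup>2)))"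
  have sq: "((\<Sum>j\<in>S. x j)::real)\<^sup>2 \<le> real CARD('j) * (\<Sum>j\<in>S. (x j)\<^sup>2)" for S :: "'j set" and x
  proof -
    have "(\<Sum>j\<in>S. x j)\<^sup>2 \<le> real (card S) * (\<Sum>j\<in>S. (x j)\<^sup>2)" using sum_power_le[of S 2 x] by simp
    also have "\<dots> \<le> real CARD('j) * (\<Sum>j\<in>S. (x j)\<^sup>2)" by (intro mult_right_mono sum_nonneg) (auto intro: card_mono)
    finally show ?thesis .
  qed
  have sqe: "(\<integral>\<^sup>+\<omega>. ennreal ((\<Sum>j\<in>S. x j \<omega>)\<^sup>2) \<partial>M) \<le> ennreal (real CARD('j)) * (\<Sum>j\<in>S. \<integral>\<^sup>+\<omega>. ennreal ((x j \<omega>)\<^sup>2) \<partial>M)"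
    if [measurable]: "\<And>j. j \<in> S \<Longrightarrow> x j \<in> borel_measurable M" for S :: "'j set" and x :: "'j \<Rightarrow> 'w \<Rightarrow> real"
  proof -
    have "(\<integral>\<^sup>+\<omega>. ennreal ((\<Sum>j\<in>S. x j \<omega>)\<^sup>2) \<partial>M) \<le> (\<integral>\<^sup>+\<omega>. ennreal (real CARD('j)) * (\<Sum>j\<in>S. ennreal ((x j \<omega>)\<^sup>2)) \<partial>M)"
    proof (rule nn_integral_mono)
      fix \<omega>
      have "ennreal ((\<Sum>j\<in>S. x j \<omega>)\<^sup>2) \<le> ennreal (real CARD('j) * (\<Sum>j\<in>S. (x j \<omega>)\<^sup>2))" by (rule ennreal_leI[OF sq])
      then show "ennreal ((\<Sum>j\<in>S. x j \<omega>)\<^sup>2) \<le> ennreal (real CARD('j)) * (\<Sum>j\<in>S. ennreal ((x j \<omega>)\<^sup>2))"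
        by (simp add: ennreal_mult' sum_ennreal)
    qed
    also have "\<dots> = ennreal (real CARD('j)) * (\<Sum>j\<in>S. \<integral>\<^sup>+\<omega>. ennreal ((x j \<omega>)\<^sup>2) \<partial>M)"
      by (simp add: nn_integral_cmult nn_integral_sum del: sum_ennreal)
    finally show ?thesis .
  qed
  have E_fin: "(\<integral>\<^sup>+\<omega>. ennreal ((E \<sigma> \<omega>)\<^sup>2) \<partial>M) < \<infinity>"
  proof -
    have im: "\<exists>Y\<in>borel_measurable M. AE \<omega> in M. ito_integral M F (B j) t \<sigma> (\<eta> i j) \<omega> = Y \<omega>" for j
    proof (cases "\<sigma> = t")
      case True then show ?thesis using drv.ito_integral_degenerate by (intro bexI[of _ "\<lambda>_. 0"]) auto
    next
      case False
      have "drv.adapted_continuous t \<sigma> (\<eta> i j)" by (rule drv.adapted_continuous_subset[OF \<eta>]) (use \<sigma> in auto)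
      from drv.is_ito_integral_ito_integral[OF this t(1) _ _ \<eta>_mean_power_finite[OF _ fin]]
      have "is_ito_integral M F (B j) t \<sigma> (\<eta> i j) (ito_integral M F (B j) t \<sigma> (\<eta> i j))" using False \<sigma> by auto
      then show ?thesis by (auto simp: is_ito_integral_def)
    qed
    then obtain Y where Y[measurable]: "\<And>j. Y j \<in> borel_measurable M" and Yae: "\<And>j. AE \<omega> in M. ito_integral M F (B j) t \<sigma> (\<eta> i j) \<omega> = Y j \<omega>"
      by metis
    have Yall: "AE \<omega> in M. \<forall>j\<in>UNIV. ito_integral M F (B j) t \<sigma> (\<eta> i j) \<omega> = Y j \<omega>"
      by (rule AE_finite_allI) (use Yae in auto)
    have "AE \<omega> in M. E \<sigma> \<omega> = (\<Sum>j\<in>UNIV. Y j \<omega>)"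
      using equation[OF \<sigma>T, of i] Yall by eventually_elim (simp add: E_def)
    then have "(\<integral>\<^sup>+\<omega>. ennreal ((E \<sigma> \<omega>)\<^sup>2) \<partial>M) = (\<integral>\<^sup>+\<omega>. ennreal ((\<Sum>j\<in>UNIV. Y j \<omega>)\<^sup>2) \<partial>M)"
      by (intro nn_integral_cong_AE) (auto elim: eventually_mono)
    also have "\<dots> \<le> ennreal (real CARD('j)) * (\<Sum>j\<in>UNIV. \<integral>\<^sup>+\<omega>. ennreal ((Y j \<omega>)\<^sup>2) \<partial>M)" by (rule sqe) measurable
    also have "(\<Sum>j\<in>UNIV. \<integral>\<^sup>+\<omega>. ennreal ((Y j \<omega>)\<^sup>2) \<partial>M) = (\<Sum>j\<in>UNIV. \<integral>\<^sup>+\<omega>. ennreal (ito_integral M F (B j) t \<sigma> (\<eta> i j) \<omega> ^ 2) \<partial>M)"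
    proof (intro sum.cong refl nn_integral_cong_AE)
      fix j
      show "AE \<omega> in M. ennreal ((Y j \<omega>)\<^sup>2) = ennreal (ito_integral M F (B j) t \<sigma> (\<eta> i j) \<omega> ^ 2)"
        using Yae[of j] by eventually_elim simp
    qed
    also have "ennreal (real CARD('j)) * \<dots> < \<infinity>"
      using ito_second_moment_finite[OF \<sigma>(1) _ fin, of _ i] \<sigma> by (simp add: ennreal_mult_less_top)
    finally show ?thesis .
  qed
  define v where "v = ennreal (real CARD('j)) * (\<Sum>j\<in>-J. drv.mean_power 2 t s1 (\<eta> i j))"
  have v: "v < \<infinity>"
  proof -
    have "drv.mean_power 2 t s1 (\<eta> i j) < \<infinity>" if "j \<notin> J" for j
      by (rule drv.is_ito_integral_finite[OF _ t(1) \<sigma>(3) good[OF that]])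
         (use \<sigma> in \<open>auto intro: drv.adapted_continuous_subset[OF \<eta>]\<close>)
    then show ?thesis unfolding v_def by (simp add: ennreal_mult_less_top)
  qed
  have V_le: "(\<integral>\<^sup>+\<omega>. ennreal ((V k \<omega>)\<^sup>2) \<partial>M) \<le> v" for k
  proof -
    have "(\<integral>\<^sup>+\<omega>. ennreal ((V k \<omega>)\<^sup>2) \<partial>M) \<le> ennreal (real CARD('j)) * (\<Sum>j\<in>-J. \<integral>\<^sup>+\<omega>. ennreal ((ito_integral M F (B j) t (s k) (\<eta> i j) \<omega>)\<^sup>2) \<partial>M)"
      unfolding V_def by (rule sqe) (use gm in auto)
    also have "\<dots> \<le> v" unfolding v_def
    proof (intro mult_left_mono sum_mono)
      fix j assume "j \<in> -J"
      then have j: "j \<notin> J" by simp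
      have H: "drv.adapted_continuous t (s k) (\<eta> i j)" by (rule drv.adapted_continuous_subset[OF \<eta>]) (use sT[of k] in auto)
      have "(\<integral>\<^sup>+\<omega>. ennreal ((ito_integral M F (B j) t (s k) (\<eta> i j) \<omega>)\<^sup>2) \<partial>M) \<le> drv.mean_power 2 t (s k) (\<eta> i j)"
        by (rule drv.ito_second_moment[OF H t(1) _ _ good[OF j s]]) (use s[of k] sT[of k] \<sigma> in auto)
      also have "\<dots> \<le> drv.mean_power 2 t s1 (\<eta> i j)" by (rule drv.mean_power_subset) (use s[of k] in auto)
      finally show "(\<integral>\<^sup>+\<omega>. ennreal ((ito_integral M F (B j) t (s k) (\<eta> i j) \<omega>)\<^sup>2) \<partial>M) \<le> drv.mean_power 2 t s1 (\<eta> i j)" .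
    qed simp
    finally show ?thesis .
  qed
  show ?thesis
  proof (intro exI[of _ Cc] conjI)
    show "Cc \<in> borel_measurable M" unfolding Cc_def by measurable
    have E2: "(\<integral>\<^sup>+\<omega>. ennreal (2 * ((E \<sigma> \<omega>)\<^sup>2 + 1)) \<partial>M) = 2 * (\<integral>\<^sup>+\<omega>. ennreal ((E \<sigma> \<omega>)\<^sup>2) \<partial>M) + 2"
      by (simp add: ennreal_mult' nn_integral_add nn_integral_cmult drv.emeasure_space_1 distrib_left)
    have "(\<integral>\<^sup>+\<omega>. Cc \<omega> \<partial>M) \<le> liminf (\<lambda>k. \<integral>\<^sup>+\<omega>. ennreal (2 * ((E \<sigma> \<omega>)\<^sup>2 + 1)) + ennreal (2 * (V k \<omega>)\<^sup>2) \<partial>M)"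
      unfolding Cc_def by (rule nn_integral_liminf) measurable
    also have "\<dots> \<le> limsup (\<lambda>k. \<integral>\<^sup>+\<omega>. ennreal (2 * ((E \<sigma> \<omega>)\<^sup>2 + 1)) + ennreal (2 * (V k \<omega>)\<^sup>2) \<partial>M)"
      by (rule Liminf_le_Limsup) simp
    also have "\<dots> \<le> (2 * (\<integral>\<^sup>+\<omega>. ennreal ((E \<sigma> \<omega>)\<^sup>2) \<partial>M) + 2) + 2 * v"
    proof (rule Limsup_bounded, rule always_eventually, rule allI)
      fix k
      have "(\<integral>\<^sup>+\<omega>. ennreal (2 * ((E \<sigma> \<omega>)\<^sup>2 + 1)) + ennreal (2 * (V k \<omega>)\<^sup>2) \<partial>M)
        = (2 * (\<integral>\<^sup>+\<omega>. ennreal ((E \<sigma> \<omega>)\<^sup>2) \<partial>M) + 2) + 2 * (\<integral>\<^sup>+\<omega>. ennreal ((V k \<omega>)\<^sup>2) \<partial>M)"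
        unfolding E2[symmetric] by (subst nn_integral_add) (auto simp: ennreal_mult' nn_integral_cmult)
      also have "\<dots> \<le> (2 * (\<integral>\<^sup>+\<omega>. ennreal ((E \<sigma> \<omega>)\<^sup>2) \<partial>M) + 2) + 2 * v"
        by (intro add_left_mono mult_left_mono V_le) simp
      finally show "(\<integral>\<^sup>+\<omega>. ennreal (2 * ((E \<sigma> \<omega>)\<^sup>2 + 1)) + ennreal (2 * (V k \<omega>)\<^sup>2) \<partial>M) \<le> (2 * (\<integral>\<^sup>+\<omega>. ennreal ((E \<sigma> \<omega>)\<^sup>2) \<partial>M) + 2) + 2 * v" .
    qed
    also have "\<dots> < \<infinity>" using E_fin v by (simp add: ennreal_mult_less_top)
    finally show "(\<integral>\<^sup>+\<omega>. Cc \<omega> \<partial>M) < \<infinity>" .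
    have "AE \<omega> in M. \<forall>k. U i (s k) \<omega> = u i + (LINT r:{t..s k}|lborel. \<alpha> i r \<omega>) + (\<Sum>j\<in>UNIV. ito_integral M F (B j) t (s k) (\<eta> i j) \<omega>)"
      unfolding AE_all_countable using equation[OF sT] by blast
    then show "AE \<omega> in M. ennreal ((c \<omega>)\<^sup>2) \<le> Cc \<omega>"
      using AE_space
    proof eventually_elim
      case (elim \<omega>)
      have card: "1 \<le> real (card J)" using junk(1) by (simp add: Suc_le_eq card_gt_0_iff) auto
      have Ek: "E (s k) \<omega> = real (card J) * c \<omega> + V k \<omega>" for k
      proof -
        have "(\<Sum>j\<in>UNIV. ito_integral M F (B j) t (s k) (\<eta> i j) \<omega>) = (\<Sum>j\<in>J. ito_integral M F (B j) t (s k) (\<eta> i j) \<omega>) + V k \<omega>"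
          unfolding V_def by (subst sum.union_disjoint[symmetric]) auto
        also have "(\<Sum>j\<in>J. ito_integral M F (B j) t (s k) (\<eta> i j) \<omega>) = (\<Sum>j\<in>J. c \<omega>)"
          by (intro sum.cong refl) (simp add: junk(2)[OF _ s])
        finally show ?thesis using elim(1) by (simp add: E_def)
      qed
      have "(\<lambda>k. (E (s k) \<omega>)\<^sup>2) \<longlonglongrightarrow> (E \<sigma> \<omega>)\<^sup>2" by (intro tendsto_power Elim elim)
      then have "eventually (\<lambda>k. (E (s k) \<omega>)\<^sup>2 < (E \<sigma> \<omega>)\<^sup>2 + 1) sequentially" by (rule order_tendstoD) simp
      then have "eventually (\<lambda>k. ennreal ((c \<omega>)\<^sup>2) \<le> ennreal (2 * ((E \<sigma> \<omega>)\<^sup>2 + 1)) + ennreal (2 * (V k \<omega>)\<^sup>2)) sequentially"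
      proof eventually_elim
        case (elim k)
        have "1 * (c \<omega>)\<^sup>2 \<le> (real (card J))\<^sup>2 * (c \<omega>)\<^sup>2" using card by (intro mult_right_mono one_le_power) auto
        also have "\<dots> = (E (s k) \<omega> - V k \<omega>)\<^sup>2" unfolding Ek by (simp add: power_mult_distrib)
        also have "\<dots> \<le> 2 * (E (s k) \<omega> - 0)\<^sup>2 + 2 * (0 - V k \<omega>)\<^sup>2" by (rule power2_diff_triangle)
        also have "\<dots> \<le> 2 * ((E \<sigma> \<omega>)\<^sup>2 + 1) + 2 * (V k \<omega>)\<^sup>2" using elim by simp
        finally have "ennreal ((c \<omega>)\<^sup>2) \<le> ennreal (2 * ((E \<sigma> \<omega>)\<^sup>2 + 1) + 2 * (V k \<omega>)\<^sup>2)" by (intro ennreal_leI) simp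
        also have "\<dots> = ennreal (2 * ((E \<sigma> \<omega>)\<^sup>2 + 1)) + ennreal (2 * (V k \<omega>)\<^sup>2)" by (rule ennreal_plus) auto
        finally show ?case .
      qed
      then show ?case unfolding Cc_def by (rule Liminf_bounded)
    qed
  qed
qed

text \<open>The openness half of the continuation. There are finitely many index pairs, so one
  \<open>s1\<close> can be found such that each integral either exists at all times of the interval
  right of \<sigma> up to \<open>s1\<close> or at none of them. Either way its second moment there
  is bounded by a finite constant, and the second power inequality carries the energy beyond
  \<sigma>.\<close>

lemma energy_extends:
  assumes \<sigma>: "t \<le> \<sigma>" "\<sigma> < T" and fin: "energy \<sigma> < \<infinity>"
  shows "\<exists>s1\<in>{\<sigma><..T}. energy s1 < \<infinity>"
proof -
  define P where "P = (\<lambda>i j s. \<exists>Y. is_ito_integral M F (B j) t s (\<eta> i j) Y)"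
  have \<eta>s: "drv.adapted_continuous t s (\<eta> i j)" if "s \<le> T" for s i j
    by (rule drv.adapted_continuous_subset[OF \<eta>]) (use that in auto)
  have P_down: "P i j s" if P: "P i j s'" and s: "t < s" "s \<le> s'" "s' \<le> T" for i j s s'
  proof -
    from P obtain Y where "is_ito_integral M F (B j) t s' (\<eta> i j) Y" by (auto simp: P_def)
    then have "drv.mean_power 2 t s' (\<eta> i j) < \<infinity>" by (rule drv.is_ito_integral_finite[OF \<eta>s[OF s(3)] t(1) s(3)])
    then have "drv.mean_power 2 t s (\<eta> i j) < \<infinity>" using drv.mean_power_subset[OF s(2), of 2 t "\<eta> i j"] by (auto intro: le_less_trans)
    then show ?thesis unfolding P_def using drv.is_ito_integral_ito_integral[OF \<eta>s t(1) s(1), of i j] s by auto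
  qed
  \<comment> \<open>For each pair, a time after \<sigma> at which the integral exists, if there is
    one; existence passes down to shorter intervals. With T as default the minimum over all pairs
    lies after \<sigma>.\<close>
  define f where "f = (\<lambda>(i, j). if \<exists>s\<in>{\<sigma><..T}. P i j s then SOME s. s \<in> {\<sigma><..T} \<and> P i j s else T)"
  have f: "f (i, j) \<in> {\<sigma><..T} \<and> ((\<exists>s\<in>{\<sigma><..T}. P i j s) \<longrightarrow> P i j (f (i, j)))" for i j
  proof (cases "\<exists>s\<in>{\<sigma><..T}. P i j s")
    case True
    then have "\<exists>s. s \<in> {\<sigma><..T} \<and> P i j s" by blast
    from someI_ex[OF this] show ?thesis using True by (simp add: f_def)
  qed (use \<sigma> in \<open>auto simp: f_def\<close>)
  define s1 where "s1 = Min (range f)"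
  have s1_le: "s1 \<le> f (i, j)" for i j unfolding s1_def by (rule Min_le) auto
  have s1: "s1 \<in> {\<sigma><..T}"
  proof -
    have "s1 \<in> range f" unfolding s1_def by (rule Min_in) auto
    then obtain x where "s1 = f x" by blast
    then show ?thesis using f[of "fst x" "snd x"] by simp
  qed
  define c :: "'w \<Rightarrow> real" where "c = (SOME Y. False)"
  have bad: "ito_integral M F (B j) t s (\<eta> i j) = c" if "\<not> P i j s1" "s \<in> {\<sigma><..s1}" for i j s
  proof -
    have "\<not> P i j s"
    proof
      assume "P i j s"
      then have "P i j (f (i, j))" using f[of i j] that s1 by auto
      then have "P i j s1" by (rule P_down) (use s1 s1_le[of i j] f[of i j] \<sigma> in auto)
      with that show False by simp
    qed
    then have "is_ito_integral M F (B j) t s (\<eta> i j) = (\<lambda>Y. False)" by (auto simp: P_def)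
    then show ?thesis by (simp add: ito_integral_def c_def)
  qed
  have good: "is_ito_integral M F (B j) t s (\<eta> i j) (ito_integral M F (B j) t s (\<eta> i j))" if "P i j s1" "s \<in> {\<sigma><..s1}" for i j s
  proof -
    have "P i j s" by (rule P_down[OF that(1)]) (use that s1 \<sigma> in auto)
    then show ?thesis unfolding P_def ito_integral_def by (rule someI_ex)
  qed
  obtain Cc where Cc[measurable]: "Cc \<in> borel_measurable M" and Cfin: "(\<integral>\<^sup>+\<omega>. Cc \<omega> \<partial>M) < \<infinity>"
    and Cae: "\<And>i j. \<not> P i j s1 \<Longrightarrow> AE \<omega> in M. ennreal ((c \<omega>)\<^sup>2) \<le> Cc \<omega>"
  proof (cases "\<exists>i j. \<not> P i j s1")
    case True
    then obtain i0 j0 where ij: "\<not> P i0 j0 s1" by blast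
    have "\<exists>Cc. Cc \<in> borel_measurable M \<and> (\<integral>\<^sup>+\<omega>. Cc \<omega> \<partial>M) < \<infinity> \<and> (AE \<omega> in M. ennreal ((c \<omega>)\<^sup>2) \<le> Cc \<omega>)"
      by (rule junk_value_square_integrable[OF \<sigma>(1) _ _ fin, of s1 j0 "{j. \<not> P i0 j s1}" i0])
         (use s1 ij bad good in auto)
    then show ?thesis using that by blast
  next
    case False then show ?thesis using that[of "\<lambda>_. 0"] by auto
  qed
  \<comment> \<open>Bounds for the noise up to \<open>s1\<close>: the square integral of a
    coefficient whose integral exists, the mean of the majorant \<open>Cc\<close> otherwise. The
    noise therefore enters as a finite constant, and only the drift feeds Gronwall.\<close>
  define z where "z = (\<lambda>i j. if P i j s1 then drv.mean_power 2 t s1 (\<eta> i j) else (\<integral>\<^sup>+\<omega>. Cc \<omega> \<partial>M))"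
  have z: "z i j < \<infinity>" for i j
  proof (cases "P i j s1")
    case True
    then have "is_ito_integral M F (B j) t s1 (\<eta> i j) (ito_integral M F (B j) t s1 (\<eta> i j))" using s1 by (intro good) auto
    moreover have "s1 \<le> T" using s1 by simp
    ultimately have "drv.mean_power 2 t s1 (\<eta> i j) < \<infinity>" by (intro drv.is_ito_integral_finite[OF \<eta>s t(1)])
    then show ?thesis using True by (simp add: z_def)
  qed (use Cfin in \<open>simp add: z_def\<close>)
  define Ae where "Ae = ennreal (initial 2) + (\<Sum>i\<in>UNIV. \<Sum>j\<in>UNIV. ennreal (noise_factor 2) * z i j)"
  have "Ae < \<infinity>" unfolding Ae_def using z by (simp add: ennreal_mult_less_top)
  then obtain A0 where A0: "0 \<le> A0" "Ae = ennreal A0" by (cases Ae) auto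
  define A where "A = A0 + bound2"
  have A: "0 \<le> A" "Ae \<le> ennreal A" "ennreal bound2 \<le> ennreal A"
    using A0 bound2_pos by (auto simp: A_def intro!: ennreal_leI)
  define N where "N = npow 2"
  have N: "drv.adapted_continuous t s1 N" unfolding N_def
    by (rule drv.adapted_continuous_subset[OF npow_adapted]) (use s1 in auto)
  have N0: "0 \<le> N r \<omega>" for r \<omega> using npow_ge_1[of 2 r \<omega>] by (simp add: N_def)
  define Q where "Q = (\<lambda>r \<omega>. LINT q:{t..r}|lborel. N q \<omega>)"
  have Qmono: "Q r \<omega> \<le> Q s \<omega>" if "r \<le> s" "s \<le> s1" "\<omega> \<in> space M" for r s \<omega>
    unfolding Q_def by (rule set_lint_mono_upper[OF drv.adapted_continuousD(3)[OF N that(3)] N0 that(1,2)])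
  have g: "(\<integral>\<^sup>+\<omega>. ennreal (N s \<omega>) \<partial>M) \<le> ennreal (2 * A * exp (2 * drift_rate 2 * (s - t)))" if "s \<in> {t<..s1}" for s
  proof (rule drv.cutoff_gronwall[OF N N0 _ A(1) drift_rate_pos that])
    fix K L s :: real assume KL: "0 < L" "L < K" and s: "s \<in> {t<..s1}"
    define R where "R = (\<lambda>\<omega>. \<integral>\<^sup>+r\<in>{t..s}. ennreal (N r \<omega>) * indicator {\<omega>. Q r \<omega> < K} \<omega> \<partial>lborel)"
    have Rm[measurable]: "R \<in> borel_measurable M"
    proof -
      have "case_prod (\<lambda>\<omega> r. ennreal (N r \<omega>) * indicator {\<omega>. Q r \<omega> < K} \<omega> * indicator {t..s} r) \<in> borel_measurable (M \<Otimes>\<^sub>M lborel)"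
        using drv.cutoff_pair_measurable[OF N, of s K] s by (simp add: case_prod_beta' Q_def)
      from lborel.borel_measurable_nn_integral[OF this] show ?thesis unfolding R_def .
    qed
    have "(\<integral>\<^sup>+\<omega>. ennreal (N s \<omega>) * indicator {\<omega>. Q s \<omega> \<le> L} \<omega> \<partial>M) \<le> ennreal A + ennreal (drift_rate 2) * (\<integral>\<^sup>+\<omega>. R \<omega> \<partial>M)"
    \<comment> \<open>Up to \<sigma> the finite energy already yields \<open>bound2\<close>, which
      was added into \<open>A\<close>; the analysis of existing and missing integrals covers only
      the times after \<sigma>.\<close>
    proof (cases "s \<le> \<sigma>")
      case True
      have "(\<integral>\<^sup>+\<omega>. ennreal (N s \<omega>) * indicator {\<omega>. Q s \<omega> \<le> L} \<omega> \<partial>M) \<le> (\<integral>\<^sup>+\<omega>. ennreal (N s \<omega>) \<partial>M)"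
        by (rule nn_integral_mono) (auto simp: indicator_def)
      also have "\<dots> \<le> ennreal bound2" unfolding N_def by (rule npow2_bound[OF _ fin]) (use \<sigma> s True in auto)
      also note A(3)
      finally show ?thesis by (simp add: add_increasing2)
    next
      case False
      then have s\<sigma>: "s \<in> {\<sigma><..s1}" using s by auto
      have sT: "0 \<le> t" "t < s" "s \<le> T" using s s1 t by auto
      define Z where "Z = (\<lambda>i j \<omega>. if P i j s1 then ennreal ((ito_integral M F (B j) t s (\<eta> i j) \<omega>)\<^sup>2) else Cc \<omega>)"
      have Zm[measurable]: "Z i j \<in> borel_measurable M" for i j
      proof (cases "P i j s1")
        case True
        then have [measurable]: "ito_integral M F (B j) t s (\<eta> i j) \<in> borel_measurable M"
          using good[OF True s\<sigma>] by (simp add: is_ito_integral_def)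
        show ?thesis using True by (simp add: Z_def)
      qed (simp add: Z_def[abs_def])
      have EZ: "(\<integral>\<^sup>+\<omega>. Z i j \<omega> \<partial>M) \<le> z i j" for i j
      proof (cases "P i j s1")
        case True
        have "(\<integral>\<^sup>+\<omega>. ennreal ((ito_integral M F (B j) t s (\<eta> i j) \<omega>)\<^sup>2) \<partial>M) \<le> drv.mean_power 2 t s (\<eta> i j)"
          by (rule drv.ito_second_moment[OF \<eta>s[OF sT(3)] sT good[OF True s\<sigma>]])
        also have "\<dots> \<le> drv.mean_power 2 t s1 (\<eta> i j)" by (rule drv.mean_power_subset) (use s in auto)
        finally show ?thesis using True by (simp add: Z_def z_def)
      qed (simp add: Z_def z_def)
      have Zle: "AE \<omega> in M. ennreal ((ito_integral M F (B j) t s (\<eta> i j) \<omega>)\<^sup>2) \<le> Z i j \<omega>" for i j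
      proof (cases "P i j s1")
        case False then show ?thesis using Cae[OF False] bad[OF False s\<sigma>] by (simp add: Z_def)
      qed (simp add: Z_def)
      have Zall: "AE \<omega> in M. \<forall>i\<in>UNIV. \<forall>j\<in>UNIV. ennreal ((ito_integral M F (B j) t s (\<eta> i j) \<omega>)\<^sup>2) \<le> Z i j \<omega>"
        by (intro AE_finite_allI finite Zle)
      have eqall: "AE \<omega> in M. \<forall>i\<in>UNIV. U i s \<omega> = u i + (LINT r:{t..s}|lborel. \<alpha> i r \<omega>) + (\<Sum>j\<in>UNIV. ito_integral M F (B j) t s (\<eta> i j) \<omega>)"
        by (rule AE_finite_allI) (use equation sT in auto)
      from Zall eqall AE_space have ae: "AE \<omega> in M. ennreal (N s \<omega>) * indicator {\<omega>. Q s \<omega> \<le> L} \<omega> \<le>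
         ennreal (initial 2) + ennreal (drift_rate 2) * R \<omega> + (\<Sum>i\<in>UNIV. \<Sum>j\<in>UNIV. ennreal (noise_factor 2) * Z i j \<omega>)"
      proof eventually_elim
        case (elim \<omega>)
        show ?case
        proof (cases "Q s \<omega> \<le> L")
          case True
          have Qr: "Q r \<omega> \<le> L" if "r \<le> s" for r using Qmono[of r s \<omega>] that s elim(3) True by auto
          have "ennreal (npow 2 s \<omega>) \<le> ennreal (initial 2) + ennreal (drift_rate 2) * (\<integral>\<^sup>+r\<in>{t..s}. ennreal (npow 2 r \<omega>) \<partial>lborel)
            + (\<Sum>i\<in>UNIV. \<Sum>j\<in>UNIV. ennreal (noise_factor 2) * ennreal (ito_integral M F (B j) t s (\<eta> i j) \<omega> ^ 2))"
            by (rule npow_pointwise) (use sT elim in auto)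
          also have "\<dots> \<le> ennreal (initial 2) + ennreal (drift_rate 2) * (\<integral>\<^sup>+r\<in>{t..s}. ennreal (npow 2 r \<omega>) \<partial>lborel)
            + (\<Sum>i\<in>UNIV. \<Sum>j\<in>UNIV. ennreal (noise_factor 2) * Z i j \<omega>)"
            using elim(1) by (intro add_left_mono sum_mono mult_left_mono) auto
          also have "(\<integral>\<^sup>+r\<in>{t..s}. ennreal (npow 2 r \<omega>) \<partial>lborel) = R \<omega>"
            unfolding R_def N_def[symmetric]
          proof (rule nn_integral_cong)
            fix r
            show "ennreal (N r \<omega>) * indicator {t..s} r = ennreal (N r \<omega>) * indicator {\<omega>. Q r \<omega> < K} \<omega> * indicator {t..s} r"
              using Qr[of r] KL by (auto simp: indicator_def)
          qed
          finally show ?thesis using True by (simp add: N_def)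
        qed simp
      qed
      have "(\<integral>\<^sup>+\<omega>. ennreal (N s \<omega>) * indicator {\<omega>. Q s \<omega> \<le> L} \<omega> \<partial>M) \<le>
        (\<integral>\<^sup>+\<omega>. ennreal (initial 2) + ennreal (drift_rate 2) * R \<omega> + (\<Sum>i\<in>UNIV. \<Sum>j\<in>UNIV. ennreal (noise_factor 2) * Z i j \<omega>) \<partial>M)"
        by (rule nn_integral_mono_AE[OF ae])
      also have "\<dots> = ennreal (initial 2) + ennreal (drift_rate 2) * (\<integral>\<^sup>+\<omega>. R \<omega> \<partial>M) + (\<Sum>i\<in>UNIV. \<Sum>j\<in>UNIV. ennreal (noise_factor 2) * (\<integral>\<^sup>+\<omega>. Z i j \<omega> \<partial>M))"
        by (simp add: nn_integral_add nn_integral_cmult nn_integral_sum drv.emeasure_space_1)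
      also have "\<dots> \<le> ennreal (initial 2) + ennreal (drift_rate 2) * (\<integral>\<^sup>+\<omega>. R \<omega> \<partial>M) + (\<Sum>i\<in>UNIV. \<Sum>j\<in>UNIV. ennreal (noise_factor 2) * z i j)"
        by (intro add_left_mono sum_mono mult_left_mono EZ) simp
      also have "\<dots> = Ae + ennreal (drift_rate 2) * (\<integral>\<^sup>+\<omega>. R \<omega> \<partial>M)" by (simp add: Ae_def ac_simps)
      also have "\<dots> \<le> ennreal A + ennreal (drift_rate 2) * (\<integral>\<^sup>+\<omega>. R \<omega> \<partial>M)" by (intro add_right_mono A(2))
      finally show ?thesis .
    qed
    then show "(\<integral>\<^sup>+\<omega>. ennreal (N s \<omega>) * indicator {\<omega>. (LINT q:{t..s}|lborel. N q \<omega>) \<le> L} \<omega> \<partial>M) \<le> ennreal A + ennreal (drift_rate 2) *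
        (\<integral>\<^sup>+\<omega>. (\<integral>\<^sup>+r\<in>{t..s}. ennreal (N r \<omega>) * indicator {\<omega>. (LINT q:{t..r}|lborel. N q \<omega>) < K} \<omega> \<partial>lborel) \<partial>M)"
      by (simp add: R_def Q_def)
  qed
  have "energy s1 \<le> ennreal ((2 * A * exp (2 * drift_rate 2 * (s1 - t))) * (s1 - t))"
  proof (rule drv.mean_power_le)
    show "drv.adapted_continuous t s1 (npow 2)" using N by (simp add: N_def)
    fix r assume r: "r \<in> {t<..<s1}"
    then have "(\<integral>\<^sup>+\<omega>. ennreal (npow 2 r \<omega> ^ 1) \<partial>M) \<le> ennreal (2 * A * exp (2 * drift_rate 2 * (r - t)))"
      using g[of r] by (simp add: N_def)
    also have "\<dots> \<le> ennreal (2 * A * exp (2 * drift_rate 2 * (s1 - t)))"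
      using r A(1) drift_rate_pos[of 2] by (intro ennreal_leI mult_left_mono) auto
    finally show "(\<integral>\<^sup>+\<omega>. ennreal (npow 2 r \<omega> ^ 1) \<partial>M) \<le> ennreal (2 * A * exp (2 * drift_rate 2 * (s1 - t)))" .
  qed (use s1 \<sigma> A(1) in auto)
  then have "energy s1 < \<infinity>" by (rule le_less_trans) simp
  with s1 show ?thesis by blast
qed

text \<open>The times with finite energy contain the start, where the interval is null. Their
  supremum belongs to them, because \<open>bound2\<close> bounds all second moments strictly before
  it, and by the extension step it cannot lie before T.\<close>

lemma energy_finite: "energy T < \<infinity>"
proof -
  define G where "G = {s \<in> {t..T}. energy s < \<infinity>}"
  have N: "drv.adapted_continuous t s (npow 2)" if "s \<le> T" for s
    by (rule drv.adapted_continuous_subset[OF npow_adapted]) (use that in auto)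
  have "energy t \<le> ennreal (0 * (t - t))" by (rule drv.mean_power_le[OF N]) (use t in auto)
  then have tG: "t \<in> G" using t by (simp add: G_def)
  have bdd: "bdd_above G" unfolding G_def by (rule bdd_aboveI[of _ T]) auto
  define \<sigma> where "\<sigma> = Sup G"
  have "t \<le> \<sigma>" unfolding \<sigma>_def by (rule cSup_upper[OF tG bdd])
  moreover have "\<sigma> \<le> T" unfolding \<sigma>_def by (rule cSup_least) (use tG in \<open>auto simp: G_def\<close>)
  ultimately have \<sigma>: "t \<le> \<sigma>" "\<sigma> \<le> T" .
  have "energy \<sigma> \<le> ennreal (bound2 * (\<sigma> - t))"
  proof (rule drv.mean_power_le[OF N])
    fix r assume r: "r \<in> {t<..<\<sigma>}"
    then obtain s where "s \<in> G" "r < s" using less_cSup_iff[of G r] tG bdd by (auto simp: \<sigma>_def)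
    then show "(\<integral>\<^sup>+\<omega>. ennreal (npow 2 r \<omega> ^ 1) \<partial>M) \<le> ennreal bound2"
      using npow2_bound[of s r] r by (auto simp: G_def)
  qed (use \<sigma> bound2_pos in auto)
  then have fin: "energy \<sigma> < \<infinity>" by (rule le_less_trans) simp
  have "\<sigma> = T"
  proof (rule ccontr)
    assume "\<sigma> \<noteq> T"
    with \<sigma> have "\<sigma> < T" by simp
    from energy_extends[OF \<sigma>(1) this fin] obtain s1 where "s1 \<in> {\<sigma><..T}" "energy s1 < \<infinity>" by blast
    then have "s1 \<in> G" "\<sigma> < s1" using \<sigma> by (auto simp: G_def)
    then show False using cSup_upper[OF _ bdd, of s1] by (simp add: \<sigma>_def)
  qed
  with fin show ?thesis by simp
qed

section \<open>Fourth moments up to the final time\<close>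

lemma npow4_bound:
  assumes "s \<in> {t<..T}"
  shows "(\<integral>\<^sup>+\<omega>. ennreal (npow 4 s \<omega>) \<partial>M) \<le> ennreal bound4"
  by (rule fourth_moment_bound[of T]) (use t assms \<eta>_mean_power_finite[OF _ energy_finite] in auto)

text \<open>Stated for any integrand whose fourth power is dominated by \<open>npow 4\<close>, so
  that it covers the coefficients of the equation as well as the weight built from the inverse of
  \<sigma> and \<open>D\<close>.\<close>

lemma ito_fourth_moment_npow:
  assumes H: "drv.adapted_continuous t T H" and "0 \<le> c"
    and le: "\<And>r \<omega>. r \<in> {t..T} \<Longrightarrow> \<omega> \<in> space M \<Longrightarrow> H r \<omega> ^ 4 \<le> c * npow 4 r \<omega>" and s: "s \<in> {t<..T}"
  shows "is_ito_integral M F (B j) t s H (ito_integral M F (B j) t s H)"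
    and "(\<integral>\<^sup>+\<omega>. ennreal (ito_integral M F (B j) t s H \<omega> ^ 4) \<partial>M) \<le> ennreal (36 * (c * bound4) * (s - t)\<^sup>2)"
proof -
  have Hs: "drv.adapted_continuous t s H" by (rule drv.adapted_continuous_subset[OF H]) (use s in auto)
  have b: "(\<integral>\<^sup>+\<omega>. ennreal (H r \<omega> ^ 4) \<partial>M) \<le> ennreal (c * bound4)" if r: "r \<in> {t<..s}" for r
  proof -
    have [measurable]: "npow 4 r \<in> borel_measurable M" using drv.adapted_continuousD(2)[OF npow_adapted] s r by auto
    have "(\<integral>\<^sup>+\<omega>. ennreal (H r \<omega> ^ 4) \<partial>M) \<le> (\<integral>\<^sup>+\<omega>. ennreal c * ennreal (npow 4 r \<omega>) \<partial>M)"
      unfolding ennreal_mult'[OF \<open>0 \<le> c\<close>, symmetric] by (intro nn_integral_mono ennreal_leI le) (use r s in auto)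
    also have "\<dots> = ennreal c * (\<integral>\<^sup>+\<omega>. ennreal (npow 4 r \<omega>) \<partial>M)" by (rule nn_integral_cmult) measurable
    also have "\<dots> \<le> ennreal c * ennreal bound4" by (intro mult_left_mono npow4_bound) (use r s in auto)
    finally show ?thesis using \<open>0 \<le> c\<close> by (simp add: ennreal_mult')
  qed
  have c: "0 \<le> c * bound4" using \<open>0 \<le> c\<close> bound4_pos by simp
  show "is_ito_integral M F (B j) t s H (ito_integral M F (B j) t s H)"
    by (rule drv.ito_fourth_moment_uniform(1)[OF Hs t(1) _ _ c b]) (use s in auto)
  show "(\<integral>\<^sup>+\<omega>. ennreal (ito_integral M F (B j) t s H \<omega> ^ 4) \<partial>M) \<le> ennreal (36 * (c * bound4) * (s - t)\<^sup>2)"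
    by (rule drv.ito_fourth_moment_uniform(2)[OF Hs t(1) _ _ c b]) (use s in auto)
qed

text \<open>The 27 = 3^3 comes from the three-term inequality with 0 in place of the initial value.
  The drift contributes (s - t)^4 <= T^2 (s - t)^2; the noise contributes 36 times
  \<open>CARD('j)\<close> to the fourth power, three factors from the power mean and one from the
  sum over drivers.\<close>

definition increment_factor :: real where
  "increment_factor = 27 * (T\<^sup>2 + real CARD('j) ^ 4 * 36) * (growth 4 * bound4)"

lemma increment_factor_nonneg: "0 \<le> increment_factor"
  unfolding increment_factor_def using growth_pos[of 4] bound4_pos by (intro mult_nonneg_nonneg add_nonneg_nonneg) auto

lemma fourth_moment_increment:
  assumes s: "s \<in> {t<..T}"
  shows "(\<integral>\<^sup>+\<omega>. ennreal ((U i s \<omega> - u i) ^ 4) \<partial>M) \<le> ennreal (increment_factor * (s - t)\<^sup>2)"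
proof -
  let ?a = "\<lambda>\<omega>. LINT r:{t..s}|lborel. \<alpha> i r \<omega>" and ?I = "\<lambda>j. ito_integral M F (B j) t s (\<eta> i j)"
  let ?R = "\<lambda>\<omega>. LINT r:{t..s}|lborel. npow 4 r \<omega>"
  have sT: "s \<in> {t..T}" using s by auto
  have N: "drv.adapted_continuous t s (npow 4)" by (rule drv.adapted_continuous_subset[OF npow_adapted]) (use s in auto)
  have gb: "0 \<le> growth 4 * bound4" using growth_pos[of 4] bound4_pos by simp
  have np: "0 \<le> npow 4 r \<omega>" for r \<omega> using npow_ge_1[of 4 r \<omega>] by simp
  have \<eta>4: "\<eta> i j r \<omega> ^ 4 \<le> growth 4 * npow 4 r \<omega>" if "r \<in> {t..T}" "\<omega> \<in> space M" for j r \<omega>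
    by (rule coefficient_power_le[OF \<eta>_growth[OF that]]) simp
  note I = ito_fourth_moment_npow[OF \<eta> less_imp_le[OF growth_pos] \<eta>4 s]
  have Im[measurable]: "?I j \<in> borel_measurable M" for j using I(1)[of j] by (simp add: is_ito_integral_def)
  have Rm[measurable]: "?R \<in> borel_measurable M"
    using drv.adapted_continuousD(2)[OF drv.adapted_continuous_path_integral[OF N], of s] s by auto
  have R0: "0 \<le> ?R \<omega>" for \<omega>
    unfolding set_lebesgue_integral_def by (rule integral_nonneg_AE) (simp add: np)
  have ER: "(\<integral>\<^sup>+\<omega>. ennreal (?R \<omega>) \<partial>M) \<le> ennreal (bound4 * (s - t))"
  proof -
    have "(\<integral>\<^sup>+\<omega>. ennreal (?R \<omega>) \<partial>M) = drv.mean_power 1 t s (npow 4)"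
      unfolding drv.mean_power_def
      by (rule nn_integral_cong) (simp add: nn_integral_eq_set_lint[OF drv.adapted_continuousD(3)[OF N] np])
    also have "\<dots> \<le> ennreal (bound4 * (s - t))"
      by (rule drv.mean_power_le[OF N]) (use s npow4_bound bound4_pos in auto)
    finally show ?thesis .
  qed
  have "(\<integral>\<^sup>+\<omega>. ennreal ((U i s \<omega> - u i) ^ 4) \<partial>M) \<le>
    (\<integral>\<^sup>+\<omega>. ennreal (27 * (s - t) ^ 3 * growth 4) * ennreal (?R \<omega>) + (\<Sum>j\<in>UNIV. ennreal (27 * real CARD('j) ^ 3) * ennreal (?I j \<omega> ^ 4)) \<partial>M)"
  proof (rule nn_integral_mono_AE)
    show "AE \<omega> in M. ennreal ((U i s \<omega> - u i) ^ 4) \<le> ennreal (27 * (s - t) ^ 3 * growth 4) * ennreal (?R \<omega>) + (\<Sum>j\<in>UNIV. ennreal (27 * real CARD('j) ^ 3) * ennreal (?I j \<omega> ^ 4))"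
      using equation[OF sT, of i] AE_space
    proof eventually_elim
      case (elim \<omega>)
      have "(U i s \<omega> - u i) ^ 4 = (0 + ?a \<omega> + (\<Sum>j\<in>UNIV. ?I j \<omega>)) ^ 4" using elim by simp
      also have "\<dots> \<le> 3 ^ (4 - 1) * (0 ^ 4 + ?a \<omega> ^ 4 + (\<Sum>j\<in>UNIV. ?I j \<omega>) ^ 4)" by (rule three_power_le) simp
      also have "\<dots> = 27 * ?a \<omega> ^ 4 + 27 * (\<Sum>j\<in>UNIV. ?I j \<omega>) ^ 4" by simp
      also have "\<dots> \<le> 27 * ((s - t) ^ 3 * growth 4 * ?R \<omega>) + 27 * (real CARD('j) ^ 3 * (\<Sum>j\<in>UNIV. ?I j \<omega> ^ 4))"
        using drift_power_le[OF sT elim(2), of 4 i] sum_power_le[of "UNIV :: 'j set" 4 "\<lambda>j. ?I j \<omega>"] by (intro add_mono mult_left_mono) auto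
      also have "\<dots> = 27 * (s - t) ^ 3 * growth 4 * ?R \<omega> + (\<Sum>j\<in>UNIV. 27 * real CARD('j) ^ 3 * ?I j \<omega> ^ 4)"
        by (simp add: sum_distrib_left mult.assoc)
      finally have "ennreal ((U i s \<omega> - u i) ^ 4) \<le> ennreal (27 * (s - t) ^ 3 * growth 4 * ?R \<omega> + (\<Sum>j\<in>UNIV. 27 * real CARD('j) ^ 3 * ?I j \<omega> ^ 4))"
        by (rule ennreal_leI)
      also have "\<dots> = ennreal (27 * (s - t) ^ 3 * growth 4 * ?R \<omega>) + ennreal (\<Sum>j\<in>UNIV. 27 * real CARD('j) ^ 3 * ?I j \<omega> ^ 4)"
        using s R0[of \<omega>] growth_pos[of 4] by (intro ennreal_plus sum_nonneg mult_nonneg_nonneg) auto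
      also have "ennreal (\<Sum>j\<in>UNIV. 27 * real CARD('j) ^ 3 * ?I j \<omega> ^ 4) = (\<Sum>j\<in>UNIV. ennreal (27 * real CARD('j) ^ 3) * ennreal (?I j \<omega> ^ 4))"
        by (subst sum_ennreal[symmetric]) (auto simp: ennreal_mult')
      also have "ennreal (27 * (s - t) ^ 3 * growth 4 * ?R \<omega>) = ennreal (27 * (s - t) ^ 3 * growth 4) * ennreal (?R \<omega>)"
        using s growth_pos[of 4] by (intro ennreal_mult') (auto intro!: mult_nonneg_nonneg)
      finally show ?case .
    qed
  qed
  also have "\<dots> = ennreal (27 * (s - t) ^ 3 * growth 4) * (\<integral>\<^sup>+\<omega>. ennreal (?R \<omega>) \<partial>M) + (\<Sum>j\<in>UNIV. ennreal (27 * real CARD('j) ^ 3) * (\<integral>\<^sup>+\<omega>. ennreal (?I j \<omega> ^ 4) \<partial>M))"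
    by (simp add: nn_integral_add nn_integral_cmult nn_integral_sum)
  also have "\<dots> \<le> ennreal (27 * (s - t) ^ 3 * growth 4) * ennreal (bound4 * (s - t)) + (\<Sum>j\<in>(UNIV::'j set). ennreal (27 * real CARD('j) ^ 3) * ennreal (36 * (growth 4 * bound4) * (s - t)\<^sup>2))"
    by (intro add_mono mult_left_mono sum_mono ER I(2)) auto
  also have "\<dots> = ennreal (27 * (s - t) ^ 3 * growth 4 * (bound4 * (s - t))) + (\<Sum>j\<in>(UNIV::'j set). ennreal (27 * real CARD('j) ^ 3 * (36 * (growth 4 * bound4) * (s - t)\<^sup>2)))"
    using s growth_pos[of 4] bound4_pos by (subst (1 2) ennreal_mult) (auto intro!: mult_nonneg_nonneg)
  also have "\<dots> = ennreal (27 * (s - t) ^ 3 * growth 4 * (bound4 * (s - t)) + (\<Sum>j\<in>(UNIV::'j set). 27 * real CARD('j) ^ 3 * (36 * (growth 4 * bound4) * (s - t)\<^sup>2)))"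
  proof -
    have c: "0 \<le> 27 * real CARD('j) ^ 3 * (36 * (growth 4 * bound4) * (s - t)\<^sup>2)" using growth_pos[of 4] bound4_pos by (intro mult_nonneg_nonneg) auto
    have "0 \<le> 27 * (s - t) ^ 3 * growth 4 * (bound4 * (s - t))"
      using s growth_pos[of 4] bound4_pos by (intro mult_nonneg_nonneg) auto
    then show ?thesis unfolding sum_ennreal[OF c] by (intro ennreal_plus[symmetric] sum_nonneg c)
  qed
  also have "\<dots> \<le> ennreal (increment_factor * (s - t)\<^sup>2)"
  proof (rule ennreal_leI)
    define d where "d = s - t"
    have "(s - t)\<^sup>2 * (27 * (growth 4 * bound4) * (s - t)\<^sup>2) \<le> T\<^sup>2 * (27 * (growth 4 * bound4) * (s - t)\<^sup>2)"
      using s t gb by (intro mult_right_mono power_mono) auto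
    then show "27 * (s - t) ^ 3 * growth 4 * (bound4 * (s - t)) + (\<Sum>j\<in>(UNIV::'j set). 27 * real CARD('j) ^ 3 * (36 * (growth 4 * bound4) * (s - t)\<^sup>2)) \<le> increment_factor * (s - t)\<^sup>2"
      unfolding d_def[symmetric] increment_factor_def
      by (simp add: power2_eq_square power3_eq_cube power4_eq_xxxx distrib_left distrib_right mult_ac)
  qed
  finally show ?thesis .
qed

end

section \<open>The diffusion, its variational process and the weighted increments\<close>

lemma matrix_inv_inverse:
  fixes A :: "real^'n^'n"
  assumes "invertible A"
  shows "A ** matrix_inv A = mat 1 \<and> matrix_inv A ** A = mat 1"
  using assms unfolding invertible_def matrix_inv_def by (rule someI_ex)

text \<open>Cramer's rule for the columns of the inverse. It exhibits each entry as a quotient of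
  determinants, from which continuity of the inverse is read off.\<close>

lemma matrix_inv_cramer:
  fixes A :: "real^'n^'n"
  assumes A: "invertible A"
  shows "matrix_inv A $ i $ j = det (\<chi> k l. if l = i then axis j 1 $ k else A $ k $ l) / det A"
proof -
  have d: "det A \<noteq> 0" using A by (simp add: invertible_det_nz)
  have "A *v (matrix_inv A *v axis j 1) = axis j 1"
    using matrix_inv_inverse[OF A] by (simp add: matrix_vector_mul_assoc)
  then have "matrix_inv A *v axis j 1 = (\<chi> k. det (\<chi> i l. if l = k then axis j 1 $ i else A $ i $ l) / det A)"
    unfolding cramer[OF d] .
  then have "(matrix_inv A *v axis j 1) $ i = det (\<chi> k l. if l = i then axis j 1 $ k else A $ k $ l) / det A" by simp
  then show ?thesis by (simp add: matrix_vector_mult_basis column_def)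
qed

lemma continuous_on_det:
  fixes A :: "'a::topological_space \<Rightarrow> real^'n^'n"
  assumes "\<And>i j. continuous_on S (\<lambda>p. A p $ i $ j)"
  shows "continuous_on S (\<lambda>p. det (A p))"
  unfolding det_def by (intro continuous_intros assms)

lemma continuous_on_matrix_inv:
  fixes A :: "'a::topological_space \<Rightarrow> real^'n^'n"
  assumes A: "\<And>i j. continuous_on S (\<lambda>p. A p $ i $ j)" and inv: "\<And>p. p \<in> S \<Longrightarrow> invertible (A p)"
  shows "continuous_on S (\<lambda>p. matrix_inv (A p) $ i $ j)"
proof -
  have "continuous_on S (\<lambda>p. det (\<chi> k l. if l = i then axis j 1 $ k else A p $ k $ l) / det (A p))"
  proof (intro continuous_on_divide continuous_on_det A)
    show "continuous_on S (\<lambda>p. (\<chi> k l. if l = i then axis j 1 $ k else A p $ k $ l) $ k' $ l')" for k' l'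
      by (cases "l' = i") (auto intro: A)
    show "\<forall>p\<in>S. det (A p) \<noteq> 0" using inv by (simp add: invertible_det_nz)
  qed
  then show ?thesis by (simp add: matrix_inv_cramer[OF inv] cong: continuous_on_cong)
qed

text \<open>The quadratic form is the squared norm of the transpose applied to y. Its lower bound
  makes the transpose injective, hence the matrix invertible; its upper bound at a unit vector
  bounds a row.\<close>

lemma elliptic_matrix:
  fixes A :: "real^'n^'n"
  assumes m: "0 < m" and ell: "\<And>y. m * (norm y)\<^sup>2 \<le> y \<bullet> ((A ** transpose A) *v y) \<and> y \<bullet> ((A ** transpose A) *v y) \<le> K * (norm y)\<^sup>2"
  shows "invertible A" "\<bar>A $ i $ j\<bar> \<le> sqrt K" "\<bar>matrix_inv A $ i $ j\<bar> \<le> 1 / sqrt m"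
proof -
  have quad: "y \<bullet> ((A ** transpose A) *v y) = (norm (transpose A *v y))\<^sup>2" for y
    by (simp add: matrix_vector_mul_assoc[symmetric] dot_lmul_matrix[symmetric] power2_norm_eq_inner)
  have low: "m * (norm y)\<^sup>2 \<le> (norm (transpose A *v y))\<^sup>2" and up: "(norm (transpose A *v y))\<^sup>2 \<le> K * (norm y)\<^sup>2" for y
    using ell[of y] unfolding quad by auto
  have "inj ((*v) (transpose A))"
  proof (rule injI)
    fix y z assume "transpose A *v y = transpose A *v z"
    then have "transpose A *v (y - z) = 0" by (simp add: matrix_vector_mult_diff_distrib del: transpose_matrix_vector)
    then have "m * (norm (y - z))\<^sup>2 \<le> 0" using low[of "y - z"] by simp
    then have "(norm (y - z))\<^sup>2 \<le> 0" using m by (simp add: mult_le_0_iff)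
    then show "y = z" by simp
  qed
  then have "invertible (transpose A)" unfolding invertible_left_inverse matrix_left_invertible_injective .
  from transpose_invertible[OF this] show inv: "invertible A" by (simp add: transpose_transpose)
  have "(A $ i $ j)\<^sup>2 \<le> K"
  proof -
    have "A $ i $ j = (transpose A *v axis i 1) $ j"
      unfolding matrix_vector_mult_basis by (simp add: column_def transpose_def)
    then have "\<bar>A $ i $ j\<bar> \<le> norm (transpose A *v axis i 1)" using component_le_norm_cart by metis
    then have "\<bar>A $ i $ j\<bar>\<^sup>2 \<le> (norm (transpose A *v axis i 1))\<^sup>2" by (rule power_mono) simp
    also have "\<dots> \<le> K" using up[of "axis i 1"] by (simp add: norm_axis_1)
    finally show ?thesis by simp
  qed
  then show "\<bar>A $ i $ j\<bar> \<le> sqrt K" using real_sqrt_le_mono by fastforce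
  \<comment> \<open>This is row i of the inverse, and the transpose of \<open>A\<close> maps it to
    the i-th unit vector. The lower bound at \<open>w\<close> therefore reads m |w|^2 <= 1.\<close>
  define w where "w = transpose (matrix_inv A) *v axis i 1"
  have "transpose A *v w = transpose (matrix_inv A ** A) *v axis i 1"
    unfolding w_def by (simp only: matrix_vector_mul_assoc matrix_transpose_mul)
  also have "\<dots> = axis i 1" using matrix_inv_inverse[OF inv] by (simp add: transpose_mat del: transpose_matrix_vector)
  finally have "m * (norm w)\<^sup>2 \<le> 1" using low[of w] by (simp add: norm_axis_1 del: transpose_matrix_vector)
  moreover have "matrix_inv A $ i $ j = w $ j"
    unfolding w_def matrix_vector_mult_basis by (simp add: column_def transpose_def)
  then have "\<bar>matrix_inv A $ i $ j\<bar>\<^sup>2 \<le> (norm w)\<^sup>2" by (intro power_mono) (simp_all add: component_le_norm_cart)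
  ultimately have "m * \<bar>matrix_inv A $ i $ j\<bar>\<^sup>2 \<le> 1" using m by (meson mult_left_mono order.trans less_imp_le)
  then have "\<bar>matrix_inv A $ i $ j\<bar>\<^sup>2 \<le> 1 / m" using m by (simp add: field_simps)
  then have "sqrt (\<bar>matrix_inv A $ i $ j\<bar>\<^sup>2) \<le> sqrt (1 / m)" by (rule real_sqrt_le_mono)
  then show "\<bar>matrix_inv A $ i $ j\<bar> \<le> 1 / sqrt m" by (simp add: real_sqrt_divide)
qed

lemma entry_le_norm: "\<bar>A $ i $ j\<bar> \<le> norm (A :: real^'m^'n)"
  using component_le_norm_cart[of "A $ i" j] Finite_Cartesian_Product.norm_nth_le[of A i] by linarith

lemma matrix_vector_norm_le:
  fixes A :: "real^'d^'d"
  shows "norm (A *v k) \<le> (real CARD('d))\<^sup>2 * norm A * norm k"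
proof -
  have "norm (A *v k) \<le> (\<Sum>i\<in>UNIV. \<bar>(A *v k) $ i\<bar>)" by (rule norm_le_l1_cart)
  also have "\<dots> \<le> (\<Sum>i\<in>(UNIV::'d set). \<Sum>j\<in>(UNIV::'d set). norm A * norm k)"
  proof (rule sum_mono)
    fix i
    have "\<bar>(A *v k) $ i\<bar> \<le> (\<Sum>j\<in>UNIV. \<bar>A $ i $ j * k $ j\<bar>)"
      unfolding matrix_vector_mult_def by (simp add: sum_abs)
    also have "\<dots> \<le> (\<Sum>j\<in>(UNIV::'d set). norm A * norm k)"
      unfolding abs_mult by (intro sum_mono mult_mono entry_le_norm component_le_norm_cart) auto
    finally show "\<bar>(A *v k) $ i\<bar> \<le> (\<Sum>j\<in>(UNIV::'d set). norm A * norm k)" .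
  qed
  also have "\<dots> = (real CARD('d))\<^sup>2 * norm A * norm k" by (simp add: power2_eq_square)
  finally show ?thesis .
qed

lemma continuous_on_entry: "continuous_on S A \<Longrightarrow> continuous_on S (\<lambda>p. A p $ i $ j)"
  for A :: "'a::topological_space \<Rightarrow> real^'m^'n"
  by (intro continuous_intros)

lemma standing_assumption_continuous:
  fixes \<mu> :: "real \<Rightarrow> real^'d::finite \<Rightarrow> real^'d"
  assumes sa: "standing_assumption T \<mu> \<sigma> Dmu Dsig"
  shows "continuous_on ({0..T} \<times> UNIV) (\<lambda>p. \<mu> (fst p) (snd p) $ i)"
    "continuous_on ({0..T} \<times> UNIV) (\<lambda>p. \<sigma> (fst p) (snd p) $ i $ j)"
    "continuous_on ({0..T} \<times> UNIV) (\<lambda>p. Dmu (fst p) (snd p) $ i $ j)"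
    "continuous_on ({0..T} \<times> UNIV) (\<lambda>p. Dsig k (fst p) (snd p) $ i $ j)"
    "continuous_on ({0..T} \<times> UNIV) (\<lambda>p. matrix_inv (\<sigma> (fst p) (snd p)) $ i $ j)"
proof -
  let ?S = "{0..T} \<times> UNIV :: (real \<times> (real^'d)) set"
  note parts = sa[unfolded standing_assumption_def]
  note mu_part = parts[THEN conjunct1] and sig_part = parts[THEN conjunct2, THEN conjunct1]
    and D_part = parts[THEN conjunct2, THEN conjunct2, THEN conjunct1]
    and zero_part = parts[THEN conjunct2, THEN conjunct2, THEN conjunct2, THEN conjunct1]
    and ell_part = parts[THEN conjunct2, THEN conjunct2, THEN conjunct2, THEN conjunct2]
  from mu_part obtain Tmu where mu: "\<And>t x. t \<in> {0..T} \<Longrightarrow>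
        ((\<lambda>p. \<mu> (fst p) (snd p)) has_derivative (\<lambda>(h,k). h *\<^sub>R Tmu t x + Dmu t x *v k)) (at (t,x) within ?S)"
    and Dmu: "continuous_on ?S (\<lambda>p. Dmu (fst p) (snd p))"
    by (elim exE conjE) (rule that, blast+)
  have "continuous_on ?S (\<lambda>p. \<mu> (fst p) (snd p))"
    unfolding continuous_on_eq_continuous_within by (auto intro!: has_derivative_continuous[OF mu])
  then show "continuous_on ?S (\<lambda>p. \<mu> (fst p) (snd p) $ i)" by (intro continuous_intros)
  show "continuous_on ?S (\<lambda>p. Dmu (fst p) (snd p) $ i $ j)" by (rule continuous_on_entry[OF Dmu])
  have cs: "continuous_on ?S (\<lambda>p. \<sigma> (fst p) (snd p) $ i $ j)" for i j
  proof -
    from sig_part[THEN spec[of _ j]] obtain Tsig where sig: "\<And>t x. t \<in> {0..T} \<Longrightarrow>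
        ((\<lambda>p. col j (\<sigma> (fst p) (snd p))) has_derivative (\<lambda>(h,k). h *\<^sub>R Tsig t x + Dsig j t x *v k)) (at (t,x) within ?S)"
      by (elim exE conjE) (rule that, blast+)
    have "continuous_on ?S (\<lambda>p. col j (\<sigma> (fst p) (snd p)))"
      unfolding continuous_on_eq_continuous_within by (auto intro!: has_derivative_continuous[OF sig])
    then have "continuous_on ?S (\<lambda>p. col j (\<sigma> (fst p) (snd p)) $ i)" by (intro continuous_intros)
    then show ?thesis by (simp add: col_def)
  qed
  show "continuous_on ?S (\<lambda>p. \<sigma> (fst p) (snd p) $ i $ j)" by (rule cs)
  have "continuous_on ?S (\<lambda>p. Dsig k (fst p) (snd p))" using sig_part by blast
  then show "continuous_on ?S (\<lambda>p. Dsig k (fst p) (snd p) $ i $ j)" by (rule continuous_on_entry)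
  from ell_part obtain m K where "0 < m" and ell: "\<And>t x y. t\<in>{0..T} \<Longrightarrow> m * (norm y)\<^sup>2 \<le> y \<bullet> ((\<sigma> t x ** transpose (\<sigma> t x)) *v y) \<and>
        y \<bullet> ((\<sigma> t x ** transpose (\<sigma> t x)) *v y) \<le> K * (norm y)\<^sup>2"
    by (elim exE conjE) (rule that, blast+)
  show "continuous_on ?S (\<lambda>p. matrix_inv (\<sigma> (fst p) (snd p)) $ i $ j)"
    by (rule continuous_on_matrix_inv[OF cs]) (auto intro!: elliptic_matrix(1)[OF \<open>0 < m\<close> ell])
qed

text \<open>Ellipticity bounds \<sigma> from above and its inverse through \<open>m\<close>. The
  drift grows at most linearly by the mean value inequality, starting from its bounded values at 0.
  A single sum dominates all these constants.\<close>

lemma standing_assumption_bounds: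
  fixes \<mu> :: "real \<Rightarrow> real^'d::finite \<Rightarrow> real^'d"
  assumes sa: "standing_assumption T \<mu> \<sigma> Dmu Dsig"
  obtains C where "0 < C"
    "\<And>r y i. r \<in> {0..T} \<Longrightarrow> \<bar>\<mu> r y $ i\<bar> \<le> C * (1 + (\<Sum>k\<in>UNIV. \<bar>y $ k\<bar>))"
    "\<And>r y i j. r \<in> {0..T} \<Longrightarrow> \<bar>\<sigma> r y $ i $ j\<bar> \<le> C"
    "\<And>r y i j. r \<in> {0..T} \<Longrightarrow> \<bar>Dmu r y $ i $ j\<bar> \<le> C"
    "\<And>r y k i j. r \<in> {0..T} \<Longrightarrow> \<bar>Dsig k r y $ i $ j\<bar> \<le> C"
    "\<And>r y i j. r \<in> {0..T} \<Longrightarrow> \<bar>matrix_inv (\<sigma> r y) $ i $ j\<bar> \<le> C"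
proof -
  let ?S = "{0..T} \<times> UNIV :: (real \<times> (real^'d)) set"
  note parts = sa[unfolded standing_assumption_def]
  note mu_part = parts[THEN conjunct1] and sig_part = parts[THEN conjunct2, THEN conjunct1]
    and D_part = parts[THEN conjunct2, THEN conjunct2, THEN conjunct1]
    and zero_part = parts[THEN conjunct2, THEN conjunct2, THEN conjunct2, THEN conjunct1]
    and ell_part = parts[THEN conjunct2, THEN conjunct2, THEN conjunct2, THEN conjunct2]
  from mu_part obtain Tmu where mu: "\<And>t x. t \<in> {0..T} \<Longrightarrow>
        ((\<lambda>p. \<mu> (fst p) (snd p)) has_derivative (\<lambda>(h,k). h *\<^sub>R Tmu t x + Dmu t x *v k)) (at (t,x) within ?S)"
    by (elim exE conjE) (rule that, blast+)
  from D_part obtain C1 where C1: "\<And>t x. t \<in> {0..T} \<Longrightarrow> norm (Dmu t x) \<le> C1" "\<And>t x j. t \<in> {0..T} \<Longrightarrow> norm (Dsig j t x) \<le> C1"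
    by (elim exE conjE) (rule that, blast+)
  from zero_part obtain C2 where C2: "\<And>t. t \<in> {0..T} \<Longrightarrow> norm (\<mu> t 0) \<le> C2"
    by (elim exE conjE) (rule that, blast+)
  from ell_part obtain m K where m: "0 < m" and ell: "\<And>t x y. t\<in>{0..T} \<Longrightarrow> m * (norm y)\<^sup>2 \<le> y \<bullet> ((\<sigma> t x ** transpose (\<sigma> t x)) *v y) \<and>
        y \<bullet> ((\<sigma> t x ** transpose (\<sigma> t x)) *v y) \<le> K * (norm y)\<^sup>2"
    by (elim exE conjE) (rule that, blast+)
  define L where "L = (real CARD('d))\<^sup>2 * \<bar>C1\<bar>"
  define C where "C = 1 + \<bar>C1\<bar> + \<bar>C2\<bar> + L + \<bar>sqrt K\<bar> + 1 / sqrt m"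
  have L0: "0 \<le> L" by (simp add: L_def)
  have m0: "0 < 1 / sqrt m" using m by simp
  have C0: "0 < C" "C1 \<le> C" "\<bar>C2\<bar> \<le> C" "L \<le> C" "sqrt K \<le> C" "1 / sqrt m \<le> C"
    unfolding C_def using L0 m0 by linarith+
  show ?thesis
  proof (rule that[of C])
    fix r :: real and y :: "real^'d" assume r: "r \<in> {0..T}"
    show "\<bar>Dmu r y $ i $ j\<bar> \<le> C" for i j using entry_le_norm[of "Dmu r y" i j] C1(1)[OF r, of y] C0 by linarith
    show "\<bar>Dsig k r y $ i $ j\<bar> \<le> C" for k i j using entry_le_norm[of "Dsig k r y" i j] C1(2)[OF r, of k y] C0 by linarith
    show "\<bar>\<sigma> r y $ i $ j\<bar> \<le> C" for i j using elliptic_matrix(2)[OF m ell[OF r, of _ y], of i j] C0 by linarith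
    show "\<bar>matrix_inv (\<sigma> r y) $ i $ j\<bar> \<le> C" for i j using elliptic_matrix(3)[OF m ell[OF r, of _ y], of i j] C0 by linarith
    \<comment> \<open>The spatial derivative at fixed time, obtained by composing the space-time
      derivative with y mapped to (r, y); the domain is first restricted to this slice.\<close>
    have der: "(\<mu> r has_derivative (\<lambda>k. Dmu r z *v k)) (at z within UNIV)" for z
    proof -
      have "((\<lambda>y. (r, y)) has_derivative (\<lambda>k. (0, k))) (at z within UNIV)" by (auto intro!: derivative_eq_intros)
      moreover have "((\<lambda>p. \<mu> (fst p) (snd p)) has_derivative (\<lambda>(h,k). h *\<^sub>R Tmu r z + Dmu r z *v k)) (at (r, z) within ((\<lambda>y. (r, y)) ` UNIV))"
        by (rule has_derivative_subset[OF mu[OF r]]) (use r in auto)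
      ultimately have "((\<lambda>p. \<mu> (fst p) (snd p)) \<circ> (\<lambda>y. (r, y)) has_derivative (\<lambda>(h,k). h *\<^sub>R Tmu r z + Dmu r z *v k) \<circ> (\<lambda>k. (0, k))) (at z within UNIV)"
        by (rule diff_chain_within)
      then show ?thesis by (simp add: o_def)
    qed
    have "norm (\<mu> r y - \<mu> r 0) \<le> L * norm (y - 0)"
    proof (rule differentiable_bound[OF convex_UNIV der])
      fix z
      show "onorm (\<lambda>k. Dmu r z *v k) \<le> L"
      proof (rule onorm_bound[OF L0])
        fix k
        have "norm (Dmu r z *v k) \<le> (real CARD('d))\<^sup>2 * norm (Dmu r z) * norm k" by (rule matrix_vector_norm_le)
        also have "\<dots> \<le> (real CARD('d))\<^sup>2 * \<bar>C1\<bar> * norm k"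
          using C1(1)[OF r, of z] by (intro mult_right_mono mult_left_mono) auto
        finally show "norm (Dmu r z *v k) \<le> L * norm k" by (simp add: L_def)
      qed
    qed auto
    then have "norm (\<mu> r y) \<le> \<bar>C2\<bar> + L * norm y" using C2[OF r] norm_triangle_sub[of "\<mu> r y" "\<mu> r 0"] by simp
    also have "\<dots> \<le> C + C * (\<Sum>k\<in>UNIV. \<bar>y $ k\<bar>)"
      using C0 L0 norm_le_l1_cart[of y] by (intro add_mono mult_mono) auto
    finally have "norm (\<mu> r y) \<le> C * (1 + (\<Sum>k\<in>UNIV. \<bar>y $ k\<bar>))" by (simp add: distrib_left)
    then show "\<bar>\<mu> r y $ i\<bar> \<le> C * (1 + (\<Sum>k\<in>UNIV. \<bar>y $ k\<bar>))" for i
      using component_le_norm_cart[of "\<mu> r y" i] by linarith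
  qed (use C0 in simp)
qed

section \<open>Passage from vector and matrix equations to scalar coordinates\<close>

context ito_driver
begin

lemma adapted_continuous_composite:
  fixes X :: "real \<Rightarrow> 'w \<Rightarrow> real^'d::finite"
  assumes X: "\<And>r. r \<in> {s..T} \<Longrightarrow> X r \<in> borel_measurable (F r)" "\<And>\<omega>. \<omega> \<in> space M \<Longrightarrow> continuous_on {s..T} (\<lambda>r. X r \<omega>)"
    and "0 \<le> s" and \<phi>: "continuous_on ({0..T} \<times> UNIV) (\<lambda>p. \<phi> (fst p) (snd p))"
  shows "adapted_continuous s T (\<lambda>r \<omega>. \<phi> r (X r \<omega>))"
  unfolding adapted_continuous_def
proof (intro conjI ballI)
  fix r assume r: "r \<in> {s..T}"
  have "continuous_on UNIV (\<lambda>y. (\<lambda>p. \<phi> (fst p) (snd p)) (r, y))"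
    by (rule continuous_on_compose2[OF \<phi>]) (use r \<open>0 \<le> s\<close> in \<open>auto intro!: continuous_intros\<close>)
  then have "\<phi> r \<in> borel_measurable borel" by (intro borel_measurable_continuous_onI) simp
  then show "(\<lambda>\<omega>. \<phi> r (X r \<omega>)) \<in> borel_measurable (F r)" by (rule measurable_compose[OF X(1)[OF r]])
next
  fix \<omega> assume \<omega>: "\<omega> \<in> space M"
  have "continuous_on {s..T} (\<lambda>r. (\<lambda>p. \<phi> (fst p) (snd p)) (r, X r \<omega>))"
    by (rule continuous_on_compose2[OF \<phi>]) (use \<open>0 \<le> s\<close> in \<open>auto intro!: continuous_intros X(2)[OF \<omega>]\<close>)
  then show "continuous_on {s..T} (\<lambda>r. \<phi> r (X r \<omega>))" by simp
qed

end

lemma set_lint_vec_nth: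
  fixes f :: "real \<Rightarrow> real^'n"
  assumes "continuous_on {t..s} f"
  shows "(LINT r:{t..s}|lborel. f r) $ i = (LINT r:{t..s}|lborel. f r $ i)"
proof -
  have "integrable lborel (\<lambda>r. indicator {t..s} r *\<^sub>R f r)"
    using borel_integrable_atLeastAtMost'[OF assms] by (simp add: set_integrable_def)
  from integral_bounded_linear[OF bounded_linear_vec_nth[of i] this]
  show ?thesis by (simp add: set_lebesgue_integral_def)
qed

lemma set_lint_mat_nth:
  fixes f :: "real \<Rightarrow> real^'n^'m"
  assumes "continuous_on {t..s} f"
  shows "(LINT r:{t..s}|lborel. f r) $ i $ j = (LINT r:{t..s}|lborel. f r $ i $ j)"
proof -
  have "integrable lborel (\<lambda>r. indicator {t..s} r *\<^sub>R f r)"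
    using borel_integrable_atLeastAtMost'[OF assms] by (simp add: set_integrable_def)
  from integral_bounded_linear[OF bounded_linear_compose[OF bounded_linear_vec_nth[of j] bounded_linear_vec_nth[of i]] this]
  show ?thesis by (simp add: set_lebesgue_integral_def)
qed

lemma continuous_on_vec_of_components:
  fixes f :: "'a::topological_space \<Rightarrow> 'b::topological_space^'n"
  assumes "\<And>i. continuous_on S (\<lambda>p. f p $ i)"
  shows "continuous_on S f"
proof -
  have "continuous_on S (\<lambda>p. \<chi> i. f p $ i)" by (intro continuous_on_vec_lambda assms)
  then show ?thesis by simp
qed

lemma matrix_mult_entry: "(A ** B) $ k $ l = (\<Sum>q\<in>UNIV. A $ k $ q * B $ q $ l)"
  by (simp add: matrix_matrix_mult_def)

text \<open>An entry of a matrix product involves only one column of \<open>D\<close>. The sum is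
  enlarged to all entries, which is the growth form for a system indexed by pairs.\<close>

lemma sum_column_le:
  fixes D :: "real^'d^'d"
  assumes "\<And>q. \<bar>a q\<bar> \<le> C" "0 \<le> C"
  shows "\<bar>\<Sum>q\<in>UNIV. a q * D $ q $ l\<bar> \<le> C * (1 + (\<Sum>k\<in>UNIV. \<bar>D $ fst k $ snd k\<bar>))"
proof -
  have "\<bar>\<Sum>q\<in>UNIV. a q * D $ q $ l\<bar> \<le> (\<Sum>q\<in>UNIV. \<bar>a q * D $ q $ l\<bar>)" by (rule sum_abs)
  also have "\<dots> \<le> (\<Sum>q\<in>UNIV. C * \<bar>D $ q $ l\<bar>)" unfolding abs_mult by (intro sum_mono mult_right_mono assms) simp
  also have "\<dots> = C * (\<Sum>q\<in>UNIV. \<bar>D $ q $ l\<bar>)" by (simp add: sum_distrib_left)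
  also have "(\<Sum>q\<in>UNIV. \<bar>D $ q $ l\<bar>) = (\<Sum>k\<in>(\<lambda>q. (q, l)) ` UNIV. \<bar>D $ fst k $ snd k\<bar>)"
    by (subst sum.reindex) (auto simp: inj_on_def)
  also have "\<dots> \<le> (\<Sum>k\<in>UNIV. \<bar>D $ fst k $ snd k\<bar>)" by (rule sum_mono2) auto
  also have "C * (\<Sum>k\<in>UNIV. \<bar>D $ fst k $ snd k\<bar>) \<le> C * (1 + (\<Sum>k\<in>UNIV. \<bar>D $ fst k $ snd k\<bar>))"
    using assms(2) by (intro mult_left_mono) auto
  finally show ?thesis using assms(2) by (simp add: mult_left_mono)
qed

lemma norm_power4_le:
  fixes z :: "real^'d"
  shows "norm z ^ 4 \<le> real CARD('d) ^ 3 * (\<Sum>i\<in>UNIV. (z $ i) ^ 4)"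
proof -
  have "norm z ^ 4 \<le> (\<Sum>i\<in>UNIV. \<bar>z $ i\<bar>) ^ 4" by (rule power_mono[OF norm_le_l1_cart]) simp
  also have "\<dots> \<le> real CARD('d) ^ (4 - 1) * (\<Sum>i\<in>UNIV. \<bar>z $ i\<bar> ^ 4)" by (rule sum_power_le) auto
  finally show ?thesis by simp
qed

text \<open>The Cauchy-Schwarz step in pointwise form, a^2 b^2 <= a^4 + b^4. Nothing is lost in the
  order, since both fourth moments are of order d^2.\<close>

lemma product_power2_le:
  fixes a b d :: real
  assumes "0 < d"
  shows "((a / d) * b)\<^sup>2 \<le> (a ^ 4 + b ^ 4) / d\<^sup>2"
proof -
  have "0 \<le> (a\<^sup>2 - b\<^sup>2)\<^sup>2 + a ^ 4 + b ^ 4" by simp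
  then have "a\<^sup>2 * b\<^sup>2 \<le> a ^ 4 + b ^ 4" by (simp add: power2_eq_square power4_eq_xxxx algebra_simps)
  then show ?thesis using assms by (simp add: power_mult_distrib power_divide divide_right_mono)
qed

text \<open>The constant C is fixed here before any starting time is chosen, so every bound derived
  from it is uniform in the starting time.\<close>

locale sde_flow =
  fixes M :: "'w measure" and F :: "real \<Rightarrow> 'w measure" and T :: real
    and W :: "real \<Rightarrow> 'w \<Rightarrow> real^'d::finite"
    and \<mu> :: "real \<Rightarrow> real^'d \<Rightarrow> real^'d" and \<sigma> :: "real \<Rightarrow> real^'d \<Rightarrow> real^'d^'d"
    and Dmu :: "real \<Rightarrow> real^'d \<Rightarrow> real^'d^'d" and Dsig :: "'d \<Rightarrow> real \<Rightarrow> real^'d \<Rightarrow> real^'d^'d"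
    and C :: real
  assumes fps: "filtered_prob_space M F" and bm: "brownian_motion M F T W"
    and sa: "standing_assumption T \<mu> \<sigma> Dmu Dsig" and C: "0 < C"
    and \<mu>_growth: "\<And>r y i. r \<in> {0..T} \<Longrightarrow> \<bar>\<mu> r y $ i\<bar> \<le> C * (1 + (\<Sum>k\<in>UNIV. \<bar>y $ k\<bar>))"
    and \<sigma>_bound: "\<And>r y i j. r \<in> {0..T} \<Longrightarrow> \<bar>\<sigma> r y $ i $ j\<bar> \<le> C"
    and Dmu_bound: "\<And>r y i j. r \<in> {0..T} \<Longrightarrow> \<bar>Dmu r y $ i $ j\<bar> \<le> C"
    and Dsig_bound: "\<And>r y k i j. r \<in> {0..T} \<Longrightarrow> \<bar>Dsig k r y $ i $ j\<bar> \<le> C"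
    and inv_bound: "\<And>r y i j. r \<in> {0..T} \<Longrightarrow> \<bar>matrix_inv (\<sigma> r y) $ i $ j\<bar> \<le> C"
begin

sublocale drv: ito_driver M F T "\<lambda>r \<omega>. W r \<omega> $ j" for j
  by (rule brownian_motion_ito_driver[OF fps bm])

lemma sde_linear_growth:
  assumes X: "sde_solution M F W T \<mu> \<sigma> s x X" and s: "0 \<le> s" "s < T"
  shows "linear_growth_sde M F T (\<lambda>j r \<omega>. W r \<omega> $ j) (\<lambda>i r \<omega>. X r \<omega> $ i) (\<lambda>i r \<omega>. \<mu> r (X r \<omega>) $ i)
    (\<lambda>i j r \<omega>. \<sigma> r (X r \<omega>) $ i $ j) (\<lambda>i. x $ i) C s"
proof (rule linear_growth_sde.intro)
  have Xm: "X r \<in> borel_measurable (F r)" if "r \<in> {s..T}" for r using X that by (simp add: sde_solution_def)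
  have Xc: "continuous_on {s..T} (\<lambda>r. X r \<omega>)" if "\<omega> \<in> space M" for \<omega> using X that by (simp add: sde_solution_def)
  note ac = drv.adapted_continuous_composite[OF Xm Xc s(1)]
  show "ito_driver M F T (\<lambda>r \<omega>. W r \<omega> $ j)" for j by (rule brownian_motion_ito_driver[OF fps bm])
  show "0 \<le> s" "s < T" "0 < C" using s C by auto
  show "drv.adapted_continuous s T (\<lambda>r \<omega>. X r \<omega> $ i)" for i
    by (rule ac) (auto intro!: continuous_intros)
  show mc: "drv.adapted_continuous s T (\<lambda>r \<omega>. \<mu> r (X r \<omega>) $ i)" for i
    by (rule ac) (auto intro: standing_assumption_continuous(1)[OF sa])
  show "drv.adapted_continuous s T (\<lambda>r \<omega>. \<sigma> r (X r \<omega>) $ i $ j)" for i j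
    by (rule ac) (auto intro: standing_assumption_continuous(2)[OF sa])
  show "\<bar>\<mu> r (X r \<omega>) $ i\<bar> \<le> C * (1 + (\<Sum>k\<in>UNIV. \<bar>X r \<omega> $ k\<bar>))" if "r \<in> {s..T}" for i r \<omega>
    by (rule \<mu>_growth) (use that s in auto)
  show "\<bar>\<sigma> r (X r \<omega>) $ i $ j\<bar> \<le> C * (1 + (\<Sum>k\<in>UNIV. \<bar>X r \<omega> $ k\<bar>))" if "r \<in> {s..T}" for i j r \<omega>
  proof -
    have "\<bar>\<sigma> r (X r \<omega>) $ i $ j\<bar> \<le> C * 1" using \<sigma>_bound[of r "X r \<omega>" i j] that s by auto
    also have "\<dots> \<le> C * (1 + (\<Sum>k\<in>UNIV. \<bar>X r \<omega> $ k\<bar>))" using C by (intro mult_left_mono) (auto simp: sum_nonneg)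
    finally show ?thesis .
  qed
  fix i e assume e: "e \<in> {s..T}"
  have "AE \<omega> in M. X e \<omega> = x + (LINT r:{s..e}|lborel. \<mu> r (X r \<omega>)) + ito_vec M F W s e (\<lambda>r \<omega>'. \<sigma> r (X r \<omega>')) \<omega>"
    using X e by (simp add: sde_solution_def)
  then show "AE \<omega> in M. X e \<omega> $ i = x $ i + (LINT r:{s..e}|lborel. \<mu> r (X r \<omega>) $ i)
    + (\<Sum>j\<in>UNIV. ito_integral M F (\<lambda>r \<omega>. W r \<omega> $ j) s e (\<lambda>r \<omega>. \<sigma> r (X r \<omega>) $ i $ j) \<omega>)"
    using AE_space
  proof eventually_elim
    case (elim \<omega>)
    have "continuous_on {s..T} (\<lambda>r. \<mu> r (X r \<omega>))"
      by (rule continuous_on_vec_of_components) (rule drv.adapted_continuousD(3)[OF mc elim(2)])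
    then have "continuous_on {s..e} (\<lambda>r. \<mu> r (X r \<omega>))" by (rule continuous_on_subset) (use e in auto)
    from set_lint_vec_nth[OF this, of i] elim(1) show ?case by (simp add: ito_vec_def)
  qed
qed

text \<open>Given the path of \<open>X\<close>, the equation for \<open>D\<close> is linear with
  bounded coefficient matrices, so its d^2 entries form a system of linear growth with the unit
  matrix as initial value.\<close>

lemma variational_linear_growth:
  assumes X: "sde_solution M F W T \<mu> \<sigma> s x X" and D: "variational_solution M F W T Dmu Dsig s X D" and s: "0 \<le> s" "s < T"
  shows "linear_growth_sde M F T (\<lambda>j r \<omega>. W r \<omega> $ j) (\<lambda>k r \<omega>. D r \<omega> $ fst k $ snd k)
    (\<lambda>k r \<omega>. (Dmu r (X r \<omega>) ** D r \<omega>) $ fst k $ snd k)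
    (\<lambda>k j r \<omega>. (Dsig j r (X r \<omega>) ** D r \<omega>) $ fst k $ snd k) (\<lambda>k. mat 1 $ fst k $ snd k) C s"
proof (rule linear_growth_sde.intro)
  have Xm: "X r \<in> borel_measurable (F r)" if "r \<in> {s..T}" for r using X that by (simp add: sde_solution_def)
  have Xc: "continuous_on {s..T} (\<lambda>r. X r \<omega>)" if "\<omega> \<in> space M" for \<omega> using X that by (simp add: sde_solution_def)
  note ac = drv.adapted_continuous_composite[OF Xm Xc s(1)]
  show "ito_driver M F T (\<lambda>r \<omega>. W r \<omega> $ j)" for j by (rule brownian_motion_ito_driver[OF fps bm])
  show "0 \<le> s" "s < T" "0 < C" using s C by auto
  have Dc': "drv.adapted_continuous s T (\<lambda>r \<omega>. D r \<omega> $ k $ l)" for k l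
    using D unfolding drv.adapted_continuous_def variational_solution_def
    by (auto intro!: continuous_on_entry measurable_compose[OF _ borel_measurable_nth] measurable_compose[OF _ borel_measurable_continuous_onI[OF continuous_on_entry[OF continuous_on_id]]])
  then show "drv.adapted_continuous s T (\<lambda>r \<omega>. D r \<omega> $ fst k $ snd k)" for k .
  have mc: "drv.adapted_continuous s T (\<lambda>r \<omega>. (Dmu r (X r \<omega>) ** D r \<omega>) $ k $ l)" for k l
    unfolding matrix_mult_entry
    by (intro drv.adapted_continuous_sum drv.adapted_continuous_mult Dc' ac standing_assumption_continuous(3)[OF sa])
  then show "drv.adapted_continuous s T (\<lambda>r \<omega>. (Dmu r (X r \<omega>) ** D r \<omega>) $ fst k $ snd k)" for k .
  show "drv.adapted_continuous s T (\<lambda>r \<omega>. (Dsig j r (X r \<omega>) ** D r \<omega>) $ fst k $ snd k)" for j k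
    unfolding matrix_mult_entry
    by (intro drv.adapted_continuous_sum drv.adapted_continuous_mult Dc' ac standing_assumption_continuous(4)[OF sa])
  show "\<bar>(Dmu r (X r \<omega>) ** D r \<omega>) $ fst k $ snd k\<bar> \<le> C * (1 + (\<Sum>k\<in>UNIV. \<bar>D r \<omega> $ fst k $ snd k\<bar>))" if "r \<in> {s..T}" for k r \<omega>
    unfolding matrix_mult_entry by (rule sum_column_le[OF Dmu_bound]) (use that s C in auto)
  show "\<bar>(Dsig j r (X r \<omega>) ** D r \<omega>) $ fst k $ snd k\<bar> \<le> C * (1 + (\<Sum>k\<in>UNIV. \<bar>D r \<omega> $ fst k $ snd k\<bar>))" if "r \<in> {s..T}" for k j r \<omega>
    unfolding matrix_mult_entry by (rule sum_column_le[OF Dsig_bound]) (use that s C in auto)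
  fix k e assume e: "e \<in> {s..T}"
  have "AE \<omega> in M. D e \<omega> = mat 1 + (LINT r:{s..e}|lborel. Dmu r (X r \<omega>) ** D r \<omega>) + ito_mat M F W s e (\<lambda>j r \<omega>'. Dsig j r (X r \<omega>') ** D r \<omega>') \<omega>"
    using D e by (simp add: variational_solution_def)
  then show "AE \<omega> in M. D e \<omega> $ fst k $ snd k = mat 1 $ fst k $ snd k + (LINT r:{s..e}|lborel. (Dmu r (X r \<omega>) ** D r \<omega>) $ fst k $ snd k)
    + (\<Sum>j\<in>UNIV. ito_integral M F (\<lambda>r \<omega>. W r \<omega> $ j) s e (\<lambda>r \<omega>. (Dsig j r (X r \<omega>) ** D r \<omega>) $ fst k $ snd k) \<omega>)"
    using AE_space
  proof eventually_elim
    case (elim \<omega>)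
    have "continuous_on {s..T} (\<lambda>r. Dmu r (X r \<omega>) ** D r \<omega>)"
      by (intro continuous_on_vec_of_components drv.adapted_continuousD(3)[OF mc elim(2)])
    then have "continuous_on {s..e} (\<lambda>r. Dmu r (X r \<omega>) ** D r \<omega>)" by (rule continuous_on_subset) (use e in auto)
    from set_lint_mat_nth[OF this, of "fst k" "snd k"] elim(1) show ?case by (simp add: ito_mat_def)
  qed
qed

text \<open>The locale constant is taken with its explicit parameters, among which the starting time
  does not occur. Of the four dimension factors three compare the norm with coordinates and one
  counts the coordinates.\<close>

definition flow_const :: "real^'d \<Rightarrow> real" where
  "flow_const x = real CARD('d) ^ 4 * linear_growth_sde.increment_factor TYPE('d) T (\<lambda>i. x $ i) C"

text \<open>The eighth power of the dimension splits as 3 + 3 + 2: three factors to pass from the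
  norm to coordinates, three for the sum over the drivers, two for the number of entries.\<close>

definition weight_const :: real where
  "weight_const = real CARD('d) ^ 8 * (36 * (linear_growth_sde.growth TYPE('d \<times> 'd) C 4 *
     linear_growth_sde.bound4 TYPE('d) T (\<lambda>k::'d \<times> 'd. mat 1 $ fst k $ snd k) C))"

lemma flow_increment_fourth_moment:
  assumes X: "sde_solution M F W T \<mu> \<sigma> s x X" and s: "0 \<le> s" "e \<in> {s<..T}"
  shows "X e \<in> borel_measurable M" "0 \<le> flow_const x"
    "(\<integral>\<^sup>+\<omega>. ennreal (norm (X e \<omega> - x) ^ 4) \<partial>M) \<le> ennreal (flow_const x * (e - s)\<^sup>2)"
proof -
  have sT: "s < T" using s by auto
  interpret v: linear_growth_sde M F T "\<lambda>j r \<omega>. W r \<omega> $ j" "\<lambda>i r \<omega>. X r \<omega> $ i" "\<lambda>i r \<omega>. \<mu> r (X r \<omega>) $ i"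
    "\<lambda>i j r \<omega>. \<sigma> r (X r \<omega>) $ i $ j" "\<lambda>i. x $ i" C s
    by (rule sde_linear_growth[OF X s(1) sT])
  have "X e \<in> borel_measurable (F e)" using X s by (auto simp: sde_solution_def)
  then show Xm[measurable]: "X e \<in> borel_measurable M"
    by (rule borel_measurable_subalgebra) (use drv.subalgebra drv.space_F in auto)
  have [measurable]: "(\<lambda>\<omega>. X e \<omega> $ i) \<in> borel_measurable M" for i
    by (rule measurable_compose[OF Xm borel_measurable_nth])
  show "0 \<le> flow_const x" unfolding flow_const_def using v.increment_factor_nonneg by simp
  have "(\<integral>\<^sup>+\<omega>. ennreal (norm (X e \<omega> - x) ^ 4) \<partial>M) \<le> (\<integral>\<^sup>+\<omega>. ennreal (real CARD('d) ^ 3) * (\<Sum>i\<in>UNIV. ennreal ((X e \<omega> $ i - x $ i) ^ 4)) \<partial>M)"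
  proof (rule nn_integral_mono)
    fix \<omega>
    have "ennreal (norm (X e \<omega> - x) ^ 4) \<le> ennreal (real CARD('d) ^ 3 * (\<Sum>i\<in>UNIV. ((X e \<omega> - x) $ i) ^ 4))"
      by (rule ennreal_leI[OF norm_power4_le])
    then show "ennreal (norm (X e \<omega> - x) ^ 4) \<le> ennreal (real CARD('d) ^ 3) * (\<Sum>i\<in>UNIV. ennreal ((X e \<omega> $ i - x $ i) ^ 4))"
      by (simp add: ennreal_mult')
  qed
  also have "\<dots> = ennreal (real CARD('d) ^ 3) * (\<Sum>i\<in>UNIV. \<integral>\<^sup>+\<omega>. ennreal ((X e \<omega> $ i - x $ i) ^ 4) \<partial>M)"
    by (simp add: nn_integral_cmult nn_integral_sum del: sum_ennreal)
  also have "\<dots> \<le> ennreal (real CARD('d) ^ 3) * (\<Sum>i\<in>(UNIV::'d set). ennreal (v.increment_factor * (e - s)\<^sup>2))"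
    by (intro mult_left_mono sum_mono v.fourth_moment_increment s(2)) simp
  also have "\<dots> = ennreal (flow_const x * (e - s)\<^sup>2)"
  proof -
    have "0 \<le> v.increment_factor * (e - s)\<^sup>2" using v.increment_factor_nonneg by simp
    then show ?thesis
      unfolding sum_ennreal[OF \<open>0 \<le> v.increment_factor * (e - s)\<^sup>2\<close>] ennreal_mult'[OF zero_le_power[OF of_nat_0_le_iff], symmetric]
      by (simp add: flow_const_def power_numeral_reduce mult_ac)
  qed
  finally show "(\<integral>\<^sup>+\<omega>. ennreal (norm (X e \<omega> - x) ^ 4) \<partial>M) \<le> ennreal (flow_const x * (e - s)\<^sup>2)" .
qed

text \<open>Since the entries of the inverse of \<sigma> are bounded, the entries of the weight grow
  linearly in \<open>D\<close> with the same C as the coefficients. The integral bound for processes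
  dominated by \<open>npow 4\<close> therefore applies to them.\<close>

lemma weight_fourth_moment:
  fixes s e :: real
  defines "Z X D \<equiv> ito_vec M F W s e (\<lambda>r \<omega>'. transpose (matrix_inv (\<sigma> r (X r \<omega>')) ** D r \<omega>'))"
  assumes X: "sde_solution M F W T \<mu> \<sigma> s x X" and D: "variational_solution M F W T Dmu Dsig s X D" and s: "0 \<le> s" "e \<in> {s<..T}"
  shows "(\<lambda>\<omega>. norm (Z X D \<omega>)) \<in> borel_measurable M" "0 \<le> weight_const"
    "(\<integral>\<^sup>+\<omega>. ennreal (norm (Z X D \<omega>) ^ 4) \<partial>M) \<le> ennreal (weight_const * (e - s)\<^sup>2)"
proof -
  have sT: "s < T" using s by auto
  interpret v: linear_growth_sde M F T "\<lambda>j r \<omega>. W r \<omega> $ j" "\<lambda>k r \<omega>. D r \<omega> $ fst k $ snd k"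
    "\<lambda>k r \<omega>. (Dmu r (X r \<omega>) ** D r \<omega>) $ fst k $ snd k"
    "\<lambda>k j r \<omega>. (Dsig j r (X r \<omega>) ** D r \<omega>) $ fst k $ snd k" "\<lambda>k. mat 1 $ fst k $ snd k" C s
    by (rule variational_linear_growth[OF X D s(1) sT])
  have Xm: "X r \<in> borel_measurable (F r)" if "r \<in> {s..T}" for r using X that by (simp add: sde_solution_def)
  have Xc: "continuous_on {s..T} (\<lambda>r. X r \<omega>)" if "\<omega> \<in> space M" for \<omega> using X that by (simp add: sde_solution_def)
  \<comment> \<open>The indices are exchanged because the weight integrates the transposed
    matrix.\<close>
  define H where "H = (\<lambda>i j r \<omega>. (matrix_inv (\<sigma> r (X r \<omega>)) ** D r \<omega>) $ j $ i)"
  define I where "I = (\<lambda>i j. ito_integral M F (\<lambda>r \<omega>. W r \<omega> $ j) s e (H i j))"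
  have Dc: "drv.adapted_continuous s T (\<lambda>r \<omega>. D r \<omega> $ k $ l)" for k l using v.U[of "(k, l)"] by simp
  have H: "drv.adapted_continuous s T (H i j)" for i j
    unfolding H_def matrix_mult_entry
    by (intro drv.adapted_continuous_sum drv.adapted_continuous_mult Dc
        drv.adapted_continuous_composite[OF Xm Xc s(1)] standing_assumption_continuous(5)[OF sa])
  have H4: "H i j r \<omega> ^ 4 \<le> v.growth 4 * v.npow 4 r \<omega>" if "r \<in> {s..T}" for i j r \<omega>
  proof (rule v.coefficient_power_le)
    have r: "r \<in> {0..T}" using that s by auto
    show "\<bar>H i j r \<omega>\<bar> \<le> C * (1 + (\<Sum>k\<in>UNIV. \<bar>D r \<omega> $ fst k $ snd k\<bar>))"
      unfolding H_def matrix_mult_entry by (rule sum_column_le[OF inv_bound[OF r]]) (use C in simp)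
  qed simp
  note I = v.ito_fourth_moment_npow[OF H less_imp_le[OF v.growth_pos] H4 s(2), folded I_def]
  have Im[measurable]: "I i j \<in> borel_measurable M" for i j using I(1)[of j i j] by (simp add: is_ito_integral_def I_def)
  have Zi: "Z X D \<omega> $ i = (\<Sum>j\<in>UNIV. I i j \<omega>)" for \<omega> i
    by (simp add: Z_def ito_vec_def I_def H_def transpose_def)
  have norm_Z: "norm (Z X D \<omega>) = sqrt (\<Sum>i\<in>UNIV. (\<Sum>j\<in>UNIV. I i j \<omega>)\<^sup>2)" for \<omega>
    by (simp add: norm_vec_def L2_set_def Zi)
  show "(\<lambda>\<omega>. norm (Z X D \<omega>)) \<in> borel_measurable M" unfolding norm_Z by measurable
  have gb: "0 \<le> v.growth 4 * v.bound4" using v.growth_pos[of 4] v.bound4_pos by simp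
  then show "0 \<le> weight_const" unfolding weight_const_def
    by (intro mult_nonneg_nonneg[OF zero_le_power[OF of_nat_0_le_iff] mult_nonneg_nonneg[OF _ gb]]) simp
  have "(\<integral>\<^sup>+\<omega>. ennreal (norm (Z X D \<omega>) ^ 4) \<partial>M) \<le>
    (\<integral>\<^sup>+\<omega>. (\<Sum>i\<in>UNIV. \<Sum>j\<in>UNIV. ennreal (real CARD('d) ^ 6) * ennreal (I i j \<omega> ^ 4)) \<partial>M)"
  proof (rule nn_integral_mono)
    fix \<omega>
    have "norm (Z X D \<omega>) ^ 4 \<le> real CARD('d) ^ 3 * (\<Sum>i\<in>UNIV. (\<Sum>j\<in>UNIV. I i j \<omega>) ^ 4)"
      using norm_power4_le[of "Z X D \<omega>"] by (simp add: Zi)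
    also have "\<dots> \<le> real CARD('d) ^ 3 * (\<Sum>i\<in>UNIV. real CARD('d) ^ (4 - 1) * (\<Sum>j\<in>UNIV. I i j \<omega> ^ 4))"
      by (intro mult_left_mono sum_mono sum_power_le) auto
    also have "\<dots> = (\<Sum>i\<in>UNIV. \<Sum>j\<in>UNIV. real CARD('d) ^ 6 * I i j \<omega> ^ 4)"
      by (simp add: sum_distrib_left mult.assoc[symmetric] flip: power_add)
    finally have "ennreal (norm (Z X D \<omega>) ^ 4) \<le> ennreal (\<Sum>i\<in>UNIV. \<Sum>j\<in>UNIV. real CARD('d) ^ 6 * I i j \<omega> ^ 4)" by (rule ennreal_leI)
    also have "\<dots> = (\<Sum>i\<in>UNIV. \<Sum>j\<in>UNIV. ennreal (real CARD('d) ^ 6) * ennreal (I i j \<omega> ^ 4))"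
      by (simp add: sum_ennreal[symmetric] sum_nonneg ennreal_mult')
    finally show "ennreal (norm (Z X D \<omega>) ^ 4) \<le> (\<Sum>i\<in>UNIV. \<Sum>j\<in>UNIV. ennreal (real CARD('d) ^ 6) * ennreal (I i j \<omega> ^ 4))" .
  qed
  also have "\<dots> = (\<Sum>i\<in>UNIV. \<Sum>j\<in>UNIV. ennreal (real CARD('d) ^ 6) * (\<integral>\<^sup>+\<omega>. ennreal (I i j \<omega> ^ 4) \<partial>M))"
    by (simp add: nn_integral_cmult nn_integral_sum)
  also have "\<dots> \<le> (\<Sum>i\<in>(UNIV::'d set). \<Sum>j\<in>(UNIV::'d set). ennreal (real CARD('d) ^ 6) * ennreal (36 * (v.growth 4 * v.bound4) * (e - s)\<^sup>2))"
    unfolding I_def by (intro sum_mono mult_left_mono I(2)) auto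
  also have "\<dots> = ennreal (\<Sum>i\<in>(UNIV::'d set). \<Sum>j\<in>(UNIV::'d set). real CARD('d) ^ 6 * (36 * (v.growth 4 * v.bound4) * (e - s)\<^sup>2))"
  proof -
    have "0 \<le> 36 * (v.growth 4 * v.bound4) * (e - s)\<^sup>2" using gb by (intro mult_nonneg_nonneg[OF mult_nonneg_nonneg]) auto
    then have c: "0 \<le> real CARD('d) ^ 6 * (36 * (v.growth 4 * v.bound4) * (e - s)\<^sup>2)"
      by (rule mult_nonneg_nonneg[OF zero_le_power[OF of_nat_0_le_iff]])
    then have "0 \<le> (\<Sum>j\<in>(UNIV::'d set). real CARD('d) ^ 6 * (36 * (v.growth 4 * v.bound4) * (e - s)\<^sup>2))" by (intro sum_nonneg)
    from sum_ennreal[OF this] show ?thesis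
      unfolding ennreal_mult'[OF zero_le_power[OF of_nat_0_le_iff], symmetric] sum_ennreal[OF c] .
  qed
  also have "\<dots> = ennreal (weight_const * (e - s)\<^sup>2)"
    by (simp add: weight_const_def power_numeral_reduce mult_ac)
  finally show "(\<integral>\<^sup>+\<omega>. ennreal (norm (Z X D \<omega>) ^ 4) \<partial>M) \<le> ennreal (weight_const * (e - s)\<^sup>2)" .
qed

text \<open>The common core of both claims: \<Phi> stands for the increment of g, or of f in time
  and space. After division by d^2 the moments of \<open>X\<close> and of the weight leave constants
  and the time increment leaves d^2 <= T^2, so the bound depends neither on the starting nor on the
  final time.\<close>

lemma weighted_increment_bound:
  fixes \<Phi> :: "'w \<Rightarrow> real"
  assumes X: "sde_solution M F W T \<mu> \<sigma> s x X" and D: "variational_solution M F W T Dmu Dsig s X D" and s: "0 \<le> s" "e \<in> {s<..T}"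
    and \<Phi>: "\<And>\<omega>. \<bar>\<Phi> \<omega>\<bar> \<le> L * ((e - s) + norm (X e \<omega> - x))" and L: "0 \<le> L"
  shows "(\<integral>\<^sup>+\<omega>. ennreal ((norm ((\<Phi> \<omega> / (e - s)) *\<^sub>R
      ito_vec M F W s e (\<lambda>r \<omega>'. transpose (matrix_inv (\<sigma> r (X r \<omega>')) ** D r \<omega>')) \<omega>))\<^sup>2) \<partial>M)
    \<le> ennreal (8 * L ^ 4 * (T\<^sup>2 + flow_const x) + weight_const)"
proof -
  define Z where "Z = ito_vec M F W s e (\<lambda>r \<omega>'. transpose (matrix_inv (\<sigma> r (X r \<omega>')) ** D r \<omega>'))"
  note X4 = flow_increment_fourth_moment[OF X s] and Z4 = weight_fourth_moment[OF X D s, folded Z_def]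
  note [measurable] = X4(1) Z4(1)
  define d where "d = e - s"
  have d: "0 < d" "d \<le> T" using s by (auto simp: d_def)
  have "(\<integral>\<^sup>+\<omega>. ennreal ((norm ((\<Phi> \<omega> / (e - s)) *\<^sub>R Z \<omega>))\<^sup>2) \<partial>M) \<le>
    (\<integral>\<^sup>+\<omega>. ennreal (8 * L ^ 4 * d\<^sup>2) + ennreal (8 * L ^ 4 / d\<^sup>2) * ennreal (norm (X e \<omega> - x) ^ 4) + ennreal (1 / d\<^sup>2) * ennreal (norm (Z \<omega>) ^ 4) \<partial>M)"
  proof (rule nn_integral_mono)
    fix \<omega>
    let ?y = "norm (X e \<omega> - x)"
    have "\<Phi> \<omega> ^ 4 = \<bar>\<Phi> \<omega>\<bar> ^ 4" by simp
    also have "\<dots> \<le> (L * (d + ?y)) ^ 4" unfolding d_def by (rule power_mono[OF \<Phi>]) simp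
    also have "\<dots> = L ^ 4 * (d + ?y) ^ 4" by (simp add: power_mult_distrib)
    \<comment> \<open>The factor 8 = 2^3 is the power mean constant for two summands.\<close>
    also have "(d + ?y) ^ 4 \<le> 8 * (d ^ 4 + ?y ^ 4)"
      using sum_power_le[of "{0, 1::nat}" 4 "\<lambda>k. if k = 0 then d else ?y"] by simp
    finally have \<Phi>4: "\<Phi> \<omega> ^ 4 \<le> L ^ 4 * (8 * (d ^ 4 + ?y ^ 4))" by (simp add: mult_left_mono)
    have "(norm ((\<Phi> \<omega> / d) *\<^sub>R Z \<omega>))\<^sup>2 = ((\<Phi> \<omega> / d) * norm (Z \<omega>))\<^sup>2" by (simp add: power_mult_distrib power_divide)
    also have "\<dots> \<le> (\<Phi> \<omega> ^ 4 + norm (Z \<omega>) ^ 4) / d\<^sup>2" by (rule product_power2_le[OF d(1)])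
    also have "\<dots> \<le> (L ^ 4 * (8 * (d ^ 4 + ?y ^ 4)) + norm (Z \<omega>) ^ 4) / d\<^sup>2"
      using \<Phi>4 by (intro divide_right_mono) auto
    also have "\<dots> = 8 * L ^ 4 * d\<^sup>2 + (8 * L ^ 4 / d\<^sup>2) * ?y ^ 4 + (1 / d\<^sup>2) * norm (Z \<omega>) ^ 4"
      using d by (simp add: field_simps power2_eq_square power4_eq_xxxx)
    finally have "ennreal ((norm ((\<Phi> \<omega> / d) *\<^sub>R Z \<omega>))\<^sup>2) \<le> ennreal (8 * L ^ 4 * d\<^sup>2 + (8 * L ^ 4 / d\<^sup>2) * ?y ^ 4 + (1 / d\<^sup>2) * norm (Z \<omega>) ^ 4)"
      by (rule ennreal_leI)
    also have "\<dots> = ennreal (8 * L ^ 4 * d\<^sup>2) + ennreal ((8 * L ^ 4 / d\<^sup>2) * ?y ^ 4) + ennreal ((1 / d\<^sup>2) * norm (Z \<omega>) ^ 4)"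
      by (simp add: ennreal_plus)
    also have "ennreal ((8 * L ^ 4 / d\<^sup>2) * ?y ^ 4) = ennreal (8 * L ^ 4 / d\<^sup>2) * ennreal (?y ^ 4)" by (rule ennreal_mult') simp
    also have "ennreal ((1 / d\<^sup>2) * norm (Z \<omega>) ^ 4) = ennreal (1 / d\<^sup>2) * ennreal (norm (Z \<omega>) ^ 4)" by (rule ennreal_mult') simp
    finally show "ennreal ((norm ((\<Phi> \<omega> / (e - s)) *\<^sub>R Z \<omega>))\<^sup>2) \<le> ennreal (8 * L ^ 4 * d\<^sup>2) + ennreal (8 * L ^ 4 / d\<^sup>2) * ennreal (?y ^ 4) + ennreal (1 / d\<^sup>2) * ennreal (norm (Z \<omega>) ^ 4)"
      by (simp add: d_def)
  qed
  also have "\<dots> = ennreal (8 * L ^ 4 * d\<^sup>2) + ennreal (8 * L ^ 4 / d\<^sup>2) * (\<integral>\<^sup>+\<omega>. ennreal (norm (X e \<omega> - x) ^ 4) \<partial>M) + ennreal (1 / d\<^sup>2) * (\<integral>\<^sup>+\<omega>. ennreal (norm (Z \<omega>) ^ 4) \<partial>M)"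
    by (simp add: nn_integral_add nn_integral_cmult drv.emeasure_space_1)
  also have "\<dots> \<le> ennreal (8 * L ^ 4 * d\<^sup>2) + ennreal (8 * L ^ 4 / d\<^sup>2) * ennreal (flow_const x * d\<^sup>2) + ennreal (1 / d\<^sup>2) * ennreal (weight_const * d\<^sup>2)"
    using X4(3) Z4(3) by (intro add_mono mult_left_mono) (auto simp: d_def)
  also have "\<dots> = ennreal (8 * L ^ 4 * d\<^sup>2 + 8 * L ^ 4 * flow_const x + weight_const)"
  proof -
    have "ennreal (8 * L ^ 4 / d\<^sup>2) * ennreal (flow_const x * d\<^sup>2) = ennreal (8 * L ^ 4 * flow_const x)"
      by (subst ennreal_mult'[symmetric]) (use d in \<open>auto simp: mult.assoc\<close>)
    moreover have "ennreal (1 / d\<^sup>2) * ennreal (weight_const * d\<^sup>2) = ennreal weight_const"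
      by (subst ennreal_mult'[symmetric]) (use d in auto)
    ultimately show ?thesis using X4(2) Z4(2) by (simp add: ennreal_plus)
  qed
  also have "\<dots> \<le> ennreal (8 * L ^ 4 * (T\<^sup>2 + flow_const x) + weight_const)"
  proof (rule ennreal_leI)
    have "8 * L ^ 4 * d\<^sup>2 \<le> 8 * L ^ 4 * T\<^sup>2" using d by (intro mult_left_mono power_mono) auto
    then show "8 * L ^ 4 * d\<^sup>2 + 8 * L ^ 4 * flow_const x + weight_const \<le> 8 * L ^ 4 * (T\<^sup>2 + flow_const x) + weight_const"
      by (simp add: distrib_left)
  qed
  finally show ?thesis by (simp add: Z_def)
qed

end

section \<open>Lipschitz bounds and the two claims\<close>

lemma gradient_bound_Lipschitz:
  fixes g :: "real^'d \<Rightarrow> real"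
  assumes der: "\<And>y. (g has_derivative (\<lambda>h. Dg y \<bullet> h)) (at y)" and C: "\<And>y. norm (Dg y) \<le> C"
  shows "\<bar>g y - g z\<bar> \<le> C * norm (y - z)"
proof -
  have "0 \<le> C" using C[of 0] norm_ge_zero order.trans by blast
  have "norm (g y - g z) \<le> C * norm (y - z)"
  proof (rule differentiable_bound[OF convex_UNIV])
    show "(g has_derivative (\<lambda>h. Dg x \<bullet> h)) (at x within UNIV)" for x using der by simp
    show "onorm (\<lambda>h. Dg x \<bullet> h) \<le> C" for x
    proof (rule onorm_bound[OF \<open>0 \<le> C\<close>])
      fix h
      have "norm (Dg x \<bullet> h) \<le> norm (Dg x) * norm h" by (simp add: Cauchy_Schwarz_ineq2)
      also have "\<dots> \<le> C * norm h" by (intro mult_right_mono C) simp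
      finally show "norm (Dg x \<bullet> h) \<le> C * norm h" .
    qed
  qed auto
  then show ?thesis by simp
qed

text \<open>The mean value inequality on the convex strip. The factor 2 arises because the time part
  and the space part of the derivative are each estimated by C times the norm of the pair.\<close>

lemma space_time_gradient_bound_Lipschitz:
  fixes f :: "real \<Rightarrow> real^'d \<Rightarrow> real"
  assumes der: "\<And>s y. s \<in> {0..T} \<Longrightarrow> ((\<lambda>p. f (fst p) (snd p)) has_derivative (\<lambda>(h,k). h * ft s y + fx s y \<bullet> k)) (at (s,y) within {0..T} \<times> UNIV)"
    and C: "\<And>s y. s \<in> {0..T} \<Longrightarrow> \<bar>ft s y\<bar> \<le> C \<and> norm (fx s y) \<le> C" and s: "s \<in> {0..T}" "s' \<in> {0..T}"
  shows "\<bar>f s y - f s' z\<bar> \<le> 2 * C * (\<bar>s - s'\<bar> + norm (y - z))"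
proof -
  have C0: "0 \<le> C" using C[OF s(1), of 0] abs_ge_zero order.trans by blast
  let ?f = "\<lambda>p. f (fst p) (snd p)"
  have "norm (?f (s, y) - ?f (s', z)) \<le> 2 * C * norm ((s, y) - (s', z))"
  proof (rule differentiable_bound[where S="{0..T} \<times> UNIV"])
    show "convex ({0..T} \<times> (UNIV :: (real^'d) set))" by (intro convex_Times convex_UNIV convex_real_interval)
    fix p :: "real \<times> (real^'d)" assume p: "p \<in> {0..T} \<times> UNIV"
    then have p1: "fst p \<in> {0..T}" by auto
    show "(?f has_derivative (\<lambda>(h,k). h * ft (fst p) (snd p) + fx (fst p) (snd p) \<bullet> k)) (at p within {0..T} \<times> UNIV)"
      using der[OF p1, of "snd p"] by simp
    show "onorm (\<lambda>(h,k). h * ft (fst p) (snd p) + fx (fst p) (snd p) \<bullet> k) \<le> 2 * C"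
    proof (rule onorm_bound)
      fix q :: "real \<times> (real^'d)"
      obtain h k where q: "q = (h, k)" by (cases q)
      have "\<bar>h * ft (fst p) (snd p) + fx (fst p) (snd p) \<bullet> k\<bar> \<le> \<bar>h\<bar> * \<bar>ft (fst p) (snd p)\<bar> + norm (fx (fst p) (snd p)) * norm k"
        using Cauchy_Schwarz_ineq2[of "fx (fst p) (snd p)" k] abs_triangle_ineq[of "h * ft (fst p) (snd p)" "fx (fst p) (snd p) \<bullet> k"]
        by (simp add: abs_mult)
      also have "\<dots> \<le> norm q * C + C * norm q"
        using C[OF p1, of "snd p"] C0 norm_fst_le[of h k] norm_snd_le[of k h] by (intro add_mono mult_mono) (auto simp: q)
      finally show "norm (case q of (h, k) \<Rightarrow> h * ft (fst p) (snd p) + fx (fst p) (snd p) \<bullet> k) \<le> 2 * C * norm q"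
        by (simp add: q algebra_simps)
    qed (use C0 in simp)
  qed (use s in auto)
  also have "\<dots> \<le> 2 * C * (\<bar>s - s'\<bar> + norm (y - z))"
    using norm_Pair_le[of "s - s'" "y - z"] C0 by (intro mult_left_mono) auto
  finally show ?thesis by simp
qed

theorem theorem3p2:
  fixes M :: "'w measure" and F :: "real \<Rightarrow> 'w measure" and T :: real
    and W :: "real \<Rightarrow> 'w \<Rightarrow> real^'d::finite"
    and \<mu> :: "real \<Rightarrow> real^'d \<Rightarrow> real^'d" and \<sigma> :: "real \<Rightarrow> real^'d \<Rightarrow> real^'d^'d"
    and Dmu :: "real \<Rightarrow> real^'d \<Rightarrow> real^'d^'d" and Dsig :: "'d \<Rightarrow> real \<Rightarrow> real^'d \<Rightarrow> real^'d^'d"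
    and X :: "real \<Rightarrow> real^'d \<Rightarrow> real \<Rightarrow> 'w \<Rightarrow> real^'d"
    and D :: "real \<Rightarrow> real^'d \<Rightarrow> real \<Rightarrow> 'w \<Rightarrow> real^'d^'d"
    and g :: "real^'d \<Rightarrow> real" and Dg :: "real^'d \<Rightarrow> real^'d"
    and f :: "real \<Rightarrow> real^'d \<Rightarrow> real" and ft :: "real \<Rightarrow> real^'d \<Rightarrow> real"
    and fx :: "real \<Rightarrow> real^'d \<Rightarrow> real^'d"
    and t :: real and x :: "real^'d"
  assumes "0 < T"
    and "filtered_prob_space M F"
    and "brownian_motion M F T W"
    and "standing_assumption T \<mu> \<sigma> Dmu Dsig"
    and "\<And>s y. s \<in> {0..T} \<Longrightarrow> sde_solution M F W T \<mu> \<sigma> s y (X s y)"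
    and "\<And>s y. s \<in> {0..T} \<Longrightarrow> variational_solution M F W T Dmu Dsig s (X s y) (D s y)"
    and "\<And>y. (g has_derivative (\<lambda>h. Dg y \<bullet> h)) (at y)"
    and "continuous_on UNIV Dg" and "\<exists>C. \<forall>y. norm (Dg y) \<le> C"
    and "\<And>s y. s \<in> {0..T} \<Longrightarrow>
           ((\<lambda>p. f (fst p) (snd p)) has_derivative (\<lambda>(h,k). h * ft s y + fx s y \<bullet> k))
             (at (s,y) within {0..T} \<times> UNIV)"
    and "continuous_on ({0..T} \<times> UNIV) (\<lambda>p. ft (fst p) (snd p))"
    and "continuous_on ({0..T} \<times> UNIV) (\<lambda>p. fx (fst p) (snd p))"
    and "\<exists>C. \<forall>s\<in>{0..T}. \<forall>y. \<bar>ft s y\<bar> \<le> C \<and> norm (fx s y) \<le> C"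
    and "t \<in> {0..<T}"
  shows "((SUP s\<in>{t..<T}. \<integral>\<^sup>+\<omega>. ennreal ((norm
            (((g (X s x T \<omega>) - g x) / (T - s)) *\<^sub>R
               ito_vec M F W s T (\<lambda>r \<omega>'. transpose (matrix_inv (\<sigma> r (X s x r \<omega>')) ** D s x r \<omega>')) \<omega>))\<^sup>2) \<partial>M)
           < \<infinity>) \<and>
         ((\<integral>\<^sup>+s\<in>{t..T}. (\<integral>\<^sup>+\<omega>. ennreal ((norm
            (((f s (X t x s \<omega>) - f t x) / (s - t)) *\<^sub>R
               ito_vec M F W t s (\<lambda>r \<omega>'. transpose (matrix_inv (\<sigma> r (X t x r \<omega>')) ** D t x r \<omega>')) \<omega>))\<^sup>2) \<partial>M) \<partial>lborel)
           < \<infinity>)"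
proof -
  obtain C where "0 < C"
    "\<And>r y i. r \<in> {0..T} \<Longrightarrow> \<bar>\<mu> r y $ i\<bar> \<le> C * (1 + (\<Sum>k\<in>UNIV. \<bar>y $ k\<bar>))"
    "\<And>r y i j. r \<in> {0..T} \<Longrightarrow> \<bar>\<sigma> r y $ i $ j\<bar> \<le> C"
    "\<And>r y i j. r \<in> {0..T} \<Longrightarrow> \<bar>Dmu r y $ i $ j\<bar> \<le> C"
    "\<And>r y k i j. r \<in> {0..T} \<Longrightarrow> \<bar>Dsig k r y $ i $ j\<bar> \<le> C"
    "\<And>r y i j. r \<in> {0..T} \<Longrightarrow> \<bar>matrix_inv (\<sigma> r y) $ i $ j\<bar> \<le> C"
    by (rule standing_assumption_bounds[OF assms(4)]) (rule that)
  then interpret sde_flow M F T W \<mu> \<sigma> Dmu Dsig C using assms(2-4) by unfold_locales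
  obtain Cg where Cg: "\<And>y. norm (Dg y) \<le> Cg" using assms(9) by blast
  obtain Cf where Cf: "\<And>s y. s \<in> {0..T} \<Longrightarrow> \<bar>ft s y\<bar> \<le> Cf \<and> norm (fx s y) \<le> Cf" using assms(13) by blast
  have t: "0 \<le> t" "t < T" using assms(14) by auto
  have Cg0: "0 \<le> Cg" using Cg[of 0] norm_ge_zero order.trans by blast
  have Cf0: "0 \<le> 2 * Cf" using Cf[of t 0] t by auto
  \<comment> \<open>The bound of \<open>weighted_increment_bound\<close> as a function of the
    Lipschitz constant alone: \<open>Cg\<close> for the first claim, \<open>2 * Cf\<close> for the
    second.\<close>
  define K where "K = (\<lambda>L. 8 * L ^ 4 * (T\<^sup>2 + flow_const x) + weight_const)"
  show ?thesis
  proof (intro conjI)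
    have "(SUP s\<in>{t..<T}. \<integral>\<^sup>+\<omega>. ennreal ((norm (((g (X s x T \<omega>) - g x) / (T - s)) *\<^sub>R
        ito_vec M F W s T (\<lambda>r \<omega>'. transpose (matrix_inv (\<sigma> r (X s x r \<omega>')) ** D s x r \<omega>')) \<omega>))\<^sup>2) \<partial>M) \<le> ennreal (K Cg)"
    proof (rule SUP_least)
      fix s assume "s \<in> {t..<T}"
      then have s: "s \<in> {0..T}" "0 \<le> s" "T \<in> {s<..T}" using t by auto
      show "(\<integral>\<^sup>+\<omega>. ennreal ((norm (((g (X s x T \<omega>) - g x) / (T - s)) *\<^sub>R
        ito_vec M F W s T (\<lambda>r \<omega>'. transpose (matrix_inv (\<sigma> r (X s x r \<omega>')) ** D s x r \<omega>')) \<omega>))\<^sup>2) \<partial>M) \<le> ennreal (K Cg)"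
        unfolding K_def
      proof (rule weighted_increment_bound[OF assms(5)[OF s(1)] assms(6)[OF s(1)] s(2,3) _ Cg0])
        fix \<omega>
        have "\<bar>g (X s x T \<omega>) - g x\<bar> \<le> Cg * norm (X s x T \<omega> - x)" by (rule gradient_bound_Lipschitz[OF assms(7) Cg])
        also have "\<dots> \<le> Cg * ((T - s) + norm (X s x T \<omega> - x))" using s Cg0 by (intro mult_left_mono) auto
        finally show "\<bar>g (X s x T \<omega>) - g x\<bar> \<le> Cg * ((T - s) + norm (X s x T \<omega> - x))" .
      qed
    qed
    then show "(SUP s\<in>{t..<T}. \<integral>\<^sup>+\<omega>. ennreal ((norm (((g (X s x T \<omega>) - g x) / (T - s)) *\<^sub>R
        ito_vec M F W s T (\<lambda>r \<omega>'. transpose (matrix_inv (\<sigma> r (X s x r \<omega>')) ** D s x r \<omega>')) \<omega>))\<^sup>2) \<partial>M) < \<infinity>"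
      by (rule le_less_trans) simp
    have tT: "t \<in> {0..T}" using t by auto
    have "(\<integral>\<^sup>+s\<in>{t..T}. (\<integral>\<^sup>+\<omega>. ennreal ((norm (((f s (X t x s \<omega>) - f t x) / (s - t)) *\<^sub>R
        ito_vec M F W t s (\<lambda>r \<omega>'. transpose (matrix_inv (\<sigma> r (X t x r \<omega>')) ** D t x r \<omega>')) \<omega>))\<^sup>2) \<partial>M) \<partial>lborel)
      \<le> (\<integral>\<^sup>+s. ennreal (K (2 * Cf)) * indicator {t..T} s \<partial>lborel)"
    proof (rule nn_integral_mono)
      fix s :: real
      show "(\<integral>\<^sup>+\<omega>. ennreal ((norm (((f s (X t x s \<omega>) - f t x) / (s - t)) *\<^sub>R
        ito_vec M F W t s (\<lambda>r \<omega>'. transpose (matrix_inv (\<sigma> r (X t x r \<omega>')) ** D t x r \<omega>')) \<omega>))\<^sup>2) \<partial>M) * indicator {t..T} s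
        \<le> ennreal (K (2 * Cf)) * indicator {t..T} s"
      proof (cases "s \<in> {t<..T}")
        case True
        then have s: "s \<in> {0..T}" using t by auto
        have "(\<integral>\<^sup>+\<omega>. ennreal ((norm (((f s (X t x s \<omega>) - f t x) / (s - t)) *\<^sub>R
          ito_vec M F W t s (\<lambda>r \<omega>'. transpose (matrix_inv (\<sigma> r (X t x r \<omega>')) ** D t x r \<omega>')) \<omega>))\<^sup>2) \<partial>M) \<le> ennreal (K (2 * Cf))"
          unfolding K_def
        proof (rule weighted_increment_bound[OF assms(5)[OF tT] assms(6)[OF tT] t(1) True _ Cf0])
          fix \<omega>
          show "\<bar>f s (X t x s \<omega>) - f t x\<bar> \<le> 2 * Cf * ((s - t) + norm (X t x s \<omega> - x))"
            using space_time_gradient_bound_Lipschitz[OF assms(10) Cf s tT, of "X t x s \<omega>" x] True by simp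
        qed
        then show ?thesis by (rule mult_right_mono) simp
      next
        \<comment> \<open>Only s = t needs attention inside the interval: there the quotient is a
          division by 0, which evaluates to 0, and so does the integrand.\<close>
        case False then show ?thesis by (cases "s = t") (auto simp: indicator_def)
      qed
    qed
    also have "\<dots> < \<infinity>" by (simp add: nn_integral_cmult ennreal_mult_less_top emeasure_lborel_Icc_eq)
    finally show "(\<integral>\<^sup>+s\<in>{t..T}. (\<integral>\<^sup>+\<omega>. ennreal ((norm (((f s (X t x s \<omega>) - f t x) / (s - t)) *\<^sub>R
        ito_vec M F W t s (\<lambda>r \<omega>'. transpose (matrix_inv (\<sigma> r (X t x r \<omega>')) ** D t x r \<omega>')) \<omega>))\<^sup>2) \<partial>M) \<partial>lborel) < \<infinity>" .
  qed
qed

end
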